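(* In the following, $*$ denotes independent Haar-random variables valued in $\mathbb{Z}_p$. (a) Let $M_{n,n}$ be an $n\times n$ matrix over $\mathbb{Z}_p$ with cokernel $G\in X_0$. Then $d^*(G)$ is distributed as the cokernel of the random $(n+1)\times n$ matrix $$\begin{bmatrix} M_{n,n}\\ *\ \cdots\ *\end{bmatrix}$$ obtained by adjoining a row of $*$'s to $M_{n,n}$. (b) Let $M_{n+1,n}$ be an $(n+1)\times n$ matrix over $\mathbb{Z}_p$ with cokernel $H\in X_1$. Then $d(H)$ is distributed as the cokernel of the random $(n+1)\times(n+1)$ matrix $$\left[\begin{array}{c|c} M_{n+1,n} & \begin{array}{c} *\\ \vdots\\ *\end{array}\end{array}\right]$$ obtained by adjoining a column of $*$'s to $M_{n+1,n}$. (c) Let $M_{n,n}$ be an $n\times n$ matrix over $\mathbb{Z}_p$ with cokernel $G\in X_0$. Then $\Delta_0(G)$ is distributed as the cokernel of the random $(n+1)\times(n+1)$ matrix $$\left[\begin{array}{c|c} M_{n,n} & \begin{array}{c} *\\ \vdots\\ *\end{array}\\ \hline *\ \cdots\ * & *\end{array}\right]$$ obtained by adjoining a row and a column of $*$'s to $M_{n,n}$.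
   Context: Fix a prime $p$. $X_0$ is the set of isomorphism classes of finite abelian $p$-groups; $X_1$ is the set of isomorphism classes of finitely generated $\mathbb{Z}_p$-modules of $\mathbb{Q}_p$-rank $1$. The cokernel of an $m\times n$ matrix $M$ over $\mathbb{Z}_p$ is $\mathbb{Z}_p^m/M\mathbb{Z}_p^n$. The random operator $d$ from $X_1$ to $X_0$: $d(H)$ is the quotient of $H$ by (the submodule generated by) a Haar-random element of $H$ (almost surely finite). The random operator $d^*$ from $X_0$ to $X_1$: $d^*(G)$ is the middle term of the extension $0\to\mathbb{Z}_p\to H\to G\to 0$ corresponding to a uniformly random element of the finite group $\mathrm{Ext}(G,\mathbb{Z}_p)$. $\Delta_0=d\,d^*$ (first $d^*$, then $d$, independent choices), a random operator from $X_0$ to $X_0$. Equality in distribution is as random elements of $X_0$ or $X_1$ (isomorphism classes). *)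

theory Defs
  imports "HOL-Probability.Probability" "HOL-Algebra.Module" "HOL-Algebra.AbelCoset"
begin

section \<open>The $p$-adic integers\<close>

text \<open>$\mathbb{Z}_p$ is the inverse limit of the rings $\mathbb{Z}/p^k$: the $k$-th entry of a sequence
  is the residue modulo $p^k$, represented in $\{0,\dots,p^k-1\}$.\<close>

type_synonym zp = "nat \<Rightarrow> int"

definition Zp :: "nat \<Rightarrow> zp ring" where
  "Zp p = \<lparr> carrier = {x. \<forall>k. x k \<in> {0..<int p ^ k} \<and> x (Suc k) mod int p ^ k = x k},
            mult = (\<lambda>x y k. (x k * y k) mod int p ^ k),
            one = (\<lambda>k. 1 mod int p ^ k),
            zero = (\<lambda>k. 0),
            add = (\<lambda>x y k. (x k + y k) mod int p ^ k) \<rparr>"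

section \<open>Modules\<close>

text \<open>Module records inherit the fields \<open>mult\<close> and \<open>one\<close> from rings.  They play no role for
  modules, and nothing below depends on them.\<close>

definition regular_module :: "'a ring \<Rightarrow> ('a, 'a) module" where
  "regular_module R = \<lparr> carrier = carrier R, mult = mult R, one = one R, zero = \<zero>\<^bsub>R\<^esub>,
                        add = add R, smult = mult R \<rparr>"

definition module_hom :: "('a, 'r) ring_scheme \<Rightarrow> ('a, 'b, 'm) module_scheme \<Rightarrow>
    ('a, 'c, 'n) module_scheme \<Rightarrow> ('b \<Rightarrow> 'c) set" where
  "module_hom R M N = {f \<in> carrier M \<rightarrow> carrier N.
     (\<forall>x\<in>carrier M. \<forall>y\<in>carrier M. f (x \<oplus>\<^bsub>M\<^esub> y) = f x \<oplus>\<^bsub>N\<^esub> f y) \<and>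
     (\<forall>r\<in>carrier R. \<forall>x\<in>carrier M. f (r \<odot>\<^bsub>M\<^esub> x) = r \<odot>\<^bsub>N\<^esub> f x)}"

definition module_iso :: "('a, 'r) ring_scheme \<Rightarrow> ('a, 'b, 'm) module_scheme \<Rightarrow>
    ('a, 'c, 'n) module_scheme \<Rightarrow> ('b \<Rightarrow> 'c) set" where
  "module_iso R M N = {f \<in> module_hom R M N. bij_betw f (carrier M) (carrier N)}"

definition span :: "('a, 'r) ring_scheme \<Rightarrow> ('a, 'b, 'm) module_scheme \<Rightarrow> 'b set \<Rightarrow> 'b set" where
  "span R M S = \<Inter>{N. submodule N R M \<and> S \<subseteq> N}"

definition finitely_generated ::
    "('a, 'r) ring_scheme \<Rightarrow> ('a, 'b, 'm) module_scheme \<Rightarrow> bool" where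
  "finitely_generated R M \<longleftrightarrow> (\<exists>S. finite S \<and> S \<subseteq> carrier M \<and> span R M S = carrier M)"

definition lin_indep ::
    "('a, 'r) ring_scheme \<Rightarrow> ('a, 'b, 'm) module_scheme \<Rightarrow> 'b set \<Rightarrow> bool" where
  "lin_indep R M S \<longleftrightarrow> S \<subseteq> carrier M \<and>
     (\<forall>a \<in> S \<rightarrow> carrier R. (\<Oplus>\<^bsub>M\<^esub>s\<in>S. a s \<odot>\<^bsub>M\<^esub> s) = \<zero>\<^bsub>M\<^esub> \<longrightarrow> (\<forall>s\<in>S. a s = \<zero>\<^bsub>R\<^esub>))"

text \<open>Rank of a module over an integral domain: the maximal size of a linearly independent set.
  Over $\mathbb{Z}_p$ this is the dimension of $M \otimes \mathbb{Q}_p$ over $\mathbb{Q}_p$.\<close>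

definition has_rank ::
    "('a, 'r) ring_scheme \<Rightarrow> ('a, 'b, 'm) module_scheme \<Rightarrow> nat \<Rightarrow> bool" where
  "has_rank R M r \<longleftrightarrow> (\<exists>S. finite S \<and> lin_indep R M S \<and> card S = r) \<and>
                      (\<forall>S. finite S \<and> lin_indep R M S \<longrightarrow> card S \<le> r)"

definition quot_module :: "('a, 'b) module \<Rightarrow> 'b set \<Rightarrow> ('a, 'b set) module" where
  "quot_module M N = \<lparr> carrier = a_rcosets\<^bsub>M\<^esub> N, mult = undefined, one = undefined,
                       zero = N, add = set_add M,
                       smult = (\<lambda>r C. \<Union>x\<in>C. N +>\<^bsub>M\<^esub> (r \<odot>\<^bsub>M\<^esub> x)) \<rparr>"

section \<open>Matrices and cokernels\<close>

definition Zp_power :: "nat \<Rightarrow> nat \<Rightarrow> (zp, nat \<Rightarrow> zp) module" where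
  "Zp_power p m = \<lparr> carrier = {..<m} \<rightarrow>\<^sub>E carrier (Zp p), mult = undefined, one = undefined,
                    zero = (\<lambda>i\<in>{..<m}. \<zero>\<^bsub>Zp p\<^esub>),
                    add = (\<lambda>v w. \<lambda>i\<in>{..<m}. v i \<oplus>\<^bsub>Zp p\<^esub> w i),
                    smult = (\<lambda>r v. \<lambda>i\<in>{..<m}. r \<otimes>\<^bsub>Zp p\<^esub> v i) \<rparr>"

text \<open>The entry in row \<open>i\<close> and column \<open>j\<close> of a matrix \<open>M\<close> is \<open>M (i, j)\<close>; rows and columns are
  numbered from 0.  Entries outside the format of the matrix are ignored.\<close>

definition is_matrix :: "nat \<Rightarrow> nat \<Rightarrow> nat \<Rightarrow> (nat \<times> nat \<Rightarrow> zp) \<Rightarrow> bool" where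
  "is_matrix p m n M \<longleftrightarrow> (\<forall>i<m. \<forall>j<n. M (i, j) \<in> carrier (Zp p))"

definition mat_vec ::
    "nat \<Rightarrow> nat \<Rightarrow> nat \<Rightarrow> (nat \<times> nat \<Rightarrow> zp) \<Rightarrow> (nat \<Rightarrow> zp) \<Rightarrow> nat \<Rightarrow> zp" where
  "mat_vec p m n M v = (\<lambda>i\<in>{..<m}. \<Oplus>\<^bsub>Zp p\<^esub>j\<in>{..<n}. M (i, j) \<otimes>\<^bsub>Zp p\<^esub> v j)"

definition coker ::
    "nat \<Rightarrow> nat \<Rightarrow> nat \<Rightarrow> (nat \<times> nat \<Rightarrow> zp) \<Rightarrow> (zp, (nat \<Rightarrow> zp) set) module" where
  "coker p m n M = quot_module (Zp_power p m) (mat_vec p m n M ` carrier (Zp_power p n))"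

section \<open>Isomorphism classes\<close>

text \<open>All isomorphism classes are formed inside one type of modules, that of the cokernels.
  Every finitely generated $\mathbb{Z}_p$-module, over whatever carrier type, is isomorphic to some
  $\mathbb{Z}_p^m/N$ and hence has a nonempty class here.\<close>

type_synonym zp_module = "(zp, (nat \<Rightarrow> zp) set) module"

definition iso_class :: "nat \<Rightarrow> (zp, 'b, 'm) module_scheme \<Rightarrow> zp_module set" where
  "iso_class p M = {K. module (Zp p) K \<and> module_iso (Zp p) K M \<noteq> {}}"

text \<open>Finite abelian $p$-groups are regarded as $\mathbb{Z}_p$-modules: the module structure exists and
  is unique, and every additive map between them is $\mathbb{Z}_p$-linear.\<close>

definition X0 :: "nat \<Rightarrow> zp_module set set" where
  "X0 p = {iso_class p G | G :: zp_module.
             module (Zp p) G \<and> finite (carrier G) \<and> (\<exists>k. card (carrier G) = p ^ k)}"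

definition X1 :: "nat \<Rightarrow> zp_module set set" where
  "X1 p = {iso_class p H | H :: zp_module.
             module (Zp p) H \<and> finitely_generated (Zp p) H \<and> has_rank (Zp p) H 1}"

definition rep :: "zp_module set \<Rightarrow> zp_module" where
  "rep c = (SOME K. K \<in> c)"

section \<open>Haar probability measure\<close>

text \<open>The topology is the $p$-adic one, in which the subgroups $p^k H$ form a neighbourhood basis of
  0; for finitely generated $H$ it is the compact topology induced from $\mathbb{Z}_p^m$.  Only the
  additive structure is used, so that \<open>haar\<close> applies to the ring $\mathbb{Z}_p$ and to modules alike.\<close>

definition padic_open :: "nat \<Rightarrow> ('a, 'm) ring_scheme \<Rightarrow> 'a set \<Rightarrow> bool" where
  "padic_open p H U \<longleftrightarrow> U \<subseteq> carrier H \<and>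
     (\<forall>x\<in>U. \<exists>k::nat. \<forall>y\<in>carrier H. x \<oplus>\<^bsub>H\<^esub> add_pow H (p ^ k) y \<in> U)"

definition is_haar :: "nat \<Rightarrow> ('a, 'm) ring_scheme \<Rightarrow> 'a measure \<Rightarrow> bool" where
  "is_haar p H \<mu> \<longleftrightarrow>
     space \<mu> = carrier H \<and>
     sets \<mu> = sigma_sets (carrier H) {U. padic_open p H U} \<and>
     prob_space \<mu> \<and>
     (\<forall>a\<in>carrier H. \<forall>A\<in>sets \<mu>. emeasure \<mu> ((\<lambda>x. a \<oplus>\<^bsub>H\<^esub> x) ` A) = emeasure \<mu> A)"

definition haar :: "nat \<Rightarrow> ('a, 'm) ring_scheme \<Rightarrow> 'a measure" where
  "haar p H = (THE \<mu>. is_haar p H \<mu>)"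

section \<open>Laws of random elements\<close>

text \<open>A random element of the countable set \<open>S\<close> need only be \<open>S\<close>-valued almost surely; its law is
  a measure on all subsets of \<open>S\<close>.\<close>

definition random_element :: "'w measure \<Rightarrow> ('w \<Rightarrow> 'c) \<Rightarrow> 'c set \<Rightarrow> bool" where
  "random_element P f S \<longleftrightarrow> (\<forall>A\<subseteq>S. f -` A \<inter> space P \<in> sets P) \<and> (AE w in P. f w \<in> S)"

definition law :: "'w measure \<Rightarrow> ('w \<Rightarrow> 'c) \<Rightarrow> 'c set \<Rightarrow> 'c measure" where
  "law P f S = distr (restrict_space P (f -` S \<inter> space P)) (count_space S) f"

definition distributed_as :: "'w measure \<Rightarrow> ('w \<Rightarrow> 'c) \<Rightarrow> 'c set \<Rightarrow> 'c measure \<Rightarrow> bool" where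
  "distributed_as P f S \<mu> \<longleftrightarrow> random_element P f S \<and> law P f S = \<mu>"

text \<open>\<open>X i\<close>, for \<open>i \<in> I\<close>, are independent Haar-random elements of $\mathbb{Z}_p$ on the
  probability space \<open>P\<close>.\<close>

definition indep_haar :: "nat \<Rightarrow> 'w measure \<Rightarrow> ('i \<Rightarrow> 'w \<Rightarrow> zp) \<Rightarrow> 'i set \<Rightarrow> bool" where
  "indep_haar p P X I \<longleftrightarrow> prob_space.indep_vars P (\<lambda>_. haar p (Zp p)) X I \<and>
     (\<forall>i\<in>I. distr P (haar p (Zp p)) (X i) = haar p (Zp p))"

section \<open>Extensions by the $p$-adic integers\<close>

text \<open>\<open>(H, i, q)\<close> is an extension \<open>0 \<rightarrow> Z\<^sub>p \<rightarrow> H \<rightarrow> G \<rightarrow> 0\<close> with maps \<open>i\<close> and \<open>q\<close>.  As a set, \<open>H\<close> is in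
  bijection with \<open>Z\<^sub>p \<times> G\<close>, so every extension is equivalent to one carried by that type.\<close>

type_synonym 'g extension = "(zp, zp \<times> 'g) module \<times> (zp \<Rightarrow> zp \<times> 'g) \<times> (zp \<times> 'g \<Rightarrow> 'g)"

definition extensions :: "nat \<Rightarrow> (zp, 'g) module \<Rightarrow> 'g extension set" where
  "extensions p G = {(H, i, q).
     module (Zp p) H \<and>
     i \<in> module_hom (Zp p) (regular_module (Zp p)) H \<and>
     q \<in> module_hom (Zp p) H G \<and>
     inj_on i (carrier (Zp p)) \<and>
     q ` carrier H = carrier G \<and>
     i ` carrier (Zp p) = {x \<in> carrier H. q x = \<zero>\<^bsub>G\<^esub>}}"

definition ext_rel :: "nat \<Rightarrow> (zp, 'g) module \<Rightarrow> ('g extension \<times> 'g extension) set" where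
  "ext_rel p G = {((H, i, q), (H', i', q')).
     (H, i, q) \<in> extensions p G \<and> (H', i', q') \<in> extensions p G \<and>
     (\<exists>f \<in> module_iso (Zp p) H H'.
        (\<forall>x\<in>carrier (Zp p). f (i x) = i' x) \<and> (\<forall>y\<in>carrier H. q' (f y) = q y))}"

text \<open>The underlying set of \<open>Ext(G, Z\<^sub>p)\<close> as equivalence classes of extensions (Yoneda).  The Baer
  sum is not needed to speak of a uniformly random element.\<close>

definition Ext :: "nat \<Rightarrow> (zp, 'g) module \<Rightarrow> 'g extension set set" where
  "Ext p G = extensions p G // ext_rel p G"

definition middle_class :: "nat \<Rightarrow> 'g extension set \<Rightarrow> zp_module set" where
  "middle_class p e = iso_class p (fst (SOME E. E \<in> e))"

section \<open>The random operators\<close>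

text \<open>The random operators $d$, $d^*$ and $\Delta_0 = d\,d^*$ send an isomorphism class to the law of
  the resulting random class.  The monadic composition makes the two choices in $\Delta_0$
  independently: given the outcome \<open>c'\<close> of $d^*$, the second choice has law \<open>op_d p c'\<close>.\<close>

definition op_d :: "nat \<Rightarrow> zp_module set \<Rightarrow> zp_module set measure" where
  "op_d p c = law (haar p (rep c))
     (\<lambda>h. iso_class p (quot_module (rep c) (span (Zp p) (rep c) {h}))) (X0 p)"

definition op_dstar :: "nat \<Rightarrow> zp_module set \<Rightarrow> zp_module set measure" where
  "op_dstar p c = law (uniform_count_measure (Ext p (rep c))) (middle_class p) (X1 p)"

definition op_Delta0 :: "nat \<Rightarrow> zp_module set \<Rightarrow> zp_module set measure" where
  "op_Delta0 p c = op_dstar p c \<bind> op_d p"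

end

theory Submission
  imports Defs "HOL-Algebra.Sylow" "HOL-Algebra.Multiplicative_Group"
begin

text \<open>Let \<open>M\<close> be a square matrix with finite cokernel \<open>G\<close>, killed by \<open>p ^ k\<close>, and let \<open>\<psi>\<close> be the
  projection onto \<open>G\<close>.  Then \<open>M\<close> is injective, because \<open>p ^ k\<close> factors through \<open>M\<close> and \<open>n + 1\<close>
  vectors of length \<open>n\<close> are linearly dependent (\<open>finite_cokernel_injective\<close>).

  \<^bold>\<open>Adjoining a row.\<close>  Let \<open>0 \<rightarrow> \<int>\<^sub>p \<rightarrow> H \<rightarrow> G \<rightarrow> 0\<close> be an extension.  Lift \<open>\<psi>\<close> to a linear map \<open>g\<close>
  into \<open>H\<close>.  On the columns of \<open>M\<close> the lift takes values in \<open>\<int>\<^sub>p\<close>, so it produces a row \<open>r\<close>, and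
  the map \<open>(v, a) \<mapsto> g v + a\<close> presents \<open>H\<close> as the cokernel of \<open>M\<close> with this row adjoined
  (up to the sign of \<open>r\<close>).  Another lift differs from \<open>g\<close> by a functional \<open>w\<close>, and changes \<open>r\<close> by
  the combination \<open>w M\<close> of the rows of \<open>M\<close>.  Hence \<open>Ext(G, \<int>\<^sub>p)\<close> is the quotient of the module of
  rows by the row space of \<open>M\<close>, and the latter contains all multiples of \<open>p ^ k\<close>.  As Haar measure is
  translation invariant, all cosets of the row space have the same measure, that is, the class
  of the extension defined by a Haar-random row is uniform on the finite set \<open>Ext(G, \<int>\<^sub>p)\<close>
  (\<open>ext_of_row_uniform\<close>).

  \<^bold>\<open>Adjoining a column.\<close>  The cokernel of \<open>M\<close> with a column \<open>c\<close> adjoined is the quotient of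
  \<open>H = coker M\<close> by the image of \<open>c\<close> (\<open>coker_new_column\<close>).  A surjective linear map from a free module
  to \<open>H\<close> carries Haar measure to Haar measure (\<open>haar_quotient\<close>), so the image of a Haar-random column
  is a Haar-random element of \<open>H\<close>.  That the quotient is almost surely finite uses the rank: as \<open>H\<close> has
  rank one, an element with infinite quotient is torsion, and the torsion elements are a null set,
  because the translates of this set by the multiples of a nontorsion element are disjoint
  (\<open>torsion_null\<close>).  The class of the quotient is a measurable function, because it is locally
  constant where the quotient is finite: if \<open>p ^ k\<close> kills the cokernel of a matrix, then changing
  the entries by multiples of \<open>p ^ (k + 1)\<close> does not affect its image, by Nakayama's lemma in the form of
  successive approximation (\<open>image_locally_constant\<close>).

  \<^bold>\<open>Adjoining both.\<close>  The new row without the corner and the new column with the corner are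
  independent.  For a fixed row, the random column realises \<open>op_d\<close> of the class defined by that row,
  and this class has law \<open>op_dstar\<close>.  By Fubini's theorem the joint law is the monadic composition.\<close>

section \<open>Homomorphisms, quotients and isomorphism classes of modules\<close>

lemma (in abelian_group) diff_eq_zero_iff:
  assumes "x \<in> carrier G" "y \<in> carrier G"
  shows "x \<ominus> y = \<zero> \<longleftrightarrow> x = y"
proof
  assume "x \<ominus> y = \<zero>"
  then have "x \<oplus> \<ominus> y = \<zero>" by (simp add: a_minus_def)
  then show "x = y" using assms add.inv_equality[of x "\<ominus> y"] by simp
qed (use assms in \<open>simp add: a_minus_def r_neg\<close>)

lemma module_homD:
  assumes "f \<in> module_hom R M N"
  shows "x \<in> carrier M \<Longrightarrow> f x \<in> carrier N"
    and "\<lbrakk>x \<in> carrier M; y \<in> carrier M\<rbrakk> \<Longrightarrow> f (x \<oplus>\<^bsub>M\<^esub> y) = f x \<oplus>\<^bsub>N\<^esub> f y"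
    and "\<lbrakk>r \<in> carrier R; x \<in> carrier M\<rbrakk> \<Longrightarrow> f (r \<odot>\<^bsub>M\<^esub> x) = r \<odot>\<^bsub>N\<^esub> f x"
  using assms by (auto simp: module_hom_def)

lemma module_homI:
  assumes "\<And>x. x \<in> carrier M \<Longrightarrow> f x \<in> carrier N"
    and "\<And>x y. \<lbrakk>x \<in> carrier M; y \<in> carrier M\<rbrakk> \<Longrightarrow> f (x \<oplus>\<^bsub>M\<^esub> y) = f x \<oplus>\<^bsub>N\<^esub> f y"
    and "\<And>r x. \<lbrakk>r \<in> carrier R; x \<in> carrier M\<rbrakk> \<Longrightarrow> f (r \<odot>\<^bsub>M\<^esub> x) = r \<odot>\<^bsub>N\<^esub> f x"
  shows "f \<in> module_hom R M N"
  using assms by (auto simp: module_hom_def)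

lemma module_hom_zero:
  assumes "module R M" "module R N" "f \<in> module_hom R M N"
  shows "f \<zero>\<^bsub>M\<^esub> = \<zero>\<^bsub>N\<^esub>"
proof -
  interpret M: Module.module R M by fact
  interpret N: Module.module R N by fact
  have "f (\<zero>\<^bsub>R\<^esub> \<odot>\<^bsub>M\<^esub> \<zero>\<^bsub>M\<^esub>) = \<zero>\<^bsub>R\<^esub> \<odot>\<^bsub>N\<^esub> f \<zero>\<^bsub>M\<^esub>"
    by (intro module_homD(3)[OF assms(3)]) auto
  then show ?thesis using module_homD(1)[OF assms(3)] by simp
qed

lemma module_hom_neg:
  assumes "module R M" "module R N" "f \<in> module_hom R M N" "x \<in> carrier M"
  shows "f (\<ominus>\<^bsub>M\<^esub> x) = \<ominus>\<^bsub>N\<^esub> f x"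
proof -
  interpret M: Module.module R M by fact
  interpret N: Module.module R N by fact
  have "f (\<ominus>\<^bsub>M\<^esub> x) \<oplus>\<^bsub>N\<^esub> f x = f (\<ominus>\<^bsub>M\<^esub> x \<oplus>\<^bsub>M\<^esub> x)"
    using assms(4) by (intro module_homD(2)[OF assms(3), symmetric]) auto
  also have "\<dots> = \<zero>\<^bsub>N\<^esub>" using assms module_hom_zero[OF assms(1-3)] by (simp add: M.l_neg)
  finally show ?thesis
    using module_homD(1)[OF assms(3)] assms(4) by (intro N.minus_equality[symmetric]) auto
qed

lemma module_hom_diff:
  assumes "module R M" "module R N" "f \<in> module_hom R M N" "x \<in> carrier M" "y \<in> carrier M"
  shows "f (x \<ominus>\<^bsub>M\<^esub> y) = f x \<ominus>\<^bsub>N\<^esub> f y"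
proof -
  interpret M: Module.module R M by fact
  show ?thesis
    unfolding a_minus_def using assms(4,5)
    by (simp add: module_homD(2)[OF assms(3)] module_hom_neg[OF assms(1-3)])
qed

lemma module_hom_comp:
  assumes "f \<in> module_hom R M N" "g \<in> module_hom R N K"
  shows "(\<lambda>x. g (f x)) \<in> module_hom R M K"
  using assms by (auto simp: module_hom_def Pi_iff)

lemma module_hom_add:
  assumes N: "module R N" and f: "f \<in> module_hom R M N" and g: "g \<in> module_hom R M N"
  shows "(\<lambda>x. f x \<oplus>\<^bsub>N\<^esub> g x) \<in> module_hom R M N"
proof -
  interpret N: Module.module R N by fact
  note [simp] = module_homD[OF f] module_homD[OF g]
  show ?thesis
    by (rule module_homI) (simp_all add: N.smult_r_distr N.add.m_ac)
qed

lemma module_hom_uminus: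
  assumes N: "module R N" and f: "f \<in> module_hom R M N"
  shows "(\<lambda>x. \<ominus>\<^bsub>N\<^esub> f x) \<in> module_hom R M N"
proof -
  interpret N: Module.module R N by fact
  note [simp] = module_homD[OF f]
  show ?thesis
    by (rule module_homI) (simp_all add: N.smult_r_minus N.minus_add)
qed

lemma module_hom_minus:
  assumes N: "module R N" and f: "f \<in> module_hom R M N" and g: "g \<in> module_hom R M N"
  shows "(\<lambda>x. f x \<ominus>\<^bsub>N\<^esub> g x) \<in> module_hom R M N"
  using module_hom_add[OF N f module_hom_uminus[OF N g]] by (simp add: a_minus_def)

lemma module_hom_smult:
  assumes N: "module R N" and a: "a \<in> carrier R"
  shows "(\<lambda>x. a \<odot>\<^bsub>N\<^esub> x) \<in> module_hom R N N"
proof -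
  interpret N: Module.module R N by fact
  show ?thesis
    using a by (intro module_homI) (auto simp: N.smult_r_distr N.smult_assoc1[symmetric] N.R.m_comm)
qed

lemma module_hom_fibre:
  assumes "module R M" "module R N" "f \<in> module_hom R M N" "x \<in> carrier M" "y \<in> carrier M"
  shows "f x = f y \<longleftrightarrow> f (x \<ominus>\<^bsub>M\<^esub> y) = \<zero>\<^bsub>N\<^esub>"
proof -
  interpret N: Module.module R N by fact
  show ?thesis using assms module_homD(1)[OF assms(3)]
    by (simp add: module_hom_diff[OF assms(1-3)] N.diff_eq_zero_iff)
qed

text \<open>The universal property of a quotient, for an arbitrary surjection in place of the canonical
  projection.\<close>

lemma module_hom_factor:
  assumes N: "module R N" and K: "module R K" and L: "module R L"
    and f: "f \<in> module_hom R N K" "f ` carrier N = carrier K"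
    and g: "g \<in> module_hom R N L"
    and ker: "\<And>x. x \<in> carrier N \<Longrightarrow> f x = \<zero>\<^bsub>K\<^esub> \<Longrightarrow> g x = \<zero>\<^bsub>L\<^esub>"
  obtains h where "h \<in> module_hom R K L" "\<And>x. x \<in> carrier N \<Longrightarrow> h (f x) = g x"
proof -
  interpret N: Module.module R N by fact
  note [simp] = module_homD[OF f(1)] module_homD[OF g]
  define h where "h y = g (inv_into (carrier N) f y)" for y
  have h: "h (f x) = g x" if x: "x \<in> carrier N" for x
  proof -
    let ?x = "inv_into (carrier N) f (f x)"
    have x': "?x \<in> carrier N" "f ?x = f x"
      using x by (auto intro: inv_into_into f_inv_into_f)
    have "g ?x = g x"
      using ker x x' module_hom_fibre[OF N K f(1), of ?x x] module_hom_fibre[OF N L g, of ?x x]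
      by auto
    then show ?thesis by (simp add: h_def)
  qed
  have "h \<in> module_hom R K L"
  proof (rule module_homI)
    fix x assume "x \<in> carrier K"
    then obtain x' where "x' \<in> carrier N" "x = f x'" using f(2) by blast
    then show "h x \<in> carrier L" by (simp add: h)
  next
    fix x y assume "x \<in> carrier K" "y \<in> carrier K"
    then obtain x' y' where "x' \<in> carrier N" "x = f x'" "y' \<in> carrier N" "y = f y'"
      using f(2) by blast
    then show "h (x \<oplus>\<^bsub>K\<^esub> y) = h x \<oplus>\<^bsub>L\<^esub> h y"
      by (simp add: h module_homD(2)[OF f(1), symmetric] del: module_homD(2)[OF f(1)])
  next
    fix r x assume "r \<in> carrier R" "x \<in> carrier K"
    moreover then obtain x' where "x' \<in> carrier N" "x = f x'" using f(2) by blast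
    ultimately show "h (r \<odot>\<^bsub>K\<^esub> x) = r \<odot>\<^bsub>L\<^esub> h x"
      by (simp add: h module_homD(3)[OF f(1), symmetric] del: module_homD(3)[OF f(1)])
  qed
  with h show ?thesis using that by blast
qed

text \<open>All isomorphisms below arise in this way: two quotients of one free module are compared
  through their kernels.\<close>

lemma same_kernel_module_iso:
  assumes N: "module R N" and K: "module R K" and L: "module R L"
    and f: "f \<in> module_hom R N K" "f ` carrier N = carrier K"
    and g: "g \<in> module_hom R N L" "g ` carrier N = carrier L"
    and ker: "\<And>x. x \<in> carrier N \<Longrightarrow> f x = \<zero>\<^bsub>K\<^esub> \<longleftrightarrow> g x = \<zero>\<^bsub>L\<^esub>"
  obtains h where "h \<in> module_iso R K L" "\<And>x. x \<in> carrier N \<Longrightarrow> h (f x) = g x"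
proof -
  obtain h where h: "h \<in> module_hom R K L" "\<And>x. x \<in> carrier N \<Longrightarrow> h (f x) = g x"
    using module_hom_factor[OF N K L f g(1)] ker by blast
  have "inj_on h (carrier K)"
  proof (rule inj_onI)
    fix x y assume "x \<in> carrier K" "y \<in> carrier K" and eq: "h x = h y"
    then obtain x' y' where x': "x' \<in> carrier N" "x = f x'" "y' \<in> carrier N" "y = f y'"
      using f(2) by blast
    interpret N: Module.module R N by fact
    have "g (x' \<ominus>\<^bsub>N\<^esub> y') = \<zero>\<^bsub>L\<^esub>"
      using eq x' h(2) module_hom_fibre[OF N L g(1), of x' y'] by simp
    then show "x = y" using x' ker[of "x' \<ominus>\<^bsub>N\<^esub> y'"] module_hom_fibre[OF N K f(1), of x' y'] by simp
  qed
  moreover have "h ` carrier K = carrier L"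
    using h(2) f(2) g(2) by (metis (no_types, lifting) image_cong image_image)
  ultimately show ?thesis using h that by (auto simp: module_iso_def bij_betw_def)
qed

lemma module_isoD:
  assumes "f \<in> module_iso R M N"
  shows "f \<in> module_hom R M N" "f ` carrier M = carrier N" "inj_on f (carrier M)"
    "bij_betw f (carrier M) (carrier N)"
  using assms by (auto simp: module_iso_def bij_betw_def)

lemma module_iso_kernel:
  assumes "module R M" "module R N" "f \<in> module_iso R M N" "x \<in> carrier M"
  shows "f x = \<zero>\<^bsub>N\<^esub> \<longleftrightarrow> x = \<zero>\<^bsub>M\<^esub>"
proof -
  interpret M: Module.module R M by fact
  show ?thesis
    using module_hom_zero[OF assms(1,2) module_isoD(1)[OF assms(3)]] module_isoD(3)[OF assms(3)] assms(4)
    by (metis M.zero_closed inj_onD)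
qed

lemma module_iso_refl: "module R M \<Longrightarrow> (\<lambda>x. x) \<in> module_iso R M M"
  by (auto simp: module_iso_def module_hom_def bij_betw_def)

lemma module_iso_comp:
  assumes "f \<in> module_iso R M N" "g \<in> module_iso R N K"
  shows "(\<lambda>x. g (f x)) \<in> module_iso R M K"
  using assms bij_betw_trans[of f "carrier M" "carrier N" g "carrier K"]
  by (auto simp: module_iso_def comp_def intro: module_hom_comp)

lemma module_iso_inverse:
  assumes M: "module R M" and N: "module R N" and f: "f \<in> module_iso R M N"
  obtains g where "g \<in> module_iso R N M" "\<And>x. x \<in> carrier M \<Longrightarrow> g (f x) = x"
  using same_kernel_module_iso[OF M N M module_isoD(1,2)[OF f] module_isoD(1,2)[OF module_iso_refl[OF M]]]
    module_iso_kernel[OF M N f] by metis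

subsection \<open>Quotients and cyclic submodules\<close>

lemma quot_module:
  fixes M :: "('a, 'b) module"
  assumes M: "module R M" and N: "submodule N R M"
  shows "module R (quot_module M N)"
    and "(\<lambda>x. N +>\<^bsub>M\<^esub> x) \<in> module_hom R M (quot_module M N)"
    and "(\<lambda>x. N +>\<^bsub>M\<^esub> x) ` carrier M = carrier (quot_module M N)"
    and "\<And>x. x \<in> carrier M \<Longrightarrow> N +>\<^bsub>M\<^esub> x = \<zero>\<^bsub>quot_module M N\<^esub> \<longleftrightarrow> x \<in> N"
proof -
  interpret Module.module R M by fact
  interpret N: abelian_subgroup N M
    using N by (intro abelian_subgroupI3) (auto simp: additive_subgroup_def submodule_def M.abelian_group_axioms)
  have sub: "N \<subseteq> carrier M" and smN: "\<And>a x. a \<in> carrier R \<Longrightarrow> x \<in> N \<Longrightarrow> a \<odot>\<^bsub>M\<^esub> x \<in> N"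
    using submoduleE[OF N] by auto
  let ?Q = "quot_module M N"
  have carr: "carrier ?Q = (\<lambda>x. N +>\<^bsub>M\<^esub> x) ` carrier M"
    by (auto simp: quot_module_def A_RCOSETS_def')
  have add: "(N +>\<^bsub>M\<^esub> x) \<oplus>\<^bsub>?Q\<^esub> (N +>\<^bsub>M\<^esub> y) = N +>\<^bsub>M\<^esub> (x \<oplus>\<^bsub>M\<^esub> y)" if "x \<in> carrier M" "y \<in> carrier M" for x y
    using that by (simp add: quot_module_def N.a_rcos_sum)
  have sm: "r \<odot>\<^bsub>?Q\<^esub> (N +>\<^bsub>M\<^esub> x) = N +>\<^bsub>M\<^esub> (r \<odot>\<^bsub>M\<^esub> x)" if r: "r \<in> carrier R" and x: "x \<in> carrier M" for r x
  proof -
    have "N +>\<^bsub>M\<^esub> (r \<odot>\<^bsub>M\<^esub> y) = N +>\<^bsub>M\<^esub> (r \<odot>\<^bsub>M\<^esub> x)" if y: "y \<in> N +>\<^bsub>M\<^esub> x" for y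
    proof -
      obtain n where n: "n \<in> N" "y = n \<oplus>\<^bsub>M\<^esub> x" using y by (auto simp: a_r_coset_def')
      then have "r \<odot>\<^bsub>M\<^esub> y = r \<odot>\<^bsub>M\<^esub> n \<oplus>\<^bsub>M\<^esub> r \<odot>\<^bsub>M\<^esub> x" using r x sub by (auto simp: smult_r_distr)
      then have "r \<odot>\<^bsub>M\<^esub> y \<in> N +>\<^bsub>M\<^esub> (r \<odot>\<^bsub>M\<^esub> x)" using smN[OF r n(1)] by (auto simp: a_r_coset_def')
      then show ?thesis using r x N.a_repr_independence' by (metis smult_closed)
    qed
    moreover have "x \<in> N +>\<^bsub>M\<^esub> x" using x by (rule N.a_rcos_self)
    ultimately have "(\<Union>y\<in>N +>\<^bsub>M\<^esub> x. N +>\<^bsub>M\<^esub> (r \<odot>\<^bsub>M\<^esub> y)) = N +>\<^bsub>M\<^esub> (r \<odot>\<^bsub>M\<^esub> x)"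
      by blast
    then show ?thesis by (simp add: quot_module_def)
  qed
  have zero: "\<zero>\<^bsub>?Q\<^esub> = N +>\<^bsub>M\<^esub> \<zero>\<^bsub>M\<^esub>"
    using sub by (simp add: quot_module_def)
  have "abelian_group ?Q"
  proof (rule abelian_groupI)
    fix x assume "x \<in> carrier ?Q"
    then obtain a where a: "a \<in> carrier M" "x = N +>\<^bsub>M\<^esub> a" by (auto simp: carr)
    show "\<exists>y\<in>carrier ?Q. y \<oplus>\<^bsub>?Q\<^esub> x = \<zero>\<^bsub>?Q\<^esub>"
      using a by (intro bexI[of _ "N +>\<^bsub>M\<^esub> (\<ominus>\<^bsub>M\<^esub> a)"]) (auto simp: carr add zero M.l_neg)
  qed (auto simp: carr add zero M.add.m_ac)
  then show "module R ?Q"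
    by (intro moduleI R.is_cring) (auto simp: carr sm add smult_l_distr smult_r_distr smult_assoc1)
  show "(\<lambda>x. N +>\<^bsub>M\<^esub> x) \<in> module_hom R M ?Q"
    by (intro module_homI) (auto simp: carr add sm)
  show "(\<lambda>x. N +>\<^bsub>M\<^esub> x) ` carrier M = carrier ?Q" by (simp add: carr)
  show "N +>\<^bsub>M\<^esub> x = \<zero>\<^bsub>?Q\<^esub> \<longleftrightarrow> x \<in> N" if "x \<in> carrier M" for x
    using that N.a_rcos_self[OF that] N.a_rcos_const[of x] by (auto simp: quot_module_def)
qed

lemma (in Module.module) submodule_image:
  assumes N: "module R N" and f: "f \<in> module_hom R N M"
  shows "submodule (f ` carrier N) R M"
proof -
  interpret N: Module.module R N by fact
  note h = module_homD[OF f]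
  show ?thesis
  proof (rule submoduleI)
    show "\<zero>\<^bsub>M\<^esub> \<in> f ` carrier N"
      using module_hom_zero[OF N module_axioms f] by (metis N.M.zero_closed imageI)
    show "\<ominus>\<^bsub>M\<^esub> a \<in> f ` carrier N" if "a \<in> f ` carrier N" for a
      using that module_hom_neg[OF N module_axioms f] by (metis (no_types, lifting) N.M.a_inv_closed image_iff)
    show "a \<oplus>\<^bsub>M\<^esub> b \<in> f ` carrier N" if "a \<in> f ` carrier N" "b \<in> f ` carrier N" for a b
      using that h(2) by (metis (no_types, lifting) N.M.a_closed image_iff)
    show "a \<odot>\<^bsub>M\<^esub> x \<in> f ` carrier N" if "a \<in> carrier R" "x \<in> f ` carrier N" for a x
      using that h(3) by (metis (no_types, lifting) N.smult_closed image_iff)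
  qed (use h in auto)
qed

lemma (in Module.module) span_minimal:
  assumes "submodule N R M" "S \<subseteq> N" shows "span R M S \<subseteq> N"
  using assms by (auto simp: span_def)

lemma (in Module.module) span_singleton:
  assumes h: "h \<in> carrier M"
  shows "span R M {h} = {r \<odot>\<^bsub>M\<^esub> h | r. r \<in> carrier R}" and "submodule (span R M {h}) R M"
proof -
  have sub: "submodule {r \<odot>\<^bsub>M\<^esub> h | r. r \<in> carrier R} R M" (is "submodule ?S R M")
  proof (rule submoduleI)
    show "\<zero>\<^bsub>M\<^esub> \<in> ?S" using h by (auto intro!: exI[of _ "\<zero>\<^bsub>R\<^esub>"])
    show "\<ominus>\<^bsub>M\<^esub> a \<in> ?S" if "a \<in> ?S" for a
      using that h by (auto simp: smult_l_minus[symmetric] intro: R.a_inv_closed)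
    show "a \<oplus>\<^bsub>M\<^esub> b \<in> ?S" if "a \<in> ?S" "b \<in> ?S" for a b
      using that h by (auto simp: smult_l_distr[symmetric] intro: R.a_closed)
    show "a \<odot>\<^bsub>M\<^esub> x \<in> ?S" if "a \<in> carrier R" "x \<in> ?S" for a x
      using that h by (auto simp: smult_assoc1[symmetric] intro: R.m_closed)
  qed (use h in auto)
  have "h \<in> ?S" using h by (auto intro!: exI[of _ "\<one>\<^bsub>R\<^esub>"])
  then have "span R M {h} \<subseteq> ?S" using sub span_minimal by blast
  moreover have "?S \<subseteq> span R M {h}"
    using submoduleE(4) by (auto simp: span_def)
  ultimately show "span R M {h} = ?S" by blast
  with sub show "submodule (span R M {h}) R M" by simp
qed

text \<open>Extensions in \<open>Ext\<close> live on subsets of one particular type.  Transport along a bijection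
  moves an extension constructed elsewhere to that type.\<close>

lemma module_transport:
  assumes H: "module R H" and bij: "bij_betw b (carrier H) Y"
  obtains K :: "('a, 'c) module" where "module R K" "carrier K = Y" "b \<in> module_iso R H K"
proof -
  interpret H: Module.module R H by fact
  define c where "c = inv_into (carrier H) b"
  have c: "\<And>x. x \<in> carrier H \<Longrightarrow> c (b x) = x" "\<And>y. y \<in> Y \<Longrightarrow> c y \<in> carrier H" "\<And>y. y \<in> Y \<Longrightarrow> b (c y) = y"
    and b: "\<And>x. x \<in> carrier H \<Longrightarrow> b x \<in> Y"
    using bij by (auto simp: c_def bij_betw_def inv_into_into f_inv_into_f)
  define K :: "('a, 'c) module" where
    "K = \<lparr>carrier = Y, mult = undefined, one = undefined, zero = b \<zero>\<^bsub>H\<^esub>,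
          add = (\<lambda>x y. b (c x \<oplus>\<^bsub>H\<^esub> c y)), smult = (\<lambda>r x. b (r \<odot>\<^bsub>H\<^esub> c x))\<rparr>"
  have K[simp]: "carrier K = Y" "\<zero>\<^bsub>K\<^esub> = b \<zero>\<^bsub>H\<^esub>" "\<And>x y. x \<oplus>\<^bsub>K\<^esub> y = b (c x \<oplus>\<^bsub>H\<^esub> c y)"
    "\<And>r x. r \<odot>\<^bsub>K\<^esub> x = b (r \<odot>\<^bsub>H\<^esub> c x)" by (auto simp: K_def)
  have "abelian_group K"
  proof (rule abelian_groupI)
    fix x assume "x \<in> carrier K"
    then show "\<exists>y\<in>carrier K. y \<oplus>\<^bsub>K\<^esub> x = \<zero>\<^bsub>K\<^esub>"
      using b c by (intro bexI[of _ "b (\<ominus>\<^bsub>H\<^esub> c x)"]) (auto simp: H.M.l_neg)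
  qed (use b c in \<open>auto simp: H.M.add.m_ac\<close>)
  then have "module R K"
    by (intro moduleI H.is_cring) (use b c in \<open>auto simp: H.smult_l_distr H.smult_r_distr H.smult_assoc1\<close>)
  moreover have "b \<in> module_iso R H K"
    using bij b c by (auto simp: module_iso_def intro!: module_homI)
  ultimately show ?thesis using that by simp
qed

subsection \<open>Isomorphism classes\<close>

lemma iso_class_eqI:
  assumes M: "module (Zp p) M" and N: "module (Zp p) N" and f: "f \<in> module_iso (Zp p) M N"
  shows "iso_class p M = iso_class p N"
proof -
  obtain g where g: "g \<in> module_iso (Zp p) N M" using module_iso_inverse[OF M N f] by blast
  show ?thesis
    unfolding iso_class_def using module_iso_comp[OF _ f] module_iso_comp[OF _ g] by blast
qed

lemma iso_class_eqD:
  fixes M :: zp_module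
  assumes M: "module (Zp p) M" and eq: "iso_class p M = iso_class p N"
  obtains f where "f \<in> module_iso (Zp p) M N"
proof -
  have "M \<in> iso_class p M" using M module_iso_refl[OF M] by (auto simp: iso_class_def)
  then show ?thesis using that eq by (auto simp: iso_class_def)
qed

lemma rep_iso_class:
  fixes M :: zp_module
  assumes M: "module (Zp p) M"
  obtains f where "module (Zp p) (rep (iso_class p M))" "f \<in> module_iso (Zp p) (rep (iso_class p M)) M"
proof -
  have "M \<in> iso_class p M" using M module_iso_refl[OF M] by (auto simp: iso_class_def)
  then have "rep (iso_class p M) \<in> iso_class p M" unfolding rep_def by (rule someI)
  then show ?thesis using that by (auto simp: iso_class_def)
qed

section \<open>Arithmetic of the $p$-adic integers\<close>

locale padic =
  fixes p :: nat
  assumes prime: "prime p"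
begin

abbreviation Z :: "zp ring" where "Z \<equiv> Zp p"
abbreviation V :: "nat \<Rightarrow> (zp, nat \<Rightarrow> zp) module" where "V n \<equiv> Zp_power p n"

lemma p_pos: "0 < int p ^ k"
  using prime prime_gt_0_nat by simp

lemma Zp_iff:
  "x \<in> carrier Z \<longleftrightarrow> (\<forall>k. 0 \<le> x k \<and> x k < int p ^ k \<and> x (Suc k) mod int p ^ k = x k)"
  by (auto simp: Zp_def)

lemma Zp_mod_self: "x \<in> carrier Z \<Longrightarrow> x k mod int p ^ k = x k"
  by (simp add: Zp_iff)

lemma Zp_residue:
  assumes "x \<in> carrier Z" "j \<le> k"
  shows "x k mod int p ^ j = x j"
  using assms(2)
proof (induction k rule: dec_induct)
  case base then show ?case using assms(1) by (rule Zp_mod_self)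
next
  case (step k)
  have "x (Suc k) mod int p ^ j = x (Suc k) mod int p ^ k mod int p ^ j"
    using step(1) by (simp add: mod_mod_cancel le_imp_power_dvd)
  also have "\<dots> = x j" using step(3) assms(1) by (simp add: Zp_iff)
  finally show ?case .
qed

lemma Zp_simps [simp]:
  "\<zero>\<^bsub>Z\<^esub> = (\<lambda>k. 0)" "\<one>\<^bsub>Z\<^esub> = (\<lambda>k. 1 mod int p ^ k)"
  "x \<oplus>\<^bsub>Z\<^esub> y = (\<lambda>k. (x k + y k) mod int p ^ k)"
  "x \<otimes>\<^bsub>Z\<^esub> y = (\<lambda>k. (x k * y k) mod int p ^ k)"
  by (simp_all add: Zp_def)

lemma Zp_of_coherent:
  assumes "\<And>k. x (Suc k) mod int p ^ k = x k mod int p ^ k"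
  shows "(\<lambda>k. x k mod int p ^ k) \<in> carrier Z"
  using assms p_pos by (simp add: Zp_iff mod_mod_cancel)

lemma Zp_cring: "cring Z"
proof -
  have closed: "(\<lambda>k. (x k + y k) mod int p ^ k) \<in> carrier Z" "(\<lambda>k. (x k * y k) mod int p ^ k) \<in> carrier Z"
    if "x \<in> carrier Z" "y \<in> carrier Z" for x y
    by (intro Zp_of_coherent; use that in \<open>metis Zp_iff mod_add_eq mod_mult_eq\<close>)+
  have one: "(\<lambda>k. 1 mod int p ^ k) \<in> carrier Z" and zero: "(\<lambda>k. 0) \<in> carrier Z"
    using Zp_of_coherent[of "\<lambda>_. 1"] Zp_of_coherent[of "\<lambda>_. 0"] by auto
  have "abelian_group Z"
  proof (rule abelian_groupI)
    fix x assume x: "x \<in> carrier Z"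
    have "(\<lambda>k. (- x k) mod int p ^ k) \<in> carrier Z"
      by (intro Zp_of_coherent) (metis Zp_iff mod_minus_eq x)
    then show "\<exists>y\<in>carrier Z. y \<oplus>\<^bsub>Z\<^esub> x = \<zero>\<^bsub>Z\<^esub>"
      by (intro bexI[of _ "\<lambda>k. (- x k) mod int p ^ k"]) (auto simp: mod_add_left_eq)
  qed (auto simp: closed zero mod_simps add_ac Zp_mod_self)
  moreover have "Group.comm_monoid Z"
    by (rule comm_monoidI) (auto simp: closed one mod_simps mult_ac Zp_mod_self)
  ultimately show ?thesis
    by (rule cringI) (auto simp: mod_simps distrib_right)
qed

sublocale Z: cring Z by (rule Zp_cring)

lemma Zp_closed_simps [simp]:
  assumes "x \<in> carrier Z" "y \<in> carrier Z"
  shows "(\<lambda>k. (x k + y k) mod int p ^ k) \<in> carrier Z" "(\<lambda>k. (x k * y k) mod int p ^ k) \<in> carrier Z"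
  using Z.a_closed[OF assms] Z.m_closed[OF assms] by auto

lemma Zp_uminus: "x \<in> carrier Z \<Longrightarrow> \<ominus>\<^bsub>Z\<^esub> x = (\<lambda>k. (- x k) mod int p ^ k)"
proof (rule Z.minus_equality)
  assume x: "x \<in> carrier Z"
  show "(\<lambda>k. (- x k) mod int p ^ k) \<in> carrier Z"
    by (intro Zp_of_coherent) (metis Zp_iff mod_minus_eq x)
qed (auto simp: mod_simps)

lemma Zp_minus: "x \<in> carrier Z \<Longrightarrow> y \<in> carrier Z \<Longrightarrow> x \<ominus>\<^bsub>Z\<^esub> y = (\<lambda>k. (x k - y k) mod int p ^ k)"
  by (simp add: a_minus_def Zp_uminus mod_simps)

lemma Zp_finsum:
  assumes "finite A" "\<And>a. a \<in> A \<Longrightarrow> f a \<in> carrier Z"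
  shows "(\<Oplus>\<^bsub>Z\<^esub>a\<in>A. f a) k = (\<Sum>a\<in>A. f a k) mod int p ^ k"
  using assms
proof (induction A)
  case (insert a A)
  then have "(\<Oplus>\<^bsub>Z\<^esub>a\<in>insert a A. f a) = f a \<oplus>\<^bsub>Z\<^esub> (\<Oplus>\<^bsub>Z\<^esub>a\<in>A. f a)"
    by (intro Z.finsum_insert) auto
  with insert show ?case by (simp add: mod_simps)
qed simp

text \<open>The canonical map from the natural numbers to \<open>\<int>\<^sub>p\<close>.\<close>

definition of_N :: "nat \<Rightarrow> zp" where "of_N n = (\<lambda>k. int n mod int p ^ k)"

lemma of_N_closed [simp]: "of_N n \<in> carrier Z"
  unfolding of_N_def by (rule Zp_of_coherent) simp

lemma of_N_simps: "of_N 0 = \<zero>\<^bsub>Z\<^esub>" "of_N 1 = \<one>\<^bsub>Z\<^esub>" "of_N (m + n) = of_N m \<oplus>\<^bsub>Z\<^esub> of_N n"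
  "of_N (m * n) = of_N m \<otimes>\<^bsub>Z\<^esub> of_N n"
  by (auto simp: of_N_def mod_simps)

lemma add_pow_eq_smult:
  assumes K: "module Z K" and x: "x \<in> carrier K"
  shows "add_pow K (n::nat) x = of_N n \<odot>\<^bsub>K\<^esub> x"
proof -
  interpret K: Module.module Z K by fact
  show ?thesis
  proof (induction n)
    case 0 then show ?case using x of_N_simps(1) by (simp del: Zp_simps)
  next
    case (Suc n)
    have "of_N (Suc n) = of_N n \<oplus>\<^bsub>Z\<^esub> \<one>\<^bsub>Z\<^esub>"
      using of_N_simps(3)[of n 1] of_N_simps(2) by simp
    then show ?case using x Suc by (simp add: K.smult_l_distr del: Zp_simps)
  qed
qed

lemma regular_module: "module Z (regular_module Z)"
proof -
  have "abelian_group (regular_module Z)"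
    by (rule abelian_groupI; unfold regular_module_def)
       (use Z.l_neg Z.a_inv_closed in \<open>auto simp del: Zp_simps simp add: Z.add.m_ac\<close>)
  then show ?thesis
    by (intro moduleI Zp_cring)
       (simp_all add: regular_module_def Z.l_distr Z.r_distr Z.m_assoc del: Zp_simps)
qed

lemma regular_simps [simp]:
  "carrier (regular_module Z) = carrier Z" "x \<oplus>\<^bsub>regular_module Z\<^esub> y = x \<oplus>\<^bsub>Z\<^esub> y"
  "r \<odot>\<^bsub>regular_module Z\<^esub> y = r \<otimes>\<^bsub>Z\<^esub> y" "\<zero>\<^bsub>regular_module Z\<^esub> = \<zero>\<^bsub>Z\<^esub>"
  by (simp_all add: regular_module_def del: Zp_simps)

lemma regular_finsum:
  assumes "finite A" "\<And>a. a \<in> A \<Longrightarrow> f a \<in> carrier Z"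
  shows "finsum (regular_module Z) f A = finsum Z f A"
proof -
  interpret R: Module.module Z "regular_module Z" by (rule regular_module)
  show ?thesis
    using assms by (induction A) (simp_all add: Pi_iff del: Zp_simps)
qed

lemma regular_add_pow: "add_pow (regular_module Z) (n::nat) x = add_pow Z n x"
  by (simp add: add_pow_def nat_pow_def del: Zp_simps)

lemma p_power_residue: "(of_N (p ^ k) \<otimes>\<^bsub>Z\<^esub> x) j = (int p ^ k * x j) mod int p ^ j"
  by (simp add: of_N_def mod_simps)

lemma p_power_residue_zero: "j \<le> k \<Longrightarrow> (of_N (p ^ k) \<otimes>\<^bsub>Z\<^esub> x) j = 0"
  unfolding p_power_residue by (simp add: le_imp_power_dvd)

text \<open>The quotient is the shifted sequence with entries \<open>x (j + k) div p ^ k\<close>.\<close>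

lemma divisible_by_p_power:
  assumes x: "x \<in> carrier Z" "x k = 0"
  obtains y where "y \<in> carrier Z" "x = of_N (p ^ k) \<otimes>\<^bsub>Z\<^esub> y"
proof -
  define y where "y j = x (j + k) div int p ^ k" for j
  have eq: "x (j + k) = int p ^ k * y j" for j
    using Zp_residue[OF x(1), of k "j + k"] x(2) by (auto simp: y_def)
  have "0 \<le> y j \<and> y j < int p ^ j" for j
  proof -
    have "0 \<le> int p ^ k * y j" "int p ^ k * y j < int p ^ k * int p ^ j"
      using x(1)[unfolded Zp_iff, rule_format, of "j + k"] eq[of j]
      by (auto simp: power_add mult.commute)
    then show ?thesis using p_pos[of k] by (simp add: zero_le_mult_iff)
  qed
  moreover have "y (Suc j) mod int p ^ j = y j" for j
  proof -
    have "(int p ^ k * y (Suc j)) mod (int p ^ k * int p ^ j) = int p ^ k * y j"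
      using x(1)[unfolded Zp_iff, rule_format, of "j + k"] eq[of j] eq[of "Suc j"]
      by (auto simp: power_add mult.commute)
    then show ?thesis using prime_gt_0_nat[OF prime] by (simp add: mult_mod_right[symmetric])
  qed
  ultimately have "y \<in> carrier Z" by (simp add: Zp_iff)
  moreover have "x = of_N (p ^ k) \<otimes>\<^bsub>Z\<^esub> y"
  proof
    fix j show "x j = (of_N (p ^ k) \<otimes>\<^bsub>Z\<^esub> y) j"
      unfolding p_power_residue using Zp_residue[OF x(1), of j "j + k"] eq[of j] by simp
  qed
  ultimately show ?thesis using that by blast
qed

lemma same_residue:
  assumes "x \<in> carrier Z" "y \<in> carrier Z" "x k = y k"
  obtains z where "z \<in> carrier Z" "x = y \<oplus>\<^bsub>Z\<^esub> of_N (p ^ k) \<otimes>\<^bsub>Z\<^esub> z"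
proof -
  have "x \<ominus>\<^bsub>Z\<^esub> y \<in> carrier Z" "(x \<ominus>\<^bsub>Z\<^esub> y) k = 0" using assms by (simp_all add: Zp_minus del: Z.minus_closed) (use assms Z.minus_closed Zp_minus in metis)
  then obtain z where z: "z \<in> carrier Z" "x \<ominus>\<^bsub>Z\<^esub> y = of_N (p ^ k) \<otimes>\<^bsub>Z\<^esub> z"
    by (rule divisible_by_p_power)
  have "x = y \<oplus>\<^bsub>Z\<^esub> (x \<ominus>\<^bsub>Z\<^esub> y)"
    using assms by (simp add: a_minus_def Z.add.m_lcomm[of y x] Z.r_neg del: Zp_simps)
  with z that show ?thesis by metis
qed

text \<open>A product of sequences that are nonzero at the places \<open>i\<close> and \<open>j\<close> is nonzero at the place
  \<open>i + j\<close>, by comparison of multiplicities.\<close>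

lemma Zp_domain: "domain Z"
proof (unfold_locales)
  show "\<one>\<^bsub>Z\<^esub> \<noteq> \<zero>\<^bsub>Z\<^esub>"
    using prime_gt_1_nat[OF prime] by (auto dest!: fun_cong[where x=1])
next
  fix a b assume ab: "a \<otimes>\<^bsub>Z\<^esub> b = \<zero>\<^bsub>Z\<^esub>" "a \<in> carrier Z" "b \<in> carrier Z"
  show "a = \<zero>\<^bsub>Z\<^esub> \<or> b = \<zero>\<^bsub>Z\<^esub>"
  proof (rule ccontr)
    assume "\<not> ?thesis"
    then obtain i j where ij: "a i \<noteq> 0" "b j \<noteq> 0" by (auto simp: fun_eq_iff)
    let ?x = "a (i + j)" and ?y = "b (i + j)"
    have nd: "\<not> int p ^ i dvd ?x" "\<not> int p ^ j dvd ?y"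
      using ij Zp_residue[OF ab(2), of i "i + j"] Zp_residue[OF ab(3), of j "i + j"] by auto
    then have nz: "?x \<noteq> 0" "?y \<noteq> 0" by auto
    have pp: "Factorial_Ring.prime (int p)" using prime by simp
    have "int p ^ (i + j) dvd ?x * ?y" using ab(1) by (auto simp: fun_eq_iff)
    then have "i + j \<le> multiplicity (int p) (?x * ?y)"
      using nz pp by (intro multiplicity_geI) auto
    also have "\<dots> = multiplicity (int p) ?x + multiplicity (int p) ?y"
      using nz pp by (intro prime_elem_multiplicity_mult_distrib) auto
    finally have "i \<le> multiplicity (int p) ?x \<or> j \<le> multiplicity (int p) ?y" by linarith
    then show False using nd multiplicity_dvd' by blast
  qed
qed

lemma of_N_nonzero: "0 < n \<Longrightarrow> of_N n \<noteq> \<zero>\<^bsub>Z\<^esub>"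
proof
  assume n: "0 < n" and eq: "of_N n = \<zero>\<^bsub>Z\<^esub>"
  have "n < p ^ n" using prime_gt_Suc_0_nat[OF prime] by (rule power_gt_expt)
  then have "of_N n n = int n"
    by (simp add: of_N_def flip: of_nat_power)
  with n eq show False by simp
qed

section \<open>Free modules, matrices and linear maps\<close>

declare Zp_simps [simp del] Zp_closed_simps [simp del]

lemma V_simps:
  "carrier (V n) = {..<n} \<rightarrow>\<^sub>E carrier Z"
  "\<zero>\<^bsub>V n\<^esub> = (\<lambda>i\<in>{..<n}. \<zero>\<^bsub>Z\<^esub>)"
  "v \<oplus>\<^bsub>V n\<^esub> w = (\<lambda>i\<in>{..<n}. v i \<oplus>\<^bsub>Z\<^esub> w i)"
  "r \<odot>\<^bsub>V n\<^esub> v = (\<lambda>i\<in>{..<n}. r \<otimes>\<^bsub>Z\<^esub> v i)"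
  by (simp_all add: Zp_power_def)

lemma V_eqI:
  assumes "v \<in> carrier (V n)" "w \<in> carrier (V n)" "\<And>i. i < n \<Longrightarrow> v i = w i"
  shows "v = w"
  using assms unfolding V_simps by (rule PiE_ext) simp

lemma V_memb: "v \<in> carrier (V n) \<Longrightarrow> i < n \<Longrightarrow> v i \<in> carrier Z"
  by (auto simp: V_simps)

lemma V_Pi: "v \<in> carrier (V n) \<Longrightarrow> v \<in> {..<n} \<rightarrow> carrier Z"
  by (auto simp: V_simps)

lemma V_closedI: "(\<And>i. i < n \<Longrightarrow> f i \<in> carrier Z) \<Longrightarrow> (\<lambda>i\<in>{..<n}. f i) \<in> carrier (V n)"
  by (simp add: V_simps)

lemma V_nth [simp]:
  assumes "i < n"
  shows "\<zero>\<^bsub>V n\<^esub> i = \<zero>\<^bsub>Z\<^esub>" "(v \<oplus>\<^bsub>V n\<^esub> w) i = v i \<oplus>\<^bsub>Z\<^esub> w i" "(r \<odot>\<^bsub>V n\<^esub> v) i = r \<otimes>\<^bsub>Z\<^esub> v i"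
  using assms by (simp_all add: V_simps)

lemma V_module: "module Z (V n)"
proof -
  have cl: "(\<lambda>i\<in>{..<n}. f i) \<in> {..<n} \<rightarrow>\<^sub>E carrier Z" if "\<And>i. i < n \<Longrightarrow> f i \<in> carrier Z" for f
    using that by simp
  have memb: "x i \<in> carrier Z" if "x \<in> {..<n} \<rightarrow>\<^sub>E carrier Z" "i < n" for x i
    using that by auto
  have ext: "(\<lambda>i\<in>{..<n}. f i) = x" if "x \<in> {..<n} \<rightarrow>\<^sub>E carrier Z" "\<And>i. i < n \<Longrightarrow> f i = x i" for f x
    using that by (metis (no_types, lifting) PiE_restrict lessThan_iff restrict_ext)
  have "abelian_group (V n)"
  proof (rule abelian_groupI; unfold V_simps)
    fix x assume x: "x \<in> {..<n} \<rightarrow>\<^sub>E carrier Z"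
    show "\<exists>y\<in>{..<n} \<rightarrow>\<^sub>E carrier Z. (\<lambda>i\<in>{..<n}. y i \<oplus>\<^bsub>Z\<^esub> x i) = (\<lambda>i\<in>{..<n}. \<zero>\<^bsub>Z\<^esub>)"
      by (intro bexI[of _ "\<lambda>i\<in>{..<n}. \<ominus>\<^bsub>Z\<^esub> x i"] restrict_ext cl)
         (simp_all add: Z.l_neg memb[OF x])
    show "(\<lambda>i\<in>{..<n}. (\<lambda>i\<in>{..<n}. \<zero>\<^bsub>Z\<^esub>) i \<oplus>\<^bsub>Z\<^esub> x i) = x"
      by (rule ext[OF x]) (simp add: memb[OF x])
  qed (intro cl restrict_ext; simp add: memb Z.add.m_ac)+
  show ?thesis
  proof (intro moduleI Zp_cring \<open>abelian_group (V n)\<close>; unfold V_simps)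
    fix x assume x: "x \<in> {..<n} \<rightarrow>\<^sub>E carrier Z"
    show "(\<lambda>i\<in>{..<n}. \<one>\<^bsub>Z\<^esub> \<otimes>\<^bsub>Z\<^esub> x i) = x"
      by (rule ext[OF x]) (simp add: memb[OF x])
  qed (intro cl restrict_ext; simp add: memb Z.l_distr Z.r_distr Z.m_assoc)+
qed

sublocale V: Module.module "Zp p" "Zp_power p n" for n by (rule V_module)

definition unit_vec :: "nat \<Rightarrow> nat \<Rightarrow> nat \<Rightarrow> zp" where
  "unit_vec n j = (\<lambda>i\<in>{..<n}. if i = j then \<one>\<^bsub>Z\<^esub> else \<zero>\<^bsub>Z\<^esub>)"

lemma unit_vec_closed [simp]: "unit_vec n j \<in> carrier (V n)"
  unfolding unit_vec_def by (rule V_closedI) simp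

lemma unit_vec_nth: "i < n \<Longrightarrow> unit_vec n j i = (if i = j then \<one>\<^bsub>Z\<^esub> else \<zero>\<^bsub>Z\<^esub>)"
  by (simp add: unit_vec_def)

definition lincomb :: "nat \<Rightarrow> (zp, 'b, 'm) module_scheme \<Rightarrow> (nat \<Rightarrow> 'b) \<Rightarrow> (nat \<Rightarrow> zp) \<Rightarrow> 'b" where
  "lincomb n K x v = (\<Oplus>\<^bsub>K\<^esub>j\<in>{..<n}. v j \<odot>\<^bsub>K\<^esub> x j)"

lemma lincomb_Suc:
  assumes "module Z K" "x \<in> {..<Suc n} \<rightarrow> carrier K" "v \<in> {..<Suc n} \<rightarrow> carrier Z"
  shows "lincomb (Suc n) K x v = lincomb n K x v \<oplus>\<^bsub>K\<^esub> v n \<odot>\<^bsub>K\<^esub> x n"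
proof -
  interpret K: Module.module Z K by fact
  have "(\<lambda>j. v j \<odot>\<^bsub>K\<^esub> x j) \<in> {..<n} \<rightarrow> carrier K" "v n \<odot>\<^bsub>K\<^esub> x n \<in> carrier K"
    using assms by (auto simp: Pi_iff intro!: K.smult_closed)
  then show ?thesis
    by (simp add: lincomb_def lessThan_Suc K.add.m_comm)
qed

lemma lincomb_hom:
  assumes K: "module Z K" and x: "x \<in> {..<n} \<rightarrow> carrier K"
  shows "lincomb n K x \<in> module_hom Z (V n) K"
proof -
  interpret K: Module.module Z K by fact
  have Kx [simp]: "x j \<in> carrier K" if "j < n" for j using that x by auto
  show ?thesis
  proof (rule module_homI, goal_cases)
    case (1 v) then show ?case
      unfolding lincomb_def by (intro K.M.finsum_closed) (auto simp: V_memb)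
  next
    case (2 v w)
    have "lincomb n K x (v \<oplus>\<^bsub>V n\<^esub> w) = (\<Oplus>\<^bsub>K\<^esub>j\<in>{..<n}. v j \<odot>\<^bsub>K\<^esub> x j \<oplus>\<^bsub>K\<^esub> w j \<odot>\<^bsub>K\<^esub> x j)"
      unfolding lincomb_def using 2 by (intro K.M.finsum_cong') (auto simp: K.smult_l_distr V_memb)
    also have "\<dots> = lincomb n K x v \<oplus>\<^bsub>K\<^esub> lincomb n K x w"
      unfolding lincomb_def using 2 by (intro K.M.finsum_addf) (auto simp: V_memb)
    finally show ?case .
  next
    case (3 r v)
    have "lincomb n K x (r \<odot>\<^bsub>V n\<^esub> v) = (\<Oplus>\<^bsub>K\<^esub>j\<in>{..<n}. r \<odot>\<^bsub>K\<^esub> (v j \<odot>\<^bsub>K\<^esub> x j))"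
      unfolding lincomb_def using 3 by (intro K.M.finsum_cong') (auto simp: K.smult_assoc1 V_memb)
    also have "\<dots> = r \<odot>\<^bsub>K\<^esub> lincomb n K x v"
      unfolding lincomb_def using 3 by (intro K.finsum_smult_ldistr[symmetric]) (auto simp: V_memb)
    finally show ?case .
  qed
qed

text \<open>By induction on the number of coordinates of \<open>v\<close> that are not replaced by zero.\<close>

lemma hom_eq_lincomb:
  assumes f: "f \<in> module_hom Z (V n) K" and K: "module Z K" and v: "v \<in> carrier (V n)"
  shows "f v = lincomb n K (\<lambda>j. f (unit_vec n j)) v"
proof -
  interpret K: Module.module Z K by fact
  define t where "t k = (\<lambda>i\<in>{..<n}. if i < k then v i else \<zero>\<^bsub>Z\<^esub>)" for k
  have tk [simp]: "t k \<in> carrier (V n)" for k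
    using V_memb[OF v] unfolding t_def by (intro V_closedI) simp
  have t_nth: "t k i = (if i < k then v i else \<zero>\<^bsub>Z\<^esub>)" if "i < n" for i k
    using that by (simp add: t_def)
  have step: "f (t k) = lincomb k K (\<lambda>j. f (unit_vec n j)) v" if "k \<le> n" for k
    using that
  proof (induction k)
    case 0
    have "t 0 = \<zero>\<^bsub>V n\<^esub>" by (rule V_eqI[of _ n]) (simp_all add: t_nth)
    then show ?case using module_hom_zero[OF V_module K f] by (simp add: lincomb_def)
  next
    case (Suc k)
    have vk: "v k \<in> carrier Z"
      using v Suc.prems by (simp add: V_memb)
    have "t (Suc k) = t k \<oplus>\<^bsub>V n\<^esub> v k \<odot>\<^bsub>V n\<^esub> unit_vec n k"
      using vk V_memb[OF v]
      by (intro V_eqI[of _ n]) (auto simp: t_nth unit_vec_nth less_Suc_eq)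
    then have "f (t (Suc k)) = f (t k) \<oplus>\<^bsub>K\<^esub> v k \<odot>\<^bsub>K\<^esub> f (unit_vec n k)"
      using vk module_homD(2,3)[OF f] by simp
    moreover have "lincomb (Suc k) K (\<lambda>j. f (unit_vec n j)) v
        = lincomb k K (\<lambda>j. f (unit_vec n j)) v \<oplus>\<^bsub>K\<^esub> v k \<odot>\<^bsub>K\<^esub> f (unit_vec n k)"
      using Suc.prems module_homD(1)[OF f unit_vec_closed] V_memb[OF v] by (intro lincomb_Suc K) auto
    ultimately show ?case using Suc by simp
  qed
  have "t n = v" using v by (intro V_eqI[of _ n]) (auto simp: t_nth)
  then show ?thesis using step[of n] by simp
qed

text \<open>Free modules are projective.\<close>

lemma free_lift:
  assumes H: "module Z H" and K: "module Z K" and q: "q \<in> module_hom Z H K"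
    and f: "f \<in> module_hom Z (V n) K" and range: "\<And>v. v \<in> carrier (V n) \<Longrightarrow> f v \<in> q ` carrier H"
  obtains g where "g \<in> module_hom Z (V n) H" "\<And>v. v \<in> carrier (V n) \<Longrightarrow> q (g v) = f v"
proof -
  have "\<forall>j. \<exists>h. h \<in> carrier H \<and> q h = f (unit_vec n j)"
    using range[OF unit_vec_closed] by (metis image_iff)
  then obtain h where h: "\<And>j. h j \<in> carrier H" "\<And>j. q (h j) = f (unit_vec n j)" by metis
  let ?g = "lincomb n H h"
  have g: "?g \<in> module_hom Z (V n) H" using h by (intro lincomb_hom H) auto
  have "q (?g v) = f v" if v: "v \<in> carrier (V n)" for v
  proof -
    have "?g (unit_vec n j) = h j" if j: "j < n" for j
    proof -
      interpret H: Module.module Z H by fact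
      have "?g (unit_vec n j) = (\<Oplus>\<^bsub>H\<^esub>i\<in>{..<n}. if j = i then h i else \<zero>\<^bsub>H\<^esub>)"
        unfolding lincomb_def
        by (intro H.M.finsum_cong') (auto simp: unit_vec_nth h)
      also have "\<dots> = h j"
        using j h by (intro H.M.finsum_singleton) auto
      finally show ?thesis .
    qed
    then have q_unit: "q (?g (unit_vec n j)) = f (unit_vec n j)" if "j < n" for j
      using that h(2) by simp
    interpret K: Module.module Z K by fact
    have "q (?g v) = lincomb n K (\<lambda>j. q (?g (unit_vec n j))) v"
      by (rule hom_eq_lincomb[OF module_hom_comp[OF g q] K v])
    also have "\<dots> = lincomb n K (\<lambda>j. f (unit_vec n j)) v"
      unfolding lincomb_def[of n K] using V_memb[OF v] module_homD(1)[OF f unit_vec_closed]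
      by (intro K.M.finsum_cong') (auto simp: q_unit)
    finally show ?thesis using hom_eq_lincomb[OF f K v] by simp
  qed
  with g show ?thesis using that by blast
qed

subsection \<open>Matrices\<close>

definition dot :: "nat \<Rightarrow> (nat \<Rightarrow> zp) \<Rightarrow> (nat \<Rightarrow> zp) \<Rightarrow> zp" where
  "dot n r v = (\<Oplus>\<^bsub>Z\<^esub>j\<in>{..<n}. r j \<otimes>\<^bsub>Z\<^esub> v j)"

lemma mat_vec_dot: "i < m \<Longrightarrow> mat_vec p m n M v i = dot n (\<lambda>j. M (i, j)) v"
  by (simp add: mat_vec_def dot_def)

lemma dot_residue:
  assumes "r \<in> {..<n} \<rightarrow> carrier Z" "v \<in> {..<n} \<rightarrow> carrier Z"
  shows "dot n r v k = (\<Sum>j<n. r j k * v j k) mod int p ^ k"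
proof -
  have "dot n r v k = (\<Sum>j<n. (r j \<otimes>\<^bsub>Z\<^esub> v j) k) mod int p ^ k"
    unfolding dot_def using assms by (intro Zp_finsum) auto
  also have "\<dots> = (\<Sum>j<n. r j k * v j k) mod int p ^ k"
    by (simp add: mod_sum_eq Zp_simps)
  finally show ?thesis .
qed

lemma dot_eq_lincomb:
  assumes "r \<in> {..<n} \<rightarrow> carrier Z" "v \<in> {..<n} \<rightarrow> carrier Z"
  shows "dot n r v = lincomb n (regular_module Z) r v"
  unfolding dot_def lincomb_def using assms
  by (subst regular_finsum) (auto intro!: Z.finsum_cong' simp: Pi_iff Z.m_comm)

lemma dot_closed [simp]:
  assumes "r \<in> {..<n} \<rightarrow> carrier Z" "v \<in> {..<n} \<rightarrow> carrier Z"
  shows "dot n r v \<in> carrier Z"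
  unfolding dot_def using assms by (intro Z.finsum_closed) auto

lemma dot_hom:
  assumes "r \<in> {..<n} \<rightarrow> carrier Z"
  shows "dot n r \<in> module_hom Z (V n) (regular_module Z)"
proof -
  have "lincomb n (regular_module Z) r \<in> module_hom Z (V n) (regular_module Z)"
    using assms by (intro lincomb_hom regular_module) simp
  moreover have "dot n r v = lincomb n (regular_module Z) r v" if "v \<in> carrier (V n)" for v
    using assms V_Pi[OF that] by (rule dot_eq_lincomb)
  ultimately show ?thesis
    unfolding module_hom_def by (simp del: regular_simps add: Pi_iff)
qed

lemma functional_eq_dot:
  assumes f: "f \<in> module_hom Z (V n) (regular_module Z)"
  obtains r where "r \<in> carrier (V n)" "\<And>v. v \<in> carrier (V n) \<Longrightarrow> f v = dot n r v"
proof -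
  let ?r = "\<lambda>j\<in>{..<n}. f (unit_vec n j)"
  have fu [simp]: "f (unit_vec n j) \<in> carrier Z" for j
    using module_homD(1)[OF f unit_vec_closed] by simp
  have r: "?r \<in> carrier (V n)" by (rule V_closedI) simp
  have "f v = dot n ?r v" if v: "v \<in> carrier (V n)" for v
  proof -
    have "dot n ?r v = lincomb n (regular_module Z) ?r v"
      using r v by (intro dot_eq_lincomb V_Pi)
    also have "\<dots> = lincomb n (regular_module Z) (\<lambda>j. f (unit_vec n j)) v"
      unfolding lincomb_def using V_memb[OF v]
      by (subst (1 2) regular_finsum) (auto intro!: Z.finsum_cong')
    finally show ?thesis using hom_eq_lincomb[OF f regular_module v] by simp
  qed
  with r that show ?thesis by blast
qed

lemma dot_add:
  assumes "r \<in> carrier (V n)" "s \<in> carrier (V n)" "v \<in> carrier (V n)"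
  shows "dot n (r \<oplus>\<^bsub>V n\<^esub> s) v = dot n r v \<oplus>\<^bsub>Z\<^esub> dot n s v"
proof
  fix k
  have rs: "r \<oplus>\<^bsub>V n\<^esub> s \<in> carrier (V n)" using assms by simp
  have *: "dot n r v k = (\<Sum>j<n. r j k * v j k) mod int p ^ k" if "r \<in> carrier (V n)" for r k
    using that assms by (intro dot_residue V_Pi)
  show "dot n (r \<oplus>\<^bsub>V n\<^esub> s) v k = (dot n r v \<oplus>\<^bsub>Z\<^esub> dot n s v) k"
  proof -
    have "(\<Sum>j<n. (r \<oplus>\<^bsub>V n\<^esub> s) j k * v j k) mod int p ^ k
        = (\<Sum>j<n. ((r j k + s j k) mod int p ^ k * v j k) mod int p ^ k) mod int p ^ k"
      by (simp add: mod_sum_eq Zp_simps)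
    also have "\<dots> = (\<Sum>j<n. r j k * v j k + s j k * v j k) mod int p ^ k"
      by (simp add: mod_mult_left_eq mod_sum_eq distrib_right)
    finally show ?thesis
      using *[OF assms(1)] *[OF assms(2)] *[OF rs] by (simp add: Zp_simps mod_simps sum.distrib)
  qed
qed

lemma dot_scale:
  assumes "r \<in> carrier (V n)" "a \<in> carrier Z" "v \<in> carrier (V n)"
  shows "dot n (a \<odot>\<^bsub>V n\<^esub> r) v = a \<otimes>\<^bsub>Z\<^esub> dot n r v"
proof -
  have "a \<otimes>\<^bsub>Z\<^esub> dot n r v = (\<Oplus>\<^bsub>Z\<^esub>j\<in>{..<n}. a \<otimes>\<^bsub>Z\<^esub> (r j \<otimes>\<^bsub>Z\<^esub> v j))"
    unfolding dot_def using assms by (intro Z.finsum_rdistr) (auto simp: V_memb)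
  also have "\<dots> = dot n (a \<odot>\<^bsub>V n\<^esub> r) v"
    unfolding dot_def using assms by (intro Z.finsum_cong') (auto simp: V_memb Z.m_assoc)
  finally show ?thesis by simp
qed

lemma mat_vec_residue:
  assumes "is_matrix p m n M" "v \<in> carrier (V n)" "i < m"
  shows "mat_vec p m n M v i k = (\<Sum>j<n. M (i, j) k * v j k) mod int p ^ k"
  using assms unfolding mat_vec_dot[OF assms(3)] by (intro dot_residue V_Pi[OF assms(2)]) (simp add: is_matrix_def)

lemma mat_vec_hom:
  assumes M: "is_matrix p m n M"
  shows "mat_vec p m n M \<in> module_hom Z (V n) (V m)"
proof -
  have row: "dot n (\<lambda>j. M (i, j)) \<in> module_hom Z (V n) (regular_module Z)" if "i < m" for i
    using M that by (intro dot_hom) (auto simp: is_matrix_def)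
  have cl: "mat_vec p m n M v \<in> carrier (V m)" if "v \<in> carrier (V n)" for v
    using module_homD(1)[OF row that] unfolding mat_vec_def dot_def[symmetric]
    by (intro V_closedI) simp
  show ?thesis
  proof (rule module_homI, goal_cases)
    case (1 v)
    with cl show ?case .
  next
    case (2 v w) then show ?case using module_homD(2)[OF row, of _ v w] cl
      by (intro V_eqI[of _ m]) (simp_all add: mat_vec_dot)
  next
    case (3 r v) then show ?case using module_homD(3)[OF row, of _ r v] cl
      by (intro V_eqI[of _ m]) (simp_all add: mat_vec_dot)
  qed
qed

end

text \<open>Gaussian elimination without division: with a pivot \<open>d = x t l \<noteq> 0\<close> the vectors
  \<open>d x\<^sub>j - x\<^sub>j\<^sub>l x\<^sub>t\<close> have one coordinate less, and a relation between them is a relation between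
  the original vectors.\<close>

lemma (in domain) linear_dependence:
  assumes "finite I" "finite J" "card I < card J"
    and "\<And>i j. i \<in> I \<Longrightarrow> j \<in> J \<Longrightarrow> x j i \<in> carrier R"
  shows "\<exists>a. (\<forall>j\<in>J. a j \<in> carrier R) \<and> (\<exists>j\<in>J. a j \<noteq> \<zero>) \<and> (\<forall>i\<in>I. (\<Oplus>j\<in>J. a j \<otimes> x j i) = \<zero>)"
  using assms
proof (induction I arbitrary: J x rule: finite_induct)
  case empty
  then obtain j where "j \<in> J" by fastforce
  then show ?case by (intro exI[of _ "\<lambda>_. \<one>"]) auto
next
  case (insert l I)
  show ?case
  proof (cases "\<forall>j\<in>J. x j l = \<zero>")
    case True
    have "\<exists>a. (\<forall>j\<in>J. a j \<in> carrier R) \<and> (\<exists>j\<in>J. a j \<noteq> \<zero>) \<and> (\<forall>i\<in>I. (\<Oplus>j\<in>J. a j \<otimes> x j i) = \<zero>)"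
      using insert.hyps insert.prems by (intro insert.IH) auto
    then obtain a where a: "\<forall>j\<in>J. a j \<in> carrier R" "\<exists>j\<in>J. a j \<noteq> \<zero>"
      "\<forall>i\<in>I. (\<Oplus>j\<in>J. a j \<otimes> x j i) = \<zero>" by blast
    have "(\<Oplus>j\<in>J. a j \<otimes> x j l) = (\<Oplus>j\<in>J. \<zero>)"
      using True a(1) by (intro finsum_cong') auto
    with a show ?thesis by (intro exI[of _ a]) auto
  next
    case False
    then obtain t where t: "t \<in> J" "x t l \<noteq> \<zero>" by blast
    define d where "d = x t l"
    define K where "K = J - {t}"
    have J: "J = insert t K" "t \<notin> K" "finite K" using t insert.prems(1) by (auto simp: K_def)
    have x: "x j i \<in> carrier R" if "j \<in> J" "i \<in> insert l I" for i j
      using insert.prems(3)[OF that(2,1)] .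
    have dc: "d \<in> carrier R" using x t by (simp add: d_def)
    \<comment> \<open>Clear the coordinate \<open>l\<close> of the other vectors with the pivot vector \<open>x t\<close>.\<close>
    let ?y = "\<lambda>j i. d \<otimes> x j i \<ominus> x j l \<otimes> x t i"
    have "\<exists>b. (\<forall>j\<in>K. b j \<in> carrier R) \<and> (\<exists>j\<in>K. b j \<noteq> \<zero>) \<and> (\<forall>i\<in>I. (\<Oplus>j\<in>K. b j \<otimes> ?y j i) = \<zero>)"
      using insert.hyps insert.prems(2) J t dc by (intro insert.IH) (auto intro!: x minus_closed)
    then obtain b where b: "\<forall>j\<in>K. b j \<in> carrier R" "\<exists>j\<in>K. b j \<noteq> \<zero>"
      "\<forall>i\<in>I. (\<Oplus>j\<in>K. b j \<otimes> ?y j i) = \<zero>" by blast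
    define s where "s = (\<Oplus>j\<in>K. b j \<otimes> x j l)"
    define a where "a j = (if j = t then \<ominus> s else d \<otimes> b j)" for j
    have sc: "s \<in> carrier R" unfolding s_def using b x J by (intro finsum_closed) auto
    have eq: "(\<Oplus>j\<in>J. a j \<otimes> x j i) = (\<Oplus>j\<in>K. b j \<otimes> ?y j i)" if i: "i \<in> insert l I" for i
    proof -
      have "(\<Oplus>j\<in>J. a j \<otimes> x j i) = \<ominus> s \<otimes> x t i \<oplus> (\<Oplus>j\<in>K. a j \<otimes> x j i)"
        unfolding J(1) using J sc dc b x i by (subst finsum_insert) (auto simp: a_def intro!: m_closed)
      also have "\<ominus> s \<otimes> x t i = (\<Oplus>j\<in>K. \<ominus> (b j \<otimes> x j l \<otimes> x t i))"
      proof -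
        have "\<ominus> s \<otimes> x t i = s \<otimes> \<ominus> x t i"
          using sc x[OF t(1) i] by (simp add: l_minus r_minus)
        also have "\<dots> = (\<Oplus>j\<in>K. b j \<otimes> x j l \<otimes> \<ominus> x t i)"
          unfolding s_def using J b x t i by (intro finsum_ldistr) auto
        also have "\<dots> = (\<Oplus>j\<in>K. \<ominus> (b j \<otimes> x j l \<otimes> x t i))"
          using J b x t i by (intro finsum_cong') (auto simp: r_minus)
        finally show ?thesis .
      qed
      also have "(\<Oplus>j\<in>K. \<ominus> (b j \<otimes> x j l \<otimes> x t i)) \<oplus> (\<Oplus>j\<in>K. a j \<otimes> x j i)
          = (\<Oplus>j\<in>K. \<ominus> (b j \<otimes> x j l \<otimes> x t i) \<oplus> a j \<otimes> x j i)"
        using J b x t i dc by (intro finsum_addf[symmetric]) (auto simp: a_def)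
      also have "\<dots> = (\<Oplus>j\<in>K. b j \<otimes> ?y j i)"
      proof (rule finsum_cong')
        fix j assume j: "j \<in> K"
        have c: "b j \<in> carrier R" "x j l \<in> carrier R" "x t i \<in> carrier R" "x j i \<in> carrier R" "j \<noteq> t"
          using j J b x t i by auto
        show "\<ominus> (b j \<otimes> x j l \<otimes> x t i) \<oplus> a j \<otimes> x j i = b j \<otimes> ?y j i"
          using c dc by (simp add: a_def a_minus_def r_distr r_minus m_ac a_comm)
      qed (use J b x t i dc in auto)
      finally show ?thesis .
    qed
    have "(\<Oplus>j\<in>K. b j \<otimes> ?y j l) = (\<Oplus>j\<in>K. \<zero>)"
    proof (rule finsum_cong')
      fix j assume "j \<in> K"
      then have "b j \<in> carrier R" "x j l \<in> carrier R" using b x J by auto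
      then show "b j \<otimes> ?y j l = \<zero>"
        using dc by (simp add: d_def[symmetric] a_minus_def m_comm r_neg)
    qed auto
    then have "\<forall>i\<in>insert l I. (\<Oplus>j\<in>J. a j \<otimes> x j i) = \<zero>" using b(3) eq by simp
    moreover have "\<forall>j\<in>J. a j \<in> carrier R" using sc dc b J by (auto simp: a_def)
    moreover have "\<exists>j\<in>J. a j \<noteq> \<zero>"
      using b J t dc by (auto simp: a_def d_def integral_iff intro!: bexI)
    ultimately show ?thesis by blast
  qed
qed

context padic
begin

lemma V_torsion_free:
  assumes "a \<in> carrier Z" "a \<noteq> \<zero>\<^bsub>Z\<^esub>" "v \<in> carrier (V n)" "a \<odot>\<^bsub>V n\<^esub> v = \<zero>\<^bsub>V n\<^esub>"
  shows "v = \<zero>\<^bsub>V n\<^esub>"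
proof (rule V_eqI[of _ n])
  fix i assume i: "i < n"
  interpret D: domain Z by (rule Zp_domain)
  have "a \<otimes>\<^bsub>Z\<^esub> v i = \<zero>\<^bsub>Z\<^esub>" using assms(4) i by (metis V_nth(1,3))
  then show "v i = \<zero>\<^bsub>V n\<^esub> i" using assms i D.integral V_memb[OF assms(3) i] by force
qed (use assms in auto)

lemma front_closed: "x \<in> carrier (V (Suc n)) \<Longrightarrow> restrict x {..<n} \<in> carrier (V n)"
  by (rule V_closedI) (simp add: V_memb)

lemma front_hom: "(\<lambda>x. restrict x {..<n}) \<in> module_hom Z (V (Suc n)) (V n)"
proof (rule module_homI)
  show "restrict (x \<oplus>\<^bsub>V (Suc n)\<^esub> y) {..<n} = restrict x {..<n} \<oplus>\<^bsub>V n\<^esub> restrict y {..<n}"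
    if "x \<in> carrier (V (Suc n))" "y \<in> carrier (V (Suc n))" for x y
    using that by (intro V_eqI[of _ n]) (simp_all add: front_closed)
  show "restrict (r \<odot>\<^bsub>V (Suc n)\<^esub> x) {..<n} = r \<odot>\<^bsub>V n\<^esub> restrict x {..<n}"
    if "r \<in> carrier Z" "x \<in> carrier (V (Suc n))" for r x
    using that by (intro V_eqI[of _ n]) (simp_all add: front_closed)
qed (rule front_closed)

lemma last_hom: "(\<lambda>x. x n) \<in> module_hom Z (V (Suc n)) (regular_module Z)"
  by (rule module_homI) (simp_all add: V_memb)

lemma snoc_closed [simp]:
  assumes "v \<in> carrier (V n)" "a \<in> carrier Z"
  shows "v(n := a) \<in> carrier (V (Suc n))"
proof -
  have "{..<Suc n} = insert n {..<n}" by auto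
  then show ?thesis using assms by (simp add: V_simps PiE_fun_upd)
qed

lemma front_snoc [simp]:
  assumes "v \<in> carrier (V n)" shows "restrict (v(n := a)) {..<n} = v"
proof -
  have "restrict (v(n := a)) {..<n} = restrict v {..<n}" by (rule restrict_ext) simp
  then show ?thesis using assms by (simp add: V_simps)
qed

lemma snoc_front:
  assumes "x \<in> carrier (V (Suc n))" shows "(restrict x {..<n})(n := x n) = x"
proof -
  have "{..<Suc n} = insert n {..<n}" by auto
  then show ?thesis using assms by (simp add: V_simps PiE_restrict)
qed

lemma inj_last_hom: "(\<lambda>a. \<zero>\<^bsub>V n\<^esub>(n := a)) \<in> module_hom Z (regular_module Z) (V (Suc n))"
proof (rule module_homI)
  show "\<zero>\<^bsub>V n\<^esub>(n := x \<oplus>\<^bsub>regular_module Z\<^esub> y) = \<zero>\<^bsub>V n\<^esub>(n := x) \<oplus>\<^bsub>V (Suc n)\<^esub> \<zero>\<^bsub>V n\<^esub>(n := y)"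
    if "x \<in> carrier (regular_module Z)" "y \<in> carrier (regular_module Z)" for x y
    using that by (intro V_eqI[of _ "Suc n"]) (auto simp: less_Suc_eq)
  show "\<zero>\<^bsub>V n\<^esub>(n := r \<odot>\<^bsub>regular_module Z\<^esub> x) = r \<odot>\<^bsub>V (Suc n)\<^esub> \<zero>\<^bsub>V n\<^esub>(n := x)"
    if "r \<in> carrier Z" "x \<in> carrier (regular_module Z)" for r x
    using that by (intro V_eqI[of _ "Suc n"]) (auto simp: less_Suc_eq)
qed auto

lemma dot_Suc:
  assumes "r \<in> {..<Suc n} \<rightarrow> carrier Z" "v \<in> {..<Suc n} \<rightarrow> carrier Z"
  shows "dot (Suc n) r v = dot n r v \<oplus>\<^bsub>Z\<^esub> r n \<otimes>\<^bsub>Z\<^esub> v n"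
proof -
  have "(\<lambda>j. r j \<otimes>\<^bsub>Z\<^esub> v j) \<in> {..<n} \<rightarrow> carrier Z" "r n \<otimes>\<^bsub>Z\<^esub> v n \<in> carrier Z"
    using assms by (auto simp: Pi_iff)
  then show ?thesis by (simp add: dot_def lessThan_Suc Z.add.m_comm)
qed

lemma dot_cong:
  assumes "\<And>j. j < n \<Longrightarrow> r j = r' j" "\<And>j. j < n \<Longrightarrow> v j = v' j"
    "r' \<in> {..<n} \<rightarrow> carrier Z" "v' \<in> {..<n} \<rightarrow> carrier Z"
  shows "dot n r v = dot n r' v'"
  unfolding dot_def using assms by (intro Z.finsum_cong') auto

lemma mat_vec_new_row:
  assumes "is_matrix p (Suc n) m M'" "\<And>i j. i < n \<Longrightarrow> j < m \<Longrightarrow> M' (i, j) = M (i, j)" "u \<in> carrier (V m)"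
  shows "mat_vec p (Suc n) m M' u = (mat_vec p n m M u)(n := dot m (\<lambda>j. M' (n, j)) u)"
proof -
  have "dot m (\<lambda>j. M' (i, j)) u = dot m (\<lambda>j. M (i, j)) u" if "i < n" for i
    using assms that V_memb[OF assms(3)]
    by (intro dot_cong) (auto simp: is_matrix_def less_Suc_eq)
  then show ?thesis
    by (auto simp: fun_eq_iff mat_vec_def dot_def[symmetric] less_Suc_eq)
qed

lemma mat_vec_new_column:
  assumes M': "is_matrix p m (Suc n) M'" and eq: "\<And>i j. i < m \<Longrightarrow> j < n \<Longrightarrow> M' (i, j) = M (i, j)"
    and x: "x \<in> carrier (V (Suc n))"
  shows "mat_vec p m (Suc n) M' x
    = mat_vec p m n M (restrict x {..<n}) \<oplus>\<^bsub>V m\<^esub> x n \<odot>\<^bsub>V m\<^esub> (\<lambda>i\<in>{..<m}. M' (i, n))"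
proof -
  have fx: "restrict x {..<n} \<in> carrier (V n)" using module_homD(1)[OF front_hom x] .
  have M: "is_matrix p m n M" using M' eq by (auto simp: is_matrix_def less_Suc_eq)
  have col: "(\<lambda>i\<in>{..<m}. M' (i, n)) \<in> carrier (V m)"
    using M' by (intro V_closedI) (auto simp: is_matrix_def)
  have xn: "x n \<in> carrier Z" using V_memb[OF x] by simp
  show ?thesis
  proof (rule V_eqI[of _ m])
    fix i assume i: "i < m"
    have r: "(\<lambda>j. M' (i, j)) \<in> {..<Suc n} \<rightarrow> carrier Z" using M' i by (auto simp: is_matrix_def)
    have "dot n (\<lambda>j. M' (i, j)) x = dot n (\<lambda>j. M (i, j)) (restrict x {..<n})"
      using eq i M V_memb[OF x] by (intro dot_cong) (auto simp: is_matrix_def)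
    then show "mat_vec p m (Suc n) M' x i = (mat_vec p m n M (restrict x {..<n})
        \<oplus>\<^bsub>V m\<^esub> x n \<odot>\<^bsub>V m\<^esub> (\<lambda>i\<in>{..<m}. M' (i, n))) i"
      using i r V_Pi[OF x] xn by (simp add: mat_vec_dot dot_Suc Z.m_comm Pi_iff)
  qed (use module_homD(1)[OF mat_vec_hom[OF M'] x] module_homD(1)[OF mat_vec_hom[OF M] fx] xn col in auto)
qed

text \<open>Linear maps from \<open>V (n + 1)\<close> to \<open>V n\<close> have a kernel, because \<open>n + 1\<close> vectors with \<open>n\<close>
  coordinates are linearly dependent.\<close>

lemma kernel_nontrivial:
  assumes f: "f \<in> module_hom Z (V (Suc n)) (V n)"
  obtains v where "v \<in> carrier (V (Suc n))" "v \<noteq> \<zero>\<^bsub>V (Suc n)\<^esub>" "f v = \<zero>\<^bsub>V n\<^esub>"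
proof -
  interpret D: domain Z by (rule Zp_domain)
  let ?x = "\<lambda>j i. f (unit_vec (Suc n) j) i"
  have fc: "?x j i \<in> carrier Z" if "i < n" for i j
    using V_memb[OF module_homD(1)[OF f unit_vec_closed] that] .
  have "\<exists>a. (\<forall>j\<in>{..<Suc n}. a j \<in> carrier Z) \<and> (\<exists>j\<in>{..<Suc n}. a j \<noteq> \<zero>\<^bsub>Z\<^esub>) \<and>
      (\<forall>i\<in>{..<n}. (\<Oplus>\<^bsub>Z\<^esub>j\<in>{..<Suc n}. a j \<otimes>\<^bsub>Z\<^esub> ?x j i) = \<zero>\<^bsub>Z\<^esub>)"
    by (rule D.linear_dependence) (auto intro: fc)
  then obtain a where a: "\<forall>j\<in>{..<Suc n}. a j \<in> carrier Z" "\<exists>j\<in>{..<Suc n}. a j \<noteq> \<zero>\<^bsub>Z\<^esub>"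
      "\<forall>i\<in>{..<n}. (\<Oplus>\<^bsub>Z\<^esub>j\<in>{..<Suc n}. a j \<otimes>\<^bsub>Z\<^esub> ?x j i) = \<zero>\<^bsub>Z\<^esub>" by blast
  let ?v = "\<lambda>j\<in>{..<Suc n}. a j"
  have v: "?v \<in> carrier (V (Suc n))" using a(1) by (intro V_closedI) auto
  have "f ?v = \<zero>\<^bsub>V n\<^esub>"
  proof (rule V_eqI[of _ n])
    fix i assume i: "i < n"
    have "(\<lambda>v. f v i) \<in> module_hom Z (V (Suc n)) (regular_module Z)"
      using i module_homD[OF f] by (intro module_homI) (auto intro: V_memb[of _ n])
    then have "f ?v i = lincomb (Suc n) (regular_module Z) (\<lambda>j. ?x j i) ?v"
      by (rule hom_eq_lincomb[OF _ regular_module v])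
    also have "\<dots> = (\<Oplus>\<^bsub>Z\<^esub>j\<in>{..<Suc n}. ?v j \<otimes>\<^bsub>Z\<^esub> ?x j i)"
      unfolding lincomb_def using a(1) fc[OF i] by (subst regular_finsum) auto
    also have "\<dots> = (\<Oplus>\<^bsub>Z\<^esub>j\<in>{..<Suc n}. a j \<otimes>\<^bsub>Z\<^esub> ?x j i)"
      using a(1) fc[OF i] by (intro Z.finsum_cong') auto
    finally show "f ?v i = \<zero>\<^bsub>V n\<^esub> i" using a(3) i by simp
  qed (use module_homD(1)[OF f v] in auto)
  moreover obtain j where j: "j < Suc n" "a j \<noteq> \<zero>\<^bsub>Z\<^esub>" using a(2) by auto
  have "?v \<noteq> \<zero>\<^bsub>V (Suc n)\<^esub>"
  proof
    assume "?v = \<zero>\<^bsub>V (Suc n)\<^esub>"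
    then have "?v j = \<zero>\<^bsub>V (Suc n)\<^esub> j" by simp
    with j show False by simp
  qed
  ultimately show ?thesis using v that by blast
qed

text \<open>The map \<open>W\<close> lifts multiplication by \<open>p ^ k\<close> through \<open>A\<close>.  If \<open>A u = 0\<close>, then a kernel vector
  \<open>(y, t)\<close> of \<open>(y, t) \<mapsto> W y + t u\<close> satisfies \<open>p\<^sup>k y = 0\<close>, hence \<open>y = 0\<close> and \<open>t u = 0\<close> with
  \<open>t \<noteq> 0\<close>.\<close>

lemma finite_cokernel_injective:
  assumes A: "A \<in> module_hom Z (V n) (V n)"
    and im: "\<And>v. v \<in> carrier (V n) \<Longrightarrow> of_N (p ^ k) \<odot>\<^bsub>V n\<^esub> v \<in> A ` carrier (V n)"
  obtains W where "W \<in> module_hom Z (V n) (V n)"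
    "\<And>v. v \<in> carrier (V n) \<Longrightarrow> A (W v) = of_N (p ^ k) \<odot>\<^bsub>V n\<^esub> v"
    "\<And>v. v \<in> carrier (V n) \<Longrightarrow> A v = \<zero>\<^bsub>V n\<^esub> \<Longrightarrow> v = \<zero>\<^bsub>V n\<^esub>"
proof -
  obtain W where W: "W \<in> module_hom Z (V n) (V n)"
    "\<And>v. v \<in> carrier (V n) \<Longrightarrow> A (W v) = of_N (p ^ k) \<odot>\<^bsub>V n\<^esub> v"
    using free_lift[OF V_module V_module A module_hom_smult[OF V_module of_N_closed]] im by metis
  have pk: "of_N (p ^ k) \<noteq> \<zero>\<^bsub>Z\<^esub>" using prime prime_gt_0_nat by (intro of_N_nonzero) simp
  have "u = \<zero>\<^bsub>V n\<^esub>" if u: "u \<in> carrier (V n)" "A u = \<zero>\<^bsub>V n\<^esub>" for u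
  proof -
    let ?f = "\<lambda>x. W (restrict x {..<n}) \<oplus>\<^bsub>V n\<^esub> x n \<odot>\<^bsub>V n\<^esub> u"
    have "(\<lambda>a. a \<odot>\<^bsub>V n\<^esub> u) \<in> module_hom Z (regular_module Z) (V n)"
      using u by (intro module_homI) (auto simp: V.smult_l_distr V.smult_assoc1)
    then have f: "?f \<in> module_hom Z (V (Suc n)) (V n)"
      by (intro module_hom_add V_module module_hom_comp[OF front_hom W(1)] module_hom_comp[OF last_hom])
    obtain x where x: "x \<in> carrier (V (Suc n))" "x \<noteq> \<zero>\<^bsub>V (Suc n)\<^esub>" "?f x = \<zero>\<^bsub>V n\<^esub>"
      using kernel_nontrivial[OF f] by blast
    let ?y = "restrict x {..<n}"
    have y: "?y \<in> carrier (V n)" "x n \<in> carrier Z"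
      using x(1) module_homD(1)[OF front_hom] module_homD(1)[OF last_hom] by auto
    have "A (?f x) = of_N (p ^ k) \<odot>\<^bsub>V n\<^esub> ?y"
      using y u W(2) by (simp add: module_homD[OF A] module_homD(1)[OF W(1)])
    then have "of_N (p ^ k) \<odot>\<^bsub>V n\<^esub> ?y = \<zero>\<^bsub>V n\<^esub>"
      using x(3) module_hom_zero[OF V_module V_module A] by simp
    then have y0: "?y = \<zero>\<^bsub>V n\<^esub>" using V_torsion_free[OF of_N_closed pk y(1)] by blast
    then have "x n \<odot>\<^bsub>V n\<^esub> u = \<zero>\<^bsub>V n\<^esub>"
      using x(3) y u module_hom_zero[OF V_module V_module W(1)] by simp
    moreover have "x n \<noteq> \<zero>\<^bsub>Z\<^esub>"
    proof
      assume "x n = \<zero>\<^bsub>Z\<^esub>"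
      then have "x = \<zero>\<^bsub>V n\<^esub>(n := \<zero>\<^bsub>Z\<^esub>)" using snoc_front[OF x(1)] y0 by simp
      also have "\<dots> = \<zero>\<^bsub>V (Suc n)\<^esub>"
        using module_hom_zero[OF regular_module V_module inj_last_hom[of n]] by simp
      finally show False using x(2) by simp
    qed
    ultimately show ?thesis using V_torsion_free[OF y(2) _ u(1)] by blast
  qed
  with W show ?thesis using that by blast
qed

subsection \<open>Successive approximation\<close>

text \<open>Completeness of \<open>\<int>\<^sub>p\<close> in the form of Nakayama's lemma: a set whose elements can be approximated
  modulo \<open>p\<close> by the image of a matrix, with errors from the same set, lies in the image.\<close>

lemma successive_approximation:
  assumes M: "is_matrix p m n M" and S: "S \<subseteq> carrier (V m)"
    and approx: "\<And>y. y \<in> S \<Longrightarrow> \<exists>v\<in>carrier (V n). \<exists>y'\<in>S.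
      y = mat_vec p m n M v \<oplus>\<^bsub>V m\<^esub> of_N p \<odot>\<^bsub>V m\<^esub> y'"
  shows "S \<subseteq> mat_vec p m n M ` carrier (V n)"
proof
  fix y assume y: "y \<in> S"
  let ?A = "mat_vec p m n M"
  note A = mat_vec_hom[OF M]
  have "\<forall>y\<in>S. \<exists>v y'. v \<in> carrier (V n) \<and> y' \<in> S \<and> y = ?A v \<oplus>\<^bsub>V m\<^esub> of_N p \<odot>\<^bsub>V m\<^esub> y'"
    using approx by blast
  then obtain v nx where vn: "\<And>y. y \<in> S \<Longrightarrow> v y \<in> carrier (V n)" "\<And>y. y \<in> S \<Longrightarrow> nx y \<in> S"
    "\<And>y. y \<in> S \<Longrightarrow> y = ?A (v y) \<oplus>\<^bsub>V m\<^esub> of_N p \<odot>\<^bsub>V m\<^esub> nx y"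
    by metis
  define Y where "Y = rec_nat y (\<lambda>_. nx)"
  define s where "s = rec_nat \<zero>\<^bsub>V n\<^esub> (\<lambda>j x. x \<oplus>\<^bsub>V n\<^esub> of_N (p ^ j) \<odot>\<^bsub>V n\<^esub> v (Y j))"
  have YS: "Y j \<in> S" for j by (induction j) (auto simp: Y_def y vn)
  then have Yc [simp]: "Y j \<in> carrier (V m)" for j using S by blast
  have s_Suc: "s (Suc j) = s j \<oplus>\<^bsub>V n\<^esub> of_N (p ^ j) \<odot>\<^bsub>V n\<^esub> v (Y j)" for j by (simp add: s_def)
  have sc [simp]: "s j \<in> carrier (V n)" for j
    by (induction j) (auto simp: s_Suc vn YS, simp add: s_def)
  have eq: "y = ?A (s j) \<oplus>\<^bsub>V m\<^esub> of_N (p ^ j) \<odot>\<^bsub>V m\<^esub> Y j" for j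
  proof (induction j)
    case 0 then show ?case
      using module_hom_zero[OF V_module V_module A] S y of_N_simps(2) by (auto simp: s_def Y_def subset_iff)
  next
    case (Suc j)
    have "Y j = ?A (v (Y j)) \<oplus>\<^bsub>V m\<^esub> of_N p \<odot>\<^bsub>V m\<^esub> Y (Suc j)"
      using vn(3)[OF YS] by (simp add: Y_def)
    moreover have "?A (v (Y j)) \<in> carrier (V m)" "?A (s j) \<in> carrier (V m)"
      using module_homD(1)[OF A] vn(1)[OF YS] by auto
    moreover have "?A (s (Suc j)) = ?A (s j) \<oplus>\<^bsub>V m\<^esub> of_N (p ^ j) \<odot>\<^bsub>V m\<^esub> ?A (v (Y j))"
      unfolding s_Suc using vn(1)[OF YS] by (simp add: module_homD[OF A])
    moreover have "of_N (p ^ Suc j) = of_N (p ^ j) \<otimes>\<^bsub>Z\<^esub> of_N p"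
      using of_N_simps(4)[of "p ^ j" p] by (simp add: mult.commute)
    ultimately show ?case using Suc
      by (metis V.smult_assoc1 V.smult_closed V.smult_r_distr V.M.a_assoc Yc of_N_closed)
  qed
  have stab: "s (k + d) i k = s k i k" if "i < n" for i k d
  proof (induction d)
    case (Suc d)
    have "s (k + Suc d) i k = (s (k + d) i k + 0) mod int p ^ k"
      using that p_power_residue_zero[of k "k + d"] by (simp add: s_Suc Zp_simps(3))
    with Suc show ?case using Zp_mod_self[OF V_memb[OF sc that]] by simp
  qed simp
  \<comment> \<open>The limit of the partial solutions: \<open>s j\<close> is constant modulo \<open>p\<^sup>k\<close> for \<open>j \<ge> k\<close>, so its
    residue modulo \<open>p\<^sup>k\<close> can be read off at \<open>j = k\<close>.\<close>
  define t where "t = (\<lambda>i\<in>{..<n}. \<lambda>k. s k i k)"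
  have "(\<lambda>k. s k i k) \<in> carrier Z" if i: "i < n" for i
  proof -
    have "s (Suc k) i (Suc k) mod int p ^ k = s k i k" for k
      using Zp_residue[OF V_memb[OF sc i], of k "Suc k" "Suc k"] stab[OF i, of k 1] by simp
    moreover have "0 \<le> s k i k \<and> s k i k < int p ^ k" for k
      using V_memb[OF sc[of k] i] unfolding Zp_iff by blast
    ultimately show ?thesis unfolding Zp_iff by blast
  qed
  then have t: "t \<in> carrier (V n)" unfolding t_def by (intro V_closedI) auto
  have "?A t = y"
  proof (rule V_eqI[of _ m])
    fix i assume i: "i < m"
    show "?A t i = y i"
    proof
      fix k
      have "?A t i k = ?A (s k) i k"
        using mat_vec_residue[OF M t i] mat_vec_residue[OF M sc i] by (simp add: t_def)
      also have "\<dots> = y i k"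
      proof -
        have "y i k = (?A (s k) i k + 0) mod int p ^ k"
          using i p_power_residue_zero[of k k] by (subst eq[of k]) (simp add: Zp_simps(3))
        then show ?thesis using Zp_mod_self[OF V_memb[OF module_homD(1)[OF A sc] i]] by simp
      qed
      finally show "?A t i k = y i k" .
    qed
  qed (use module_homD(1)[OF A t] y S in auto)
  then show "y \<in> ?A ` carrier (V n)" using t by blast
qed

lemma same_residue_vec:
  assumes "v \<in> carrier (V n)" "w \<in> carrier (V n)" "\<And>i. i < n \<Longrightarrow> v i k = w i k"
  obtains z where "z \<in> carrier (V n)" "v = w \<oplus>\<^bsub>V n\<^esub> of_N (p ^ k) \<odot>\<^bsub>V n\<^esub> z"
proof -
  have "\<forall>i. \<exists>z. i < n \<longrightarrow> z \<in> carrier Z \<and> v i = w i \<oplus>\<^bsub>Z\<^esub> of_N (p ^ k) \<otimes>\<^bsub>Z\<^esub> z"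
    using assms same_residue V_memb by metis
  then obtain z where z: "\<And>i. i < n \<Longrightarrow> z i \<in> carrier Z \<and> v i = w i \<oplus>\<^bsub>Z\<^esub> of_N (p ^ k) \<otimes>\<^bsub>Z\<^esub> z i"
    by metis
  let ?z = "\<lambda>i\<in>{..<n}. z i"
  have zc: "?z \<in> carrier (V n)" using z by (intro V_closedI) simp
  moreover have "v = w \<oplus>\<^bsub>V n\<^esub> of_N (p ^ k) \<odot>\<^bsub>V n\<^esub> ?z"
    using assms zc z by (intro V_eqI[of _ n]) auto
  ultimately show ?thesis using that by blast
qed

text \<open>Let \<open>A\<close> and \<open>B\<close> be the two matrices.  Their difference has values in \<open>p \<cdot> p\<^sup>k \<int>\<^sub>p\<^sup>m\<close>, and
  \<open>p\<^sup>k \<int>\<^sub>p\<^sup>m\<close> is contained in the image of \<open>A\<close>.  Thus every element of \<open>p\<^sup>k \<int>\<^sub>p\<^sup>m\<close> is a value of \<open>B\<close> up to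
  \<open>p\<close> times another such element, and successive approximation puts \<open>p\<^sup>k \<int>\<^sub>p\<^sup>m\<close> into the image of \<open>B\<close>.\<close>

lemma image_locally_constant:
  assumes M: "is_matrix p m n M" and N: "is_matrix p m n N"
    and close: "\<And>i j. i < m \<Longrightarrow> j < n \<Longrightarrow> N (i, j) (Suc k) = M (i, j) (Suc k)"
    and im: "\<And>v. v \<in> carrier (V m) \<Longrightarrow> of_N (p ^ k) \<odot>\<^bsub>V m\<^esub> v \<in> mat_vec p m n M ` carrier (V n)"
  shows "mat_vec p m n N ` carrier (V n) = mat_vec p m n M ` carrier (V n)"
proof -
  let ?A = "mat_vec p m n M" and ?B = "mat_vec p m n N"
  note A = mat_vec_hom[OF M] and B = mat_vec_hom[OF N]
  have diff: "\<exists>z\<in>carrier (V m). ?B v = ?A v \<oplus>\<^bsub>V m\<^esub> of_N p \<odot>\<^bsub>V m\<^esub> (of_N (p ^ k) \<odot>\<^bsub>V m\<^esub> z)"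
    and diff': "\<exists>z\<in>carrier (V m). ?A v = ?B v \<oplus>\<^bsub>V m\<^esub> of_N p \<odot>\<^bsub>V m\<^esub> (of_N (p ^ k) \<odot>\<^bsub>V m\<^esub> z)"
    if v: "v \<in> carrier (V n)" for v
  proof -
    have r: "?B v i (Suc k) = ?A v i (Suc k)" if "i < m" for i
      using mat_vec_residue[OF M v that] mat_vec_residue[OF N v that] close[OF that] by simp
    have pk: "of_N (p ^ Suc k) \<odot>\<^bsub>V m\<^esub> z = of_N p \<odot>\<^bsub>V m\<^esub> (of_N (p ^ k) \<odot>\<^bsub>V m\<^esub> z)"
      if "z \<in> carrier (V m)" for z
      using that of_N_simps(4)[of p "p ^ k"] by (simp add: V.smult_assoc1)
    show "\<exists>z\<in>carrier (V m). ?B v = ?A v \<oplus>\<^bsub>V m\<^esub> of_N p \<odot>\<^bsub>V m\<^esub> (of_N (p ^ k) \<odot>\<^bsub>V m\<^esub> z)"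
      using same_residue_vec[OF module_homD(1)[OF B v] module_homD(1)[OF A v] r] pk by metis
    show "\<exists>z\<in>carrier (V m). ?A v = ?B v \<oplus>\<^bsub>V m\<^esub> of_N p \<odot>\<^bsub>V m\<^esub> (of_N (p ^ k) \<odot>\<^bsub>V m\<^esub> z)"
      using same_residue_vec[OF module_homD(1)[OF A v] module_homD(1)[OF B v] r[symmetric]] pk by metis
  qed
  have sub: "submodule (?A ` carrier (V n)) Z (V m)" "submodule (?B ` carrier (V n)) Z (V m)"
    by (intro V.submodule_image V_module A B)+
  let ?S = "(\<lambda>z. of_N (p ^ k) \<odot>\<^bsub>V m\<^esub> z) ` carrier (V m)"
  have S: "?S \<subseteq> ?B ` carrier (V n)"
  proof (rule successive_approximation[OF N])
    fix y assume "y \<in> ?S"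
    then obtain v where v: "v \<in> carrier (V n)" "y = ?A v" using im by blast
    then show "\<exists>v\<in>carrier (V n). \<exists>y'\<in>?S. y = ?B v \<oplus>\<^bsub>V m\<^esub> of_N p \<odot>\<^bsub>V m\<^esub> y'"
      using diff'[OF v(1)] by blast
  qed auto
  have "?B v \<in> ?A ` carrier (V n)" if v: "v \<in> carrier (V n)" for v
  proof -
    obtain z where z: "z \<in> carrier (V m)"
      "?B v = ?A v \<oplus>\<^bsub>V m\<^esub> of_N p \<odot>\<^bsub>V m\<^esub> (of_N (p ^ k) \<odot>\<^bsub>V m\<^esub> z)" using diff[OF v] by blast
    show ?thesis unfolding z(2) using v z(1)
      by (intro V.submoduleE(5)[OF sub(1)] V.submoduleE(4)[OF sub(1)] im) auto
  qed
  moreover have "?A v \<in> ?B ` carrier (V n)" if v: "v \<in> carrier (V n)" for v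
  proof -
    obtain z where z: "z \<in> carrier (V m)"
      "?A v = ?B v \<oplus>\<^bsub>V m\<^esub> of_N p \<odot>\<^bsub>V m\<^esub> (of_N (p ^ k) \<odot>\<^bsub>V m\<^esub> z)" using diff'[OF v] by blast
    have "of_N (p ^ k) \<odot>\<^bsub>V m\<^esub> z \<in> ?B ` carrier (V n)" using S z(1) by blast
    then show ?thesis unfolding z(2)
      using V.submoduleE(5)[OF sub(2) imageI[OF v]] V.submoduleE(4)[OF sub(2) of_N_closed] by blast
  qed
  ultimately show ?thesis by blast
qed

text \<open>Successive approximation for the \<open>1 \<times> 1\<close> matrix \<open>u\<close>: an inverse of \<open>u\<close> modulo \<open>p\<close> solves
  \<open>u v = y\<close> up to a multiple of \<open>p\<close>.\<close>

lemma unit_Zp: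
  assumes u: "u \<in> carrier Z" "u 1 \<noteq> 0"
  obtains w where "w \<in> carrier Z" "w \<otimes>\<^bsub>Z\<^esub> u = \<one>\<^bsub>Z\<^esub>"
proof -
  let ?M = "\<lambda>_. u"
  have M: "is_matrix p 1 1 ?M" using u by (simp add: is_matrix_def)
  have dot1: "dot 1 (\<lambda>_. u) v = u \<otimes>\<^bsub>Z\<^esub> v 0" if "v \<in> carrier (V 1)" for v
    using V_memb[OF that, of 0] u by (simp add: dot_def lessThan_Suc)
  have "u 1 < int p" "0 \<le> u 1" using u unfolding Zp_iff by (auto dest: spec[of _ 1])
  then have "\<not> int p dvd u 1" using u(2) by (auto dest: zdvd_imp_le)
  then have "coprime (u 1) (int p)"
    using prime prime_imp_coprime[of "int p" "u 1"] by (simp add: coprime_commute)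
  then obtain a b where ab: "a * u 1 + b * int p = 1"
    using bezout_int[of "u 1" "int p"] by (auto simp: coprime_iff_gcd_eq_1)
  define c where "c = nat (a mod int p)"
  have c: "(int c * u 1) mod int p = 1 mod int p"
  proof -
    have "(int c * u 1) mod int p = (a * u 1) mod int p"
      using prime prime_gt_0_nat[OF prime] by (simp add: c_def mod_mult_left_eq)
    also have "\<dots> = (a * u 1 + b * int p) mod int p" by simp
    finally show ?thesis by (simp only: ab)
  qed
  have "carrier (V 1) \<subseteq> mat_vec p 1 1 ?M ` carrier (V 1)"
  proof (rule successive_approximation[OF M])
    fix y assume y: "y \<in> carrier (V 1)"
    let ?v = "of_N c \<odot>\<^bsub>V 1\<^esub> y"
    have v: "?v \<in> carrier (V 1)" using y by simp
    have "y i 1 = mat_vec p 1 1 ?M ?v i 1" if i: "i < 1" for i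
    proof -
      have "mat_vec p 1 1 ?M ?v i 1 = ((int c * u 1) mod int p * y 0 1) mod int p"
        using i mat_vec_residue[OF M v i, of 1] by (simp add: Zp_simps of_N_def mod_simps mult_ac)
      also have "\<dots> = y 0 1 mod int p" unfolding c by (simp add: mod_simps)
      also have "\<dots> = y i 1" using i Zp_mod_self[OF V_memb[OF y, of 0], of 1] by simp
      finally show ?thesis by simp
    qed
    then obtain z where "z \<in> carrier (V 1)" "y = mat_vec p 1 1 ?M ?v \<oplus>\<^bsub>V 1\<^esub> of_N (p ^ 1) \<odot>\<^bsub>V 1\<^esub> z"
      using same_residue_vec[OF y module_homD(1)[OF mat_vec_hom[OF M] v]] by metis
    then show "\<exists>v\<in>carrier (V 1). \<exists>y'\<in>carrier (V 1). y = mat_vec p 1 1 ?M v \<oplus>\<^bsub>V 1\<^esub> of_N p \<odot>\<^bsub>V 1\<^esub> y'"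
      using v by auto
  qed simp
  then obtain v where v: "v \<in> carrier (V 1)" "unit_vec 1 0 = mat_vec p 1 1 ?M v"
    using unit_vec_closed[of 1 0] by blast
  then have "unit_vec 1 0 0 = u \<otimes>\<^bsub>Z\<^esub> v 0" using dot1[OF v(1)] by (simp add: mat_vec_dot)
  then have "v 0 \<otimes>\<^bsub>Z\<^esub> u = \<one>\<^bsub>Z\<^esub>" using V_memb[OF v(1), of 0] u by (simp add: unit_vec_nth Z.m_comm)
  with that V_memb[OF v(1), of 0] show ?thesis by auto
qed

text \<open>Every nonzero \<open>p\<close>-adic integer is a power of \<open>p\<close> times a unit.\<close>

lemma p_power_in_ideal:
  assumes b: "b \<in> carrier Z" "b \<noteq> \<zero>\<^bsub>Z\<^esub>"
  obtains j c where "c \<in> carrier Z" "c \<otimes>\<^bsub>Z\<^esub> b = of_N (p ^ j)"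
proof -
  obtain k where "b k \<noteq> 0" using b(2) by (auto simp: Zp_simps)
  moreover have "b 0 = 0" using b(1) unfolding Zp_iff by (auto dest: spec[of _ 0])
  ultimately have "\<not> (\<forall>j. b j = 0 \<longrightarrow> b (Suc j) = 0)"
    using nat_induct[of "\<lambda>j. b j = 0" k] by blast
  then obtain j where j: "b j = 0" "b (Suc j) \<noteq> 0" by blast
  obtain u where u: "u \<in> carrier Z" "b = of_N (p ^ j) \<otimes>\<^bsub>Z\<^esub> u"
    using divisible_by_p_power[OF b(1) j(1)] by blast
  have "u 1 \<noteq> 0"
  proof
    assume "u 1 = 0"
    then have "int p dvd u (Suc j)" using Zp_residue[OF u(1), of 1 "Suc j"] by auto
    then have "int p ^ Suc j dvd int p ^ j * u (Suc j)" by (simp add: mult_dvd_mono mult.commute)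
    then show False using j(2) u(2) by (simp add: p_power_residue)
  qed
  then obtain w where w: "w \<in> carrier Z" "w \<otimes>\<^bsub>Z\<^esub> u = \<one>\<^bsub>Z\<^esub>" using unit_Zp[OF u(1)] by blast
  then have "w \<otimes>\<^bsub>Z\<^esub> b = of_N (p ^ j)"
    using u Z.m_lcomm[of w "of_N (p ^ j)" u] by simp
  with w that show ?thesis by blast
qed

end

context padic
begin

section \<open>Haar measure\<close>

text \<open>The coset \<open>x + p\<^sup>k K\<close>, a ball of the \<open>p\<close>-adic topology.\<close>

definition padic_ball :: "(zp, 'b, 'm) module_scheme \<Rightarrow> nat \<Rightarrow> 'b \<Rightarrow> 'b set" where
  "padic_ball K k x = {x \<oplus>\<^bsub>K\<^esub> of_N (p ^ k) \<odot>\<^bsub>K\<^esub> y | y. y \<in> carrier K}"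

definition padic_borel :: "(zp, 'b, 'm) module_scheme \<Rightarrow> 'b measure" where
  "padic_borel K = sigma (carrier K) {U. padic_open p K U}"

lemma space_padic_borel [simp]: "space (padic_borel K) = carrier K"
  and sets_padic_borel: "sets (padic_borel K) = sigma_sets (carrier K) {U. padic_open p K U}"
proof -
  have "{U. padic_open p K U} \<subseteq> Pow (carrier K)" by (auto simp: padic_open_def)
  then show "space (padic_borel K) = carrier K" "sets (padic_borel K) = sigma_sets (carrier K) {U. padic_open p K U}"
    by (simp_all add: padic_borel_def space_measure_of_conv)
qed

lemma open_in_padic_borel: "padic_open p K U \<Longrightarrow> U \<in> sets (padic_borel K)"
  by (simp add: sets_padic_borel sigma_sets.Basic)

lemma padic_open_iff_ball:
  assumes K: "module Z K"
  shows "padic_open p K U \<longleftrightarrow> U \<subseteq> carrier K \<and> (\<forall>x\<in>U. \<exists>k. padic_ball K k x \<subseteq> U)"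
proof -
  have "(\<forall>y\<in>carrier K. x \<oplus>\<^bsub>K\<^esub> add_pow K (p ^ k) y \<in> U) \<longleftrightarrow> padic_ball K k x \<subseteq> U" for x k
    unfolding padic_ball_def using add_pow_eq_smult[OF K, of _ "p ^ k"] by auto
  then show ?thesis by (simp add: padic_open_def)
qed

lemma ball_props:
  assumes K: "module Z K" and x: "x \<in> carrier K"
  shows "padic_ball K k x \<subseteq> carrier K" "x \<in> padic_ball K k x" "padic_ball K 0 x = carrier K"
    and "y \<in> padic_ball K k x \<Longrightarrow> padic_ball K k y = padic_ball K k x"
    and "k \<le> l \<Longrightarrow> padic_ball K l x \<subseteq> padic_ball K k x"
    and "padic_ball K k x = (\<lambda>y. x \<oplus>\<^bsub>K\<^esub> y) ` padic_ball K k \<zero>\<^bsub>K\<^esub>"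
    and "padic_open p K (padic_ball K k x)"
proof -
  interpret K: Module.module Z K by fact
  show sub: "padic_ball K k x \<subseteq> carrier K" for k using x by (auto simp: padic_ball_def)
  have "x = x \<oplus>\<^bsub>K\<^esub> of_N (p ^ k) \<odot>\<^bsub>K\<^esub> \<zero>\<^bsub>K\<^esub>" for k using x by simp
  then show "x \<in> padic_ball K k x" unfolding padic_ball_def by blast
  have "y = x \<oplus>\<^bsub>K\<^esub> of_N (p ^ 0) \<odot>\<^bsub>K\<^esub> (y \<ominus>\<^bsub>K\<^esub> x)" if "y \<in> carrier K" for y
    using x that of_N_simps(2) by (simp add: a_minus_def K.M.add.m_lcomm[of x y] K.M.r_neg)
  then have "carrier K \<subseteq> padic_ball K 0 x" unfolding padic_ball_def using x K.M.minus_closed by blast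
  then show "padic_ball K 0 x = carrier K" using sub[of 0] by blast
  have trans: "padic_ball K k y \<subseteq> padic_ball K k x" if yx: "y \<in> padic_ball K k x" "x \<in> carrier K" for y x k
  proof
    fix z assume "z \<in> padic_ball K k y"
    then obtain b where b: "b \<in> carrier K" "z = y \<oplus>\<^bsub>K\<^esub> of_N (p ^ k) \<odot>\<^bsub>K\<^esub> b" by (auto simp: padic_ball_def)
    obtain a where a: "a \<in> carrier K" "y = x \<oplus>\<^bsub>K\<^esub> of_N (p ^ k) \<odot>\<^bsub>K\<^esub> a"
      using yx(1) unfolding padic_ball_def by blast
    have "z = x \<oplus>\<^bsub>K\<^esub> of_N (p ^ k) \<odot>\<^bsub>K\<^esub> (a \<oplus>\<^bsub>K\<^esub> b)"
      using a b that by (simp add: K.smult_r_distr K.M.a_assoc)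
    then show "z \<in> padic_ball K k x" using a(1) b(1) by (auto simp: padic_ball_def)
  qed
  have symm: "x \<in> padic_ball K k y" if y: "y \<in> padic_ball K k x" for y k
  proof -
    obtain a where a: "a \<in> carrier K" "y = x \<oplus>\<^bsub>K\<^esub> of_N (p ^ k) \<odot>\<^bsub>K\<^esub> a" using y by (auto simp: padic_ball_def)
    have "x = y \<oplus>\<^bsub>K\<^esub> of_N (p ^ k) \<odot>\<^bsub>K\<^esub> (\<ominus>\<^bsub>K\<^esub> a)"
      using a x by (simp add: K.smult_r_minus K.M.a_assoc K.M.r_neg)
    then show ?thesis using a(1) by (auto simp: padic_ball_def)
  qed
  show eq: "padic_ball K k y = padic_ball K k x" if "y \<in> padic_ball K k x" for y k
    using trans[OF that x] trans[OF symm[OF that]] that sub by blast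
  show mono: "padic_ball K l x \<subseteq> padic_ball K k x" if "k \<le> l" for k l
  proof
    fix z assume "z \<in> padic_ball K l x"
    then obtain b where b: "b \<in> carrier K" "z = x \<oplus>\<^bsub>K\<^esub> of_N (p ^ l) \<odot>\<^bsub>K\<^esub> b" by (auto simp: padic_ball_def)
    have "of_N (p ^ l) = of_N (p ^ k) \<otimes>\<^bsub>Z\<^esub> of_N (p ^ (l - k))"
      using that of_N_simps(4)[of "p ^ k" "p ^ (l - k)"] by (simp flip: power_add)
    then have "z = x \<oplus>\<^bsub>K\<^esub> of_N (p ^ k) \<odot>\<^bsub>K\<^esub> (of_N (p ^ (l - k)) \<odot>\<^bsub>K\<^esub> b)"
      using b by (simp add: K.smult_assoc1)
    then show "z \<in> padic_ball K k x" using b(1) by (auto simp: padic_ball_def)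
  qed
  show "padic_ball K k x = (\<lambda>y. x \<oplus>\<^bsub>K\<^esub> y) ` padic_ball K k \<zero>\<^bsub>K\<^esub>"
    using x by (force simp: padic_ball_def)
  show "padic_open p K (padic_ball K k x)"
    unfolding padic_open_iff_ball[OF K] using sub eq by blast
qed

text \<open>Any two balls are nested or disjoint.\<close>

lemma ball_Int_stable:
  assumes K: "module Z K"
  shows "Int_stable ({padic_ball K k x | k x. x \<in> carrier K} \<union> {{}})"
proof (rule Int_stableI)
  have *: "padic_ball K k x \<inter> padic_ball K l y \<in> {padic_ball K k x | k x. x \<in> carrier K} \<union> {{}}"
    if "k \<le> l" "x \<in> carrier K" "y \<in> carrier K" for k l x y
  proof (cases "padic_ball K k x \<inter> padic_ball K l y = {}")
    case False
    then obtain z where z: "z \<in> padic_ball K k x" "z \<in> padic_ball K l y" by blast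
    then have zc: "z \<in> carrier K" using ball_props(1)[OF K that(2)] by blast
    have "padic_ball K l y = padic_ball K l z" "padic_ball K k x = padic_ball K k z" using z that ball_props(4)[OF K] by blast+
    then have "padic_ball K k x \<inter> padic_ball K l y = padic_ball K l z" using ball_props(5)[OF K zc that(1)] by blast
    then show ?thesis using zc by blast
  qed auto
  fix a b assume "a \<in> {padic_ball K k x | k x. x \<in> carrier K} \<union> {{}}" "b \<in> {padic_ball K k x | k x. x \<in> carrier K} \<union> {{}}"
  then consider "a = {} \<or> b = {}" | k x l y where "a = padic_ball K k x" "b = padic_ball K l y" "x \<in> carrier K" "y \<in> carrier K"
    by blast
  then show "a \<inter> b \<in> {padic_ball K k x | k x. x \<in> carrier K} \<union> {{}}"
  proof cases
    case 2
    then show ?thesis using *[of k l x y] *[of l k y x] by (cases "k \<le> l") (auto simp: Int_commute)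
  qed auto
qed

text \<open>All subgroups \<open>p\<^sup>k K\<close> have finite index.\<close>

definition finite_index :: "(zp, 'b, 'm) module_scheme \<Rightarrow> bool" where
  "finite_index K \<longleftrightarrow> (\<forall>k. finite (padic_ball K k ` carrier K))"

text \<open>There are only countably many balls, so that every open set is a countable union of balls.\<close>

lemma sets_padic_borel_ball:
  assumes K: "module Z K" and fin: "finite_index K"
  shows "sets (padic_borel K) = sigma_sets (carrier K) ({padic_ball K k x | k x. x \<in> carrier K} \<union> {{}})"
    (is "_ = sigma_sets _ ?E")
proof -
  have E: "?E = (\<Union>k. padic_ball K k ` carrier K) \<union> {{}}" by blast
  have "countable (padic_ball K k ` carrier K)" for k
    using fin by (simp add: finite_index_def countable_finite)
  then have cE: "countable ?E" unfolding E by (intro countable_Un countable_UN) auto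
  have "sigma_sets (carrier K) {U. padic_open p K U} = sigma_sets (carrier K) ?E"
  proof (rule sigma_sets_eqI)
    fix U assume "U \<in> {U. padic_open p K U}"
    then have U: "U \<subseteq> carrier K" "\<And>x. x \<in> U \<Longrightarrow> \<exists>k. padic_ball K k x \<subseteq> U" by (auto simp: padic_open_iff_ball[OF K])
    have "U = \<Union>{B \<in> ?E. B \<subseteq> U}"
    proof
      show "U \<subseteq> \<Union>{B \<in> ?E. B \<subseteq> U}"
      proof
        fix x assume x: "x \<in> U"
        then obtain k where "padic_ball K k x \<subseteq> U" using U(2) by blast
        moreover have "x \<in> padic_ball K k x" using x U(1) ball_props(2)[OF K] by blast
        moreover have "padic_ball K k x \<in> ?E" using x U(1) by blast
        ultimately show "x \<in> \<Union>{B \<in> ?E. B \<subseteq> U}" by (intro UnionI[of "padic_ball K k x"]) simp_all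
      qed
    qed blast
    moreover have "countable {B \<in> ?E. B \<subseteq> U}" using cE by (rule countable_subset[rotated]) blast
    ultimately show "U \<in> sigma_sets (carrier K) ?E"
    proof (subst \<open>U = _\<close>, intro sigma_sets_UNION)
      fix B assume "B \<in> {B \<in> ?E. B \<subseteq> U}"
      then show "B \<in> sigma_sets (carrier K) ?E" by (intro sigma_sets.Basic) simp
    qed
  next
    fix B assume "B \<in> ?E"
    then consider "B = {}" | k x where "x \<in> carrier K" "B = padic_ball K k x" by blast
    then show "B \<in> sigma_sets (carrier K) {U. padic_open p K U}"
    proof cases
      case 2
      then show ?thesis using ball_props(7)[OF K] by (intro sigma_sets.Basic) simp
    qed (simp add: sigma_sets.Empty)
  qed
  then show ?thesis by (simp add: sets_padic_borel)
qed

lemma measure_eq_on_balls: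
  assumes K: "module Z K" and fin: "finite_index K"
    and \<mu>: "prob_space \<mu>" "sets \<mu> = sets (padic_borel K)" and \<nu>: "sets \<nu> = sets (padic_borel K)"
    and eq: "\<And>k x. x \<in> carrier K \<Longrightarrow> emeasure \<mu> (padic_ball K k x) = emeasure \<nu> (padic_ball K k x)"
  shows "\<mu> = \<nu>"
proof (rule measure_eqI_generator_eq[OF ball_Int_stable[OF K]])
  interpret K: Module.module Z K by fact
  interpret prob_space \<mu> by fact
  show "{padic_ball K k x | k x. x \<in> carrier K} \<union> {{}} \<subseteq> Pow (carrier K)"
    using ball_props(1)[OF K] by blast
  have "carrier K = padic_ball K 0 \<zero>\<^bsub>K\<^esub>" using ball_props(3)[OF K] by simp
  then show "range (\<lambda>_. carrier K) \<subseteq> {padic_ball K k x | k x. x \<in> carrier K} \<union> {{}}" by blast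
qed (use assms sets_padic_borel_ball[OF K fin] in \<open>auto simp: finite_measure.emeasure_finite prob_space.finite_measure\<close>)

lemma translation_measurable:
  assumes K: "module Z K" and a: "a \<in> carrier K"
  shows "(\<lambda>x. a \<oplus>\<^bsub>K\<^esub> x) \<in> measurable (padic_borel K) (padic_borel K)"
  unfolding padic_borel_def
proof (rule measurable_measure_of, unfold padic_borel_def[symmetric])
  interpret K: Module.module Z K by fact
  show "{U. padic_open p K U} \<subseteq> Pow (carrier K)" by (auto simp: padic_open_def)
  show "(\<lambda>x. a \<oplus>\<^bsub>K\<^esub> x) \<in> space (padic_borel K) \<rightarrow> carrier K" using a by auto
  fix U assume "U \<in> {U. padic_open p K U}"
  then have U: "padic_open p K U" by simp
  have "padic_open p K ((\<lambda>x. a \<oplus>\<^bsub>K\<^esub> x) -` U \<inter> carrier K)"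
    unfolding padic_open_def
  proof (intro conjI ballI)
    fix x assume x: "x \<in> (\<lambda>x. a \<oplus>\<^bsub>K\<^esub> x) -` U \<inter> carrier K"
    then obtain k where "\<forall>y\<in>carrier K. (a \<oplus>\<^bsub>K\<^esub> x) \<oplus>\<^bsub>K\<^esub> add_pow K (p ^ k) y \<in> U"
      using U by (auto simp: padic_open_def)
    then show "\<exists>k. \<forall>y\<in>carrier K. x \<oplus>\<^bsub>K\<^esub> add_pow K (p ^ k) y \<in> (\<lambda>x. a \<oplus>\<^bsub>K\<^esub> x) -` U \<inter> carrier K"
      using x a by (intro exI[of _ k]) (auto simp: K.M.a_assoc)
  qed auto
  then show "(\<lambda>x. a \<oplus>\<^bsub>K\<^esub> x) -` U \<inter> space (padic_borel K) \<in> sets (padic_borel K)"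
    using open_in_padic_borel by simp
qed

lemma translate_image:
  assumes K: "module Z K" and a: "a \<in> carrier K" and A: "A \<subseteq> carrier K"
  shows "(\<lambda>x. a \<oplus>\<^bsub>K\<^esub> x) ` A = (\<lambda>x. \<ominus>\<^bsub>K\<^esub> a \<oplus>\<^bsub>K\<^esub> x) -` A \<inter> carrier K"
proof (intro equalityI subsetI)
  interpret K: Module.module Z K by fact
  fix y assume "y \<in> (\<lambda>x. a \<oplus>\<^bsub>K\<^esub> x) ` A"
  then show "y \<in> (\<lambda>x. \<ominus>\<^bsub>K\<^esub> a \<oplus>\<^bsub>K\<^esub> x) -` A \<inter> carrier K"
    using a A by (auto simp: K.M.a_assoc[symmetric] K.M.l_neg)
next
  interpret K: Module.module Z K by fact
  fix y assume y: "y \<in> (\<lambda>x. \<ominus>\<^bsub>K\<^esub> a \<oplus>\<^bsub>K\<^esub> x) -` A \<inter> carrier K"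
  then have "y = a \<oplus>\<^bsub>K\<^esub> (\<ominus>\<^bsub>K\<^esub> a \<oplus>\<^bsub>K\<^esub> y)" using a by (auto simp: K.M.a_assoc[symmetric] K.M.r_neg)
  then show "y \<in> (\<lambda>x. a \<oplus>\<^bsub>K\<^esub> x) ` A" using y by blast
qed

lemma is_haar_iff:
  assumes K: "module Z K"
  shows "is_haar p K \<mu> \<longleftrightarrow> prob_space \<mu> \<and> sets \<mu> = sets (padic_borel K) \<and>
    (\<forall>a\<in>carrier K. distr \<mu> (padic_borel K) (\<lambda>x. a \<oplus>\<^bsub>K\<^esub> x) = \<mu>)"
proof -
  interpret K: Module.module Z K by fact
  have "(\<forall>a\<in>carrier K. \<forall>A\<in>sets \<mu>. emeasure \<mu> ((\<lambda>x. a \<oplus>\<^bsub>K\<^esub> x) ` A) = emeasure \<mu> A)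
      \<longleftrightarrow> (\<forall>a\<in>carrier K. distr \<mu> (padic_borel K) (\<lambda>x. a \<oplus>\<^bsub>K\<^esub> x) = \<mu>)" if s: "sets \<mu> = sets (padic_borel K)"
  proof -
    have sp: "space \<mu> = carrier K" using sets_eq_imp_space_eq[OF s] by simp
    have m: "(\<lambda>x. a \<oplus>\<^bsub>K\<^esub> x) \<in> measurable \<mu> (padic_borel K)" if "a \<in> carrier K" for a
      using translation_measurable[OF K that] measurable_cong_sets[OF s refl] by blast
    have d: "emeasure (distr \<mu> (padic_borel K) (\<lambda>x. \<ominus>\<^bsub>K\<^esub> a \<oplus>\<^bsub>K\<^esub> x)) A = emeasure \<mu> ((\<lambda>x. a \<oplus>\<^bsub>K\<^esub> x) ` A)"
      if "a \<in> carrier K" "A \<in> sets \<mu>" for a A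
      using that s sp m[of "\<ominus>\<^bsub>K\<^esub> a"] sets.sets_into_space[OF that(2)] translate_image[OF K that(1), of A]
      by (subst emeasure_distr) auto
    show ?thesis
    proof (intro iffI ballI)
      fix a assume L: "\<forall>a\<in>carrier K. \<forall>A\<in>sets \<mu>. emeasure \<mu> ((\<lambda>x. a \<oplus>\<^bsub>K\<^esub> x) ` A) = emeasure \<mu> A"
        and a: "a \<in> carrier K"
      show "distr \<mu> (padic_borel K) (\<lambda>x. a \<oplus>\<^bsub>K\<^esub> x) = \<mu>"
      proof (rule measure_eqI)
        fix A assume "A \<in> sets (distr \<mu> (padic_borel K) (\<lambda>x. a \<oplus>\<^bsub>K\<^esub> x))"
        then have A: "A \<in> sets \<mu>" using s by simp
        show "emeasure (distr \<mu> (padic_borel K) (\<lambda>x. a \<oplus>\<^bsub>K\<^esub> x)) A = emeasure \<mu> A"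
          using d[of "\<ominus>\<^bsub>K\<^esub> a" A] a A L by simp
      qed (simp add: s)
    next
      fix a A assume "\<forall>a\<in>carrier K. distr \<mu> (padic_borel K) (\<lambda>x. a \<oplus>\<^bsub>K\<^esub> x) = \<mu>" "a \<in> carrier K" "A \<in> sets \<mu>"
      then show "emeasure \<mu> ((\<lambda>x. a \<oplus>\<^bsub>K\<^esub> x) ` A) = emeasure \<mu> A"
        using d[of a A] by simp
    qed
  qed
  moreover have "space \<mu> = carrier K" if "sets \<mu> = sets (padic_borel K)"
    using sets_eq_imp_space_eq[OF that] by simp
  ultimately show ?thesis unfolding is_haar_def sets_padic_borel[symmetric] by auto
qed

text \<open>The balls of one radius form a finite partition into translates of each other, so their measure
  is determined by their number; and the balls form an intersection-stable generator.\<close>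

lemma haar_unique:
  assumes K: "module Z K" and fin: "finite_index K" and \<mu>: "is_haar p K \<mu>"
  shows "haar p K = \<mu>"
proof -
  have unique: "\<mu>' = \<mu>" if \<mu>': "is_haar p K \<mu>'" for \<mu>'
  proof (rule measure_eq_on_balls[OF K fin])
    have "measure \<mu> (padic_ball K k x) = 1 / real (card (padic_ball K k ` carrier K))"
      if h: "is_haar p K \<mu>" and x: "x \<in> carrier K" for \<mu> k x
    proof -
      interpret K: Module.module Z K by fact
      have h': "prob_space \<mu>" "sets \<mu> = sets (padic_borel K)" using h unfolding is_haar_iff[OF K] by auto
      interpret prob_space \<mu> by fact
      have sp: "space \<mu> = carrier K" using sets_eq_imp_space_eq[OF h'(2)] by simp
      have bs: "padic_ball K k y \<in> sets \<mu>" if "y \<in> carrier K" for y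
        unfolding h'(2) using ball_props(7)[OF K that] by (rule open_in_padic_borel)
      have tr: "measure \<mu> (padic_ball K k y) = measure \<mu> (padic_ball K k \<zero>\<^bsub>K\<^esub>)" if y: "y \<in> carrier K" for y
        using h bs[of "\<zero>\<^bsub>K\<^esub>"] y ball_props(6)[OF K y] by (simp add: is_haar_def measure_def)
      have "1 = measure \<mu> (\<Union>B\<in>padic_ball K k ` carrier K. B)"
      proof -
        have "(\<Union>B\<in>padic_ball K k ` carrier K. B) = space \<mu>"
          unfolding sp
        proof (intro equalityI subsetI)
          fix y assume "y \<in> (\<Union>B\<in>padic_ball K k ` carrier K. B)"
          then obtain z where "z \<in> carrier K" "y \<in> padic_ball K k z" by blast
          then show "y \<in> carrier K" using ball_props(1)[OF K, of z k] by blast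
        next
          fix y assume y: "y \<in> carrier K"
          then show "y \<in> (\<Union>B\<in>padic_ball K k ` carrier K. B)"
            using ball_props(2)[OF K y, of k] by blast
        qed
        then show ?thesis using prob_space by simp
      qed
      also have "\<dots> = (\<Sum>B\<in>padic_ball K k ` carrier K. measure \<mu> B)"
      proof (rule finite_measure_finite_Union)
        show "finite (padic_ball K k ` carrier K)" using fin by (simp add: finite_index_def)
        show "(\<lambda>B. B) ` padic_ball K k ` carrier K \<subseteq> events" using bs by (simp add: image_subset_iff)
        show "disjoint_family_on (\<lambda>B. B) (padic_ball K k ` carrier K)"
        proof (unfold disjoint_family_on_def, intro ballI impI)
          fix B C assume "B \<in> padic_ball K k ` carrier K" "C \<in> padic_ball K k ` carrier K" and ne: "B \<noteq> C"
          then obtain y z where yz: "y \<in> carrier K" "z \<in> carrier K" "B = padic_ball K k y" "C = padic_ball K k z" by blast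
          have "padic_ball K k t = B \<and> padic_ball K k t = C" if "t \<in> B" "t \<in> C" for t
            using ball_props(4)[OF K yz(1), of t k] ball_props(4)[OF K yz(2), of t k] that
            unfolding yz(3,4) by blast
          then show "B \<inter> C = {}" using ne by blast
        qed
      qed
      also have "\<dots> = (\<Sum>B\<in>padic_ball K k ` carrier K. measure \<mu> (padic_ball K k x))"
      proof (rule sum.cong[OF refl])
        fix B assume "B \<in> padic_ball K k ` carrier K"
        then obtain y where "y \<in> carrier K" "B = padic_ball K k y" by blast
        then show "measure \<mu> B = measure \<mu> (padic_ball K k x)" using tr[of y] tr[OF x] by metis
      qed
      finally have *: "1 = real (card (padic_ball K k ` carrier K)) * measure \<mu> (padic_ball K k x)" by simp
      then have "real (card (padic_ball K k ` carrier K)) \<noteq> 0" by (intro notI) simp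
      then show ?thesis using * by (simp add: nonzero_eq_divide_eq mult.commute)
    qed
    note meas = this
    show "emeasure \<mu>' (padic_ball K k x) = emeasure \<mu> (padic_ball K k x)" if "x \<in> carrier K" for k x
    proof -
      interpret a: prob_space \<mu> using \<mu> by (simp add: is_haar_def)
      interpret b: prob_space \<mu>' using \<mu>' by (simp add: is_haar_def)
      show ?thesis using meas[OF \<mu> that] meas[OF \<mu>' that] by (simp add: a.emeasure_eq_measure b.emeasure_eq_measure)
    qed
    show "prob_space \<mu>'" "sets \<mu>' = sets (padic_borel K)" "sets \<mu> = sets (padic_borel K)"
      using \<mu> \<mu>' unfolding is_haar_iff[OF K] by blast+
  qed
  show ?thesis unfolding haar_def using \<mu> unique by (rule the_equality)
qed

text \<open>A translation permutes the balls of each radius.  Invariance therefore needs to be checked only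
  by comparing balls.\<close>

lemma ball_invariant_is_haar:
  assumes K: "module Z K" and fin: "finite_index K" and \<mu>: "prob_space \<mu>" "sets \<mu> = sets (padic_borel K)"
    and inv: "\<And>k x y. x \<in> carrier K \<Longrightarrow> y \<in> carrier K \<Longrightarrow> emeasure \<mu> (padic_ball K k x) = emeasure \<mu> (padic_ball K k y)"
  shows "is_haar p K \<mu>"
  unfolding is_haar_iff[OF K]
proof (intro conjI ballI \<mu>)
  interpret K: Module.module Z K by fact
  fix a assume a: "a \<in> carrier K"
  have m: "(\<lambda>x. a \<oplus>\<^bsub>K\<^esub> x) \<in> measurable \<mu> (padic_borel K)"
    using translation_measurable[OF K a] measurable_cong_sets[OF \<mu>(2) refl] by blast
  have sp: "space \<mu> = carrier K" using sets_eq_imp_space_eq[OF \<mu>(2)] by simp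
  have "\<mu> = distr \<mu> (padic_borel K) (\<lambda>x. a \<oplus>\<^bsub>K\<^esub> x)"
  proof (rule measure_eq_on_balls[OF K fin \<mu>])
    fix k x assume x: "x \<in> carrier K"
    have xa: "\<ominus>\<^bsub>K\<^esub> a \<oplus>\<^bsub>K\<^esub> x \<in> carrier K" using a x by simp
    have "(\<lambda>x. a \<oplus>\<^bsub>K\<^esub> x) -` padic_ball K k x \<inter> space \<mu> = padic_ball K k (\<ominus>\<^bsub>K\<^esub> a \<oplus>\<^bsub>K\<^esub> x)"
    proof -
      have "(\<lambda>x. a \<oplus>\<^bsub>K\<^esub> x) -` padic_ball K k x \<inter> space \<mu> = (\<lambda>y. \<ominus>\<^bsub>K\<^esub> a \<oplus>\<^bsub>K\<^esub> y) ` padic_ball K k x"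
        using translate_image[OF K K.M.a_inv_closed[OF a] ball_props(1)[OF K x]] a sp by simp
      also have "\<dots> = (\<lambda>y. \<ominus>\<^bsub>K\<^esub> a \<oplus>\<^bsub>K\<^esub> x \<oplus>\<^bsub>K\<^esub> y) ` padic_ball K k \<zero>\<^bsub>K\<^esub>"
        unfolding ball_props(6)[OF K x] image_image using a x ball_props(1)[OF K K.M.zero_closed, of k]
        by (intro image_cong) (auto simp: K.M.a_assoc)
      finally show ?thesis using ball_props(6)[OF K xa] by simp
    qed
    then show "emeasure \<mu> (padic_ball K k x) = emeasure (distr \<mu> (padic_borel K) (\<lambda>x. a \<oplus>\<^bsub>K\<^esub> x)) (padic_ball K k x)"
      using inv[OF x xa] open_in_padic_borel[OF ball_props(7)[OF K x]] by (subst emeasure_distr[OF m]) auto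
  qed simp
  then show "distr \<mu> (padic_borel K) (\<lambda>x. a \<oplus>\<^bsub>K\<^esub> x) = \<mu>" by simp
qed

subsection \<open>Haar measure on the $p$-adic integers\<close>

lemma ball_Zp:
  assumes x: "x \<in> carrier Z"
  shows "padic_ball (regular_module Z) k x = {y \<in> carrier Z. y k = x k}"
proof (intro equalityI subsetI)
  fix y assume "y \<in> padic_ball (regular_module Z) k x"
  then obtain z where z: "z \<in> carrier Z" "y = x \<oplus>\<^bsub>Z\<^esub> of_N (p ^ k) \<otimes>\<^bsub>Z\<^esub> z" by (auto simp: padic_ball_def)
  have "y k = (x k + 0) mod int p ^ k"
    using p_power_residue_zero[of k k z] z(2) by (simp add: Zp_simps(3))
  then show "y \<in> {y \<in> carrier Z. y k = x k}" using x z Zp_mod_self[OF x] by simp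
next
  fix y assume "y \<in> {y \<in> carrier Z. y k = x k}"
  then obtain z where "z \<in> carrier Z" "y = x \<oplus>\<^bsub>Z\<^esub> of_N (p ^ k) \<otimes>\<^bsub>Z\<^esub> z"
    using same_residue[of y x k] x by auto
  then show "y \<in> padic_ball (regular_module Z) k x" by (auto simp: padic_ball_def)
qed

lemma finite_index_Zp: "finite_index (regular_module Z)"
  unfolding finite_index_def
proof
  fix k
  have "padic_ball (regular_module Z) k ` carrier Z \<subseteq> (\<lambda>r. {y \<in> carrier Z. y k = r}) ` {0..<int p ^ k}"
  proof
    fix B assume "B \<in> padic_ball (regular_module Z) k ` carrier Z"
    then obtain x where x: "x \<in> carrier Z" "B = padic_ball (regular_module Z) k x" by blast
    have "x k \<in> {0..<int p ^ k}" using x(1) unfolding Zp_iff by auto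
    then show "B \<in> (\<lambda>r. {y \<in> carrier Z. y k = r}) ` {0..<int p ^ k}" using x ball_Zp by blast
  qed
  then show "finite (padic_ball (regular_module Z) k ` carrier (regular_module Z))"
    by (simp add: finite_subset)
qed

lemma padic_open_regular: "padic_open p (regular_module Z) = padic_open p Z"
  by (intro ext) (simp add: padic_open_def regular_add_pow)

lemma is_haar_regular: "is_haar p (regular_module Z) = is_haar p Z"
  by (intro ext) (simp add: is_haar_def padic_open_regular)

text \<open>A Haar-random \<open>p\<close>-adic integer has independent uniform digits.\<close>

lemma Zp_haar_exists: "\<exists>\<mu>. is_haar p (regular_module Z) \<mu>"
proof -
  define d where "d = uniform_count_measure {0..<int p}"
  have p1: "1 < int p" using prime_gt_1_nat[OF prime] by simp
  have d: "prob_space d" unfolding d_def using p1 by (intro prob_space_uniform_count_measure) auto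
  interpret d: prob_space d by fact
  interpret D: product_prob_space "\<lambda>_::nat. d" UNIV ..
  let ?D = "PiM (UNIV :: nat set) (\<lambda>_. d)"
  \<comment> \<open>The \<open>p\<close>-adic integer with the digits \<open>e\<close>.\<close>
  define f where "f e = (\<lambda>k. \<Sum>j<k. e j * int p ^ j)" for e :: "nat \<Rightarrow> int"
  have e01: "0 \<le> e j \<and> e j < int p" if "e \<in> space ?D" for e j
    using that by (auto simp: space_PiM d_def space_uniform_count_measure PiE_def Pi_iff)
  have bound: "0 \<le> f e k \<and> f e k < int p ^ k" if e: "e \<in> space ?D" for e k
  proof (induction k)
    case (Suc k)
    have "e k * int p ^ k \<le> (int p - 1) * int p ^ k" using e01[OF e, of k] by (intro mult_right_mono) auto
    with Suc e01[OF e, of k] show ?case by (simp add: f_def left_diff_distrib)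
  qed (simp add: f_def)
  have f_mod: "f e (Suc k) mod int p ^ k = f e k" "f e (Suc k) div int p ^ k = e k" if e: "e \<in> space ?D" for e k
  proof -
    have "f e (Suc k) = f e k + e k * int p ^ k" by (simp add: f_def)
    then show "f e (Suc k) mod int p ^ k = f e k" "f e (Suc k) div int p ^ k = e k"
      using bound[OF e, of k] p1 by simp_all
  qed
  have fZ: "f e \<in> carrier Z" if "e \<in> space ?D" for e
    unfolding Zp_iff using bound[OF that] f_mod(1)[OF that] by simp
  have level: "f e k = x k \<longleftrightarrow> (\<forall>j<k. e j = x (Suc j) div int p ^ j)"
    if e: "e \<in> space ?D" and x: "x \<in> carrier Z" for e x k
  proof (induction k)
    case 0 then show ?case using x unfolding Zp_iff by (auto simp: f_def dest: spec[of _ 0])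
  next
    case (Suc k)
    have "f e (Suc k) = x (Suc k) \<longleftrightarrow> f e (Suc k) mod int p ^ k = x (Suc k) mod int p ^ k
        \<and> f e (Suc k) div int p ^ k = x (Suc k) div int p ^ k"
      by (metis div_mult_mod_eq)
    also have "\<dots> \<longleftrightarrow> f e k = x k \<and> e k = x (Suc k) div int p ^ k"
      using x f_mod[OF e] by (simp add: Zp_iff)
    finally show ?case using Suc by (auto simp: less_Suc_eq)
  qed
  have digit: "x (Suc j) div int p ^ j \<in> {0..<int p}" if x: "x \<in> carrier Z" for x j
  proof -
    have x0: "0 \<le> x (Suc j)" "x (Suc j) < int p ^ Suc j" using x unfolding Zp_iff by blast+
    have "int p ^ j * (x (Suc j) div int p ^ j) \<le> x (Suc j)"
      using p_pos[of j] by (simp add: minus_mod_eq_mult_div[symmetric])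
    then have "int p ^ j * (x (Suc j) div int p ^ j) < int p ^ j * int p"
      using x0(2)[unfolded power_Suc2] by linarith
    then have "x (Suc j) div int p ^ j < int p" using p_pos[of j] by (simp only: mult_less_cancel_left_pos)
    moreover have "0 \<le> x (Suc j) div int p ^ j" using x0(1) p_pos[of j] by (simp add: pos_imp_zdiv_nonneg_iff)
    ultimately show ?thesis by simp
  qed
  let ?R = "regular_module Z"
  have pre: "f -` padic_ball ?R k x \<inter> space ?D = {e \<in> space ?D. \<forall>j\<in>{..<k}. e j \<in> {x (Suc j) div int p ^ j}}"
    if "x \<in> carrier Z" for k x
    using level[OF _ that] fZ ball_Zp[OF that] by auto
  have ds: "{r} \<in> sets d" if "r \<in> {0..<int p}" for r
    using that by (simp add: d_def sets_uniform_count_measure)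
  have m: "f \<in> measurable ?D (padic_borel ?R)"
  proof (rule measurable_sigma_sets)
    show "sets (padic_borel ?R) = sigma_sets (carrier ?R) ({padic_ball ?R k x | k x. x \<in> carrier ?R} \<union> {{}})"
      by (rule sets_padic_borel_ball[OF regular_module finite_index_Zp])
    show "{padic_ball ?R k x | k x. x \<in> carrier ?R} \<union> {{}} \<subseteq> Pow (carrier ?R)"
      using ball_props(1)[OF regular_module] by blast
    show "f \<in> space ?D \<rightarrow> carrier ?R" using fZ by auto
    fix B assume "B \<in> {padic_ball ?R k x | k x. x \<in> carrier ?R} \<union> {{}}"
    then consider "B = {}" | k x where "x \<in> carrier Z" "B = padic_ball ?R k x" by auto
    then show "f -` B \<inter> space ?D \<in> sets ?D"
    proof cases
      case 2
      have "{e \<in> space ?D. \<forall>j\<in>{..<k}. e j \<in> {x (Suc j) div int p ^ j}} \<in> sets ?D"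
      proof (rule sets.sets_Collect_finite_All)
        fix j
        have "(\<lambda>e. e j) -` {x (Suc j) div int p ^ j} \<inter> space ?D \<in> sets ?D"
          using ds[OF digit[OF 2(1)]] by (rule measurable_sets[OF measurable_component_singleton[OF UNIV_I]])
        moreover have "(\<lambda>e. e j) -` {x (Suc j) div int p ^ j} \<inter> space ?D
            = {e \<in> space ?D. e j \<in> {x (Suc j) div int p ^ j}}" by blast
        ultimately show "{e \<in> space ?D. e j \<in> {x (Suc j) div int p ^ j}} \<in> sets ?D" by simp
      qed simp
      then show ?thesis using pre[OF 2(1)] 2(2) by simp
    qed simp
  qed
  have "is_haar p ?R (distr ?D (padic_borel ?R) f)"
  proof (rule ball_invariant_is_haar[OF regular_module finite_index_Zp])
    show "prob_space (distr ?D (padic_borel ?R) f)" using m by (rule D.prob_space_distr)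
    have "emeasure (distr ?D (padic_borel ?R) f) (padic_ball ?R k x) = (\<Prod>j<k. ennreal (1 / real p))" if x: "x \<in> carrier Z" for k x
    proof -
      have "emeasure (distr ?D (padic_borel ?R) f) (padic_ball ?R k x) = emeasure ?D {e \<in> space ?D. \<forall>j\<in>{..<k}. e j \<in> {x (Suc j) div int p ^ j}}"
        using x by (subst emeasure_distr[OF m]) (auto intro!: open_in_padic_borel ball_props(7) regular_module simp: pre)
      also have "\<dots> = (\<Prod>j<k. emeasure d {x (Suc j) div int p ^ j})"
        using ds digit[OF x] by (intro D.emeasure_PiM_Collect) auto
      also have "\<dots> = (\<Prod>j<k. ennreal (1 / real p))"
        using digit[OF x] by (intro prod.cong refl) (simp add: d_def emeasure_uniform_count_measure)
      finally show ?thesis .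
    qed
    then show "emeasure (distr ?D (padic_borel ?R) f) (padic_ball ?R k x) = emeasure (distr ?D (padic_borel ?R) f) (padic_ball ?R k y)"
      if "x \<in> carrier ?R" "y \<in> carrier ?R" for k x y using that by simp
  qed simp
  then show ?thesis by blast
qed

abbreviation \<mu>Z :: "zp measure" where "\<mu>Z \<equiv> haar p Z"

lemma haar_Zp: "is_haar p (regular_module Z) \<mu>Z"
proof -
  have "haar p (regular_module Z) = haar p Z" by (simp add: haar_def is_haar_regular)
  then show ?thesis using Zp_haar_exists haar_unique[OF regular_module finite_index_Zp] by metis
qed

lemma prob_\<mu>Z: "prob_space \<mu>Z" and sets_\<mu>Z: "sets \<mu>Z = sets (padic_borel (regular_module Z))"
  and space_\<mu>Z [simp]: "space \<mu>Z = carrier Z"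
  using haar_Zp unfolding is_haar_def sets_padic_borel by auto

lemma haar_Zp_translate:
  "a \<in> carrier Z \<Longrightarrow> distr \<mu>Z (padic_borel (regular_module Z)) (\<lambda>x. a \<oplus>\<^bsub>Z\<^esub> x) = \<mu>Z"
proof -
  assume a: "a \<in> carrier Z"
  have eq: "(\<lambda>x. a \<oplus>\<^bsub>Z\<^esub> x) = (\<lambda>x. a \<oplus>\<^bsub>regular_module Z\<^esub> x)" by (intro ext) simp
  have "distr \<mu>Z (padic_borel (regular_module Z)) (\<lambda>x. a \<oplus>\<^bsub>regular_module Z\<^esub> x) = \<mu>Z"
    using haar_Zp a unfolding is_haar_iff[OF regular_module] regular_simps(1) by blast
  then show ?thesis by (simp only: eq)
qed

lemma residue_class_sets: "{x \<in> carrier Z. x k = r} \<in> sets \<mu>Z"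
proof (cases "\<exists>x\<in>carrier Z. x k = r")
  case True
  then obtain x where "x \<in> carrier Z" "x k = r" by blast
  then show ?thesis
    using open_in_padic_borel[OF ball_props(7)[OF regular_module, of x k]] by (simp add: ball_Zp sets_\<mu>Z)
next
  case False
  then have "{x \<in> carrier Z. x k = r} = {}" by blast
  then show ?thesis by (simp only: sets.empty_sets)
qed

subsection \<open>Haar measure on free modules\<close>

abbreviation haar_family :: "'i set \<Rightarrow> ('i \<Rightarrow> zp) measure" where
  "haar_family I \<equiv> PiM I (\<lambda>_. \<mu>Z)"

lemma space_haar_family [simp]: "space (haar_family I) = I \<rightarrow>\<^sub>E carrier Z"
  by (simp add: space_PiM)

lemma space_haar_V: "space (haar_family {..<n}) = carrier (V n)"
  by (simp add: V_simps)

lemma prob_haar_family: "prob_space (haar_family I)"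
  by (intro prob_space_PiM prob_\<mu>Z)

text \<open>Such a set is a union of boxes of residue classes, and there are only countably many of them.\<close>

lemma locally_constant_sets:
  assumes I: "finite I" and D: "D \<subseteq> I \<rightarrow>\<^sub>E carrier Z"
    and loc: "\<And>w. w \<in> D \<Longrightarrow> \<exists>k. \<forall>w'\<in>I \<rightarrow>\<^sub>E carrier Z. (\<forall>i\<in>I. w' i k = w i k) \<longrightarrow> w' \<in> D"
  shows "D \<in> sets (haar_family I)"
proof -
  define C where "C k r = (\<Pi>\<^sub>E i\<in>I. {x \<in> carrier Z. x k = r i})" for k and r :: "'a \<Rightarrow> int"
  define S where "S = {(k, r). r \<in> (\<Pi>\<^sub>E i\<in>I. {0..<int p ^ k}) \<and> C k r \<subseteq> D}"
  have C: "C k r \<in> sets (haar_family I)" for k r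
    unfolding C_def using I residue_class_sets by (intro sets_PiM_I_finite) auto
  have "S \<subseteq> (SIGMA k:UNIV. \<Pi>\<^sub>E i\<in>I. {0..<int p ^ k})" by (auto simp: S_def)
  moreover have "countable (SIGMA k:UNIV. \<Pi>\<^sub>E i\<in>I. {0..<int p ^ k})"
    using I by (intro countable_SIGMA countable_UN countable_finite[OF finite_PiE]) auto
  ultimately have S: "countable S" using countable_subset by blast
  have D_eq: "D = (\<Union>(k, r)\<in>S. C k r)"
  proof (intro equalityI subsetI)
    fix w assume w: "w \<in> D"
    then obtain k where k: "\<forall>w'\<in>I \<rightarrow>\<^sub>E carrier Z. (\<forall>i\<in>I. w' i k = w i k) \<longrightarrow> w' \<in> D" using loc by blast
    let ?r = "\<lambda>i\<in>I. w i k"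
    have wI: "w i \<in> carrier Z" if "i \<in> I" for i using w D that by auto
    have "?r \<in> (\<Pi>\<^sub>E i\<in>I. {0..<int p ^ k})" using wI unfolding Zp_iff by auto
    moreover have "C k ?r \<subseteq> D"
    proof
      fix w' assume "w' \<in> C k ?r"
      then have "w' \<in> I \<rightarrow>\<^sub>E carrier Z" "\<forall>i\<in>I. w' i k = w i k" by (auto simp: C_def PiE_def Pi_iff)
      then show "w' \<in> D" using k by blast
    qed
    moreover have "w \<in> C k ?r" using w D wI by (auto simp: C_def PiE_def)
    ultimately show "w \<in> (\<Union>(k, r)\<in>S. C k r)" unfolding S_def by blast
  qed (auto simp: S_def)
  show ?thesis unfolding D_eq
    by (rule sets.countable_UN'[OF S]) (auto simp: C)
qed

lemma haar_family_translate:
  assumes I: "finite I" and b: "b \<in> I \<rightarrow>\<^sub>E carrier Z"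
  shows "(\<lambda>w. \<lambda>i\<in>I. b i \<oplus>\<^bsub>Z\<^esub> w i) \<in> measurable (haar_family I) (haar_family I)"
    and "distr (haar_family I) (haar_family I) (\<lambda>w. \<lambda>i\<in>I. b i \<oplus>\<^bsub>Z\<^esub> w i) = haar_family I"
proof -
  interpret product_prob_space "\<lambda>_. \<mu>Z" I by (intro product_prob_spaceI prob_\<mu>Z)
  let ?T = "\<lambda>w. \<lambda>i\<in>I. b i \<oplus>\<^bsub>Z\<^esub> w i"
  have t: "(\<lambda>x. b i \<oplus>\<^bsub>Z\<^esub> x) \<in> measurable \<mu>Z \<mu>Z" if "i \<in> I" for i
    using translation_measurable[OF regular_module, of "b i"] b that
      measurable_cong_sets[OF sets_\<mu>Z sets_\<mu>Z] by auto
  show m: "?T \<in> measurable (haar_family I) (haar_family I)"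
  proof (rule measurable_restrict)
    fix i assume i: "i \<in> I"
    have "(\<lambda>w. w i) \<in> measurable (haar_family I) \<mu>Z" using i by (rule measurable_component_singleton)
    then show "(\<lambda>w. b i \<oplus>\<^bsub>Z\<^esub> w i) \<in> measurable (haar_family I) \<mu>Z"
      using t[OF i] by (rule measurable_compose)
  qed
  show "distr (haar_family I) (haar_family I) ?T = haar_family I"
  proof (rule PiM_eqI[OF I])
    fix A assume A: "\<And>i. i \<in> I \<Longrightarrow> A i \<in> sets \<mu>Z"
    let ?A = "\<lambda>i. (\<lambda>x. b i \<oplus>\<^bsub>Z\<^esub> x) -` A i \<inter> space \<mu>Z"
    have A': "?A i \<in> sets \<mu>Z" if "i \<in> I" for i using measurable_sets[OF t[OF that] A[OF that]] .
    have "emeasure (distr (haar_family I) (haar_family I) ?T) (Pi\<^sub>E I A) = emeasure (haar_family I) (?T -` Pi\<^sub>E I A \<inter> space (haar_family I))"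
      using A I by (intro emeasure_distr m sets_PiM_I_finite) auto
    also have "?T -` Pi\<^sub>E I A \<inter> space (haar_family I) = Pi\<^sub>E I ?A"
      by (auto simp: PiE_iff)
    also have "emeasure (haar_family I) (Pi\<^sub>E I ?A) = (\<Prod>i\<in>I. emeasure \<mu>Z (?A i))"
      using A' I by (intro emeasure_PiM) auto
    also have "\<dots> = (\<Prod>i\<in>I. emeasure \<mu>Z (A i))"
    proof (intro prod.cong refl)
      fix i assume i: "i \<in> I"
      have bi: "b i \<in> carrier Z" using b i by auto
      have "emeasure \<mu>Z (A i) = emeasure (distr \<mu>Z \<mu>Z (\<lambda>x. b i \<oplus>\<^bsub>Z\<^esub> x)) (A i)"
        using haar_Zp_translate[OF bi] distr_cong[OF refl sets_\<mu>Z refl, of \<mu>Z "\<lambda>x. b i \<oplus>\<^bsub>Z\<^esub> x"] by simp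
      then show "emeasure \<mu>Z (?A i) = emeasure \<mu>Z (A i)" using emeasure_distr[OF t[OF i] A[OF i]] by simp
    qed
    finally show "emeasure (distr (haar_family I) (haar_family I) ?T) (Pi\<^sub>E I A) = (\<Prod>i\<in>I. emeasure \<mu>Z (A i))" .
  qed simp
qed

lemma indep_haar_distr:
  assumes P: "prob_space P" and X: "indep_haar p P X (f ` I)" and I: "finite I" "inj_on f I"
  shows "(\<lambda>w. \<lambda>i\<in>I. X (f i) w) \<in> measurable P (haar_family I)"
    and "distr P (haar_family I) (\<lambda>w. \<lambda>i\<in>I. X (f i) w) = haar_family I"
proof -
  interpret PP: prob_space P by fact
  interpret product_prob_space "\<lambda>_. \<mu>Z" I by (intro product_prob_spaceI prob_\<mu>Z)
  have ind: "PP.indep_vars (\<lambda>_. \<mu>Z) X (f ` I)" and dX: "\<And>i. i \<in> I \<Longrightarrow> distr P \<mu>Z (X (f i)) = \<mu>Z"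
    using X by (auto simp: indep_haar_def)
  have mX: "X (f i) \<in> measurable P \<mu>Z" if "i \<in> I" for i
    using ind that by (auto simp: PP.indep_vars_def)
  show m: "(\<lambda>w. \<lambda>i\<in>I. X (f i) w) \<in> measurable P (haar_family I)"
    using mX by (rule measurable_restrict)
  show "distr P (haar_family I) (\<lambda>w. \<lambda>i\<in>I. X (f i) w) = haar_family I"
  proof (rule PiM_eqI[OF I(1)])
    fix A assume A: "\<And>i. i \<in> I \<Longrightarrow> A i \<in> sets \<mu>Z"
    show "emeasure (distr P (haar_family I) (\<lambda>w. \<lambda>i\<in>I. X (f i) w)) (Pi\<^sub>E I A) = (\<Prod>i\<in>I. emeasure \<mu>Z (A i))"
    proof (cases "I = {}")
      case True then show ?thesis
        using prob_space.emeasure_space_1[OF PP.prob_space_distr[OF m]] by simp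
    next
      case False
      have "emeasure (distr P (haar_family I) (\<lambda>w. \<lambda>i\<in>I. X (f i) w)) (Pi\<^sub>E I A)
          = emeasure P ((\<lambda>w. \<lambda>i\<in>I. X (f i) w) -` Pi\<^sub>E I A \<inter> space P)"
        using A I by (intro emeasure_distr m sets_PiM_I_finite) auto
      also have "(\<lambda>w. \<lambda>i\<in>I. X (f i) w) -` Pi\<^sub>E I A \<inter> space P
          = (\<Inter>j\<in>f ` I. X j -` A (inv_into I f j) \<inter> space P)"
        using False I by (auto simp: PiE_iff)
      also have "emeasure P \<dots> = (\<Prod>j\<in>f ` I. emeasure P (X j -` A (inv_into I f j) \<inter> space P))"
      proof -
        have "PP.prob (\<Inter>j\<in>f ` I. X j -` A (inv_into I f j) \<inter> space P)
            = (\<Prod>j\<in>f ` I. PP.prob (X j -` A (inv_into I f j) \<inter> space P))"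
          using False I A by (intro PP.indep_varsD[OF ind]) (auto intro: inv_into_into)
        then show ?thesis by (simp only: PP.emeasure_eq_measure prod_ennreal measure_nonneg)
      qed
      also have "\<dots> = (\<Prod>i\<in>I. emeasure P (X (f i) -` A i \<inter> space P))"
        using I by (subst prod.reindex) auto
      also have "\<dots> = (\<Prod>i\<in>I. emeasure \<mu>Z (A i))"
        using emeasure_distr[OF mX A] dX by (intro prod.cong refl) metis
      finally show ?thesis .
    qed
  qed simp
qed

lemma indep_haar_coordinates:
  assumes I: "finite I"
  shows "indep_haar p (haar_family I) (\<lambda>i w. w i) I"
proof -
  interpret Q: prob_space "haar_family I" by (rule prob_haar_family)
  have PiM_component: "distr (haar_family I) \<mu>Z (\<lambda>w. w i) = \<mu>Z" if "i \<in> I" for i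
    using that by (intro product_prob_space.PiM_component product_prob_spaceI prob_\<mu>Z)
  have "Q.indep_vars (\<lambda>_. \<mu>Z) (\<lambda>i w. w i) I"
  proof (cases "I = {}")
    case True then show ?thesis unfolding Q.indep_vars_def2 Q.indep_sets_def by simp
  next
    case False
    have "distr (haar_family I) (haar_family I) (\<lambda>w. \<lambda>i\<in>I. w i) = distr (haar_family I) (haar_family I) (\<lambda>w. w)"
      by (intro distr_cong refl) (auto simp: PiE_def extensional_def fun_eq_iff)
    also have "\<dots> = haar_family I" by (rule distr_id)
    also have "\<dots> = PiM I (\<lambda>i. distr (haar_family I) \<mu>Z (\<lambda>w. w i))"
      using PiM_component by (intro PiM_cong) auto
    finally show ?thesis
      using False by (subst Q.indep_vars_iff_distr_eq_PiM') auto
  qed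
  then show ?thesis using PiM_component by (simp add: indep_haar_def)
qed

subsection \<open>Haar measure on finitely generated modules\<close>

lemma residue_finite_image:
  assumes "\<And>v w. \<lbrakk>v \<in> carrier (V m); w \<in> carrier (V m); \<And>i. i < m \<Longrightarrow> v i k = w i k\<rbrakk> \<Longrightarrow> F v = F w"
  shows "finite (F ` carrier (V m))"
proof -
  define r where "r v = (\<lambda>i\<in>{..<m}. v i k)" for v :: "nat \<Rightarrow> zp"
  have "0 \<le> v i k \<and> v i k < int p ^ k" if "v \<in> carrier (V m)" "i < m" for v i
    using V_memb[OF that] unfolding Zp_iff by blast
  then have "r v \<in> (\<Pi>\<^sub>E i\<in>{..<m}. {0..<int p ^ k})" if "v \<in> carrier (V m)" for v
    using that by (simp add: r_def)
  then have "r ` carrier (V m) \<subseteq> (\<Pi>\<^sub>E i\<in>{..<m}. {0..<int p ^ k})" by blast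
  then have fin: "finite (r ` carrier (V m))" by (rule finite_subset) (intro finite_PiE; simp)
  define g where "g = inv_into (carrier (V m)) r"
  have "F v = F (g (r v))" if v: "v \<in> carrier (V m)" for v
  proof (rule assms[OF v])
    show "g (r v) \<in> carrier (V m)" unfolding g_def using v by (intro inv_into_into imageI)
    have "r (g (r v)) = r v" unfolding g_def by (rule f_inv_into_f[OF imageI[OF v]])
    then show "v i k = g (r v) i k" if "i < m" for i
    proof -
      have "r w i = w i k" for w using that by (simp add: r_def)
      then show ?thesis using \<open>r (g (r v)) = r v\<close> by metis
    qed
  qed
  then have "F ` carrier (V m) \<subseteq> (\<lambda>s. F (g s)) ` (r ` carrier (V m))" by blast
  then show ?thesis using fin finite_surj by blast
qed

lemma quotient_finite_index:
  assumes K: "module Z K" and \<psi>: "\<psi> \<in> module_hom Z (V m) K" "\<psi> ` carrier (V m) = carrier K"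
  shows "finite_index K"
  unfolding finite_index_def
proof
  fix k
  have "finite ((\<lambda>v. padic_ball K k (\<psi> v)) ` carrier (V m))"
  proof (rule residue_finite_image)
    fix v w assume v: "v \<in> carrier (V m)" "w \<in> carrier (V m)" "\<And>i. i < m \<Longrightarrow> v i k = w i k"
    obtain z where "z \<in> carrier (V m)" "v = w \<oplus>\<^bsub>V m\<^esub> of_N (p ^ k) \<odot>\<^bsub>V m\<^esub> z"
      using same_residue_vec[OF v] by blast
    then have "\<psi> v \<in> padic_ball K k (\<psi> w)" using v(2) module_homD[OF \<psi>(1)] by (auto simp: padic_ball_def)
    then show "padic_ball K k (\<psi> v) = padic_ball K k (\<psi> w)" by (rule ball_props(4)[OF K module_homD(1)[OF \<psi>(1) v(2)]])
  qed
  then have "finite (padic_ball K k ` \<psi> ` carrier (V m))" by (simp add: image_image)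
  then show "finite (padic_ball K k ` carrier K)" unfolding \<psi>(2) .
qed

text \<open>Translation by \<open>\<psi> b\<close> corresponds to translation by \<open>b\<close> upstairs, so the image measure is
  invariant.  In particular every finitely generated module has a Haar measure.\<close>

lemma haar_quotient:
  assumes K: "module Z K" and \<psi>: "\<psi> \<in> module_hom Z (V m) K" "\<psi> ` carrier (V m) = carrier K"
  shows "is_haar p K (haar p K)" and "\<psi> \<in> measurable (haar_family {..<m}) (haar p K)"
    and "distr (haar_family {..<m}) (haar p K) \<psi> = haar p K"
proof -
  let ?\<nu> = "haar_family {..<m}"
  interpret \<nu>: prob_space ?\<nu> by (rule prob_haar_family)
  have m: "\<psi> \<in> measurable ?\<nu> (padic_borel K)"
    unfolding padic_borel_def
  proof (rule measurable_measure_of)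
    show "{U. padic_open p K U} \<subseteq> Pow (carrier K)" by (auto simp: padic_open_def)
    show "\<psi> \<in> space ?\<nu> \<rightarrow> carrier K" using module_homD(1)[OF \<psi>(1)] by (simp add: V_simps)
    fix U assume "U \<in> {U. padic_open p K U}"
    then have U: "\<And>x. x \<in> U \<Longrightarrow> \<exists>k. padic_ball K k x \<subseteq> U" by (auto simp: padic_open_iff_ball[OF K])
    show "\<psi> -` U \<inter> space ?\<nu> \<in> sets ?\<nu>"
    proof (rule locally_constant_sets)
      fix w assume "w \<in> \<psi> -` U \<inter> space ?\<nu>"
      then have w: "w \<in> carrier (V m)" "\<psi> w \<in> U" by (auto simp: V_simps)
      then obtain k where k: "padic_ball K k (\<psi> w) \<subseteq> U" using U by blast
      have "w' \<in> \<psi> -` U \<inter> space ?\<nu>" if w': "w' \<in> carrier (V m)" "\<forall>i\<in>{..<m}. w' i k = w i k" for w'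
      proof -
        obtain z where "z \<in> carrier (V m)" "w' = w \<oplus>\<^bsub>V m\<^esub> of_N (p ^ k) \<odot>\<^bsub>V m\<^esub> z"
          using same_residue_vec[OF w'(1) w(1)] w'(2) by (metis lessThan_iff)
        then have "\<psi> w' \<in> padic_ball K k (\<psi> w)" using w module_homD[OF \<psi>(1)] by (auto simp: padic_ball_def)
        then show ?thesis using k w'(1) by (auto simp: V_simps)
      qed
      then show "\<exists>k. \<forall>w'\<in>{..<m} \<rightarrow>\<^sub>E carrier Z. (\<forall>i\<in>{..<m}. w' i k = w i k) \<longrightarrow> w' \<in> \<psi> -` U \<inter> space ?\<nu>"
        by (auto simp: V_simps)
    qed auto
  qed
  have "is_haar p K (distr ?\<nu> (padic_borel K) \<psi>)"
    unfolding is_haar_iff[OF K]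
  proof (intro conjI ballI)
    show "prob_space (distr ?\<nu> (padic_borel K) \<psi>)" using m by (rule \<nu>.prob_space_distr)
    fix a assume a: "a \<in> carrier K"
    then obtain b where b: "b \<in> carrier (V m)" "a = \<psi> b" using \<psi>(2) by blast
    let ?T = "\<lambda>w. \<lambda>i\<in>{..<m}. b i \<oplus>\<^bsub>Z\<^esub> w i"
    have T: "?T \<in> measurable ?\<nu> ?\<nu>" "distr ?\<nu> ?\<nu> ?T = ?\<nu>"
      using haar_family_translate[of "{..<m}" b] b(1) by (auto simp: V_simps)
    have "distr (distr ?\<nu> (padic_borel K) \<psi>) (padic_borel K) (\<lambda>x. a \<oplus>\<^bsub>K\<^esub> x) = distr ?\<nu> (padic_borel K) ((\<lambda>x. a \<oplus>\<^bsub>K\<^esub> x) \<circ> \<psi>)"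
      by (rule distr_distr[OF translation_measurable[OF K a] m])
    also have "\<dots> = distr ?\<nu> (padic_borel K) (\<psi> \<circ> ?T)"
    proof (rule distr_cong)
      fix w assume "w \<in> space ?\<nu>"
      then have w: "w \<in> carrier (V m)" by (simp add: V_simps)
      have "?T w = b \<oplus>\<^bsub>V m\<^esub> w" by (simp add: V_simps)
      then show "((\<lambda>x. a \<oplus>\<^bsub>K\<^esub> x) \<circ> \<psi>) w = (\<psi> \<circ> ?T) w"
        using module_homD(2)[OF \<psi>(1) b(1) w] b(2) by simp
    qed auto
    also have "\<dots> = distr (distr ?\<nu> ?\<nu> ?T) (padic_borel K) \<psi>" by (rule distr_distr[OF m T(1), symmetric])
    finally show "distr (distr ?\<nu> (padic_borel K) \<psi>) (padic_borel K) (\<lambda>x. a \<oplus>\<^bsub>K\<^esub> x) = distr ?\<nu> (padic_borel K) \<psi>" using T(2) by simp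
  qed simp
  then have h: "haar p K = distr ?\<nu> (padic_borel K) \<psi>"
    and "is_haar p K (haar p K)"
    using haar_unique[OF K quotient_finite_index[OF K \<psi>]] by auto
  then show "is_haar p K (haar p K)" by blast
  show "\<psi> \<in> measurable ?\<nu> (haar p K)" using m h by simp
  show "distr ?\<nu> (haar p K) \<psi> = haar p K" using h distr_cong[OF refl, of "haar p K" "padic_borel K" ?\<nu> \<psi> \<psi>] by simp
qed

end

section \<open>Finite $p$-groups\<close>

text \<open>A prime divisor \<open>q \<noteq> p\<close> of the order would provide a subgroup of order \<open>q\<close>, by Sylow's theorem,
  whose elements are killed by both \<open>q\<close> and a power of \<open>p\<close>.\<close>

lemma (in group) p_power_order:
  assumes fin: "finite (carrier G)" and p: "Factorial_Ring.prime p"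
    and kill: "\<And>x. x \<in> carrier G \<Longrightarrow> x [^] (p ^ k) = \<one>"
  shows "\<exists>l. order G = p ^ l"
proof -
  have ord0: "order G \<noteq> 0" using fin one_closed by (auto simp: order_def)
  obtain m where m: "order G = p ^ multiplicity p (order G) * m" "\<not> p dvd m"
    using multiplicity_decompose'[of "order G" p] ord0 p by (metis not_prime_unit)
  have "m = 1"
  proof (rule ccontr)
    assume "m \<noteq> 1"
    then obtain q where q: "Factorial_Ring.prime q" "q dvd m" by (metis prime_factor_nat)
    then have "q \<noteq> p" using m(2) by auto
    from q m(1) have "q dvd order G" by (metis dvd_mult)
    then obtain r where "order G = q ^ 1 * r" by auto
    then obtain H where H: "subgroup H G" "card H = q ^ 1"
      using sylow_thm[OF q(1) is_group _ fin] by blast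
    interpret H: subgroup H G by fact
    have "card H > 1" using H(2) q(1) prime_gt_1_nat by simp
    then have "\<not> H \<subseteq> {\<one>}" using card_mono[of "{\<one>}" H] by auto
    then obtain x where x: "x \<in> H" "x \<noteq> \<one>" by blast
    have xG: "x \<in> carrier G" using x(1) by simp
    interpret HG: group "G\<lparr>carrier := H\<rparr>" by (rule H.subgroup_is_group[OF is_group])
    have "x [^]\<^bsub>G\<lparr>carrier := H\<rparr>\<^esub> card H = \<one>"
      using HG.pow_order_eq_1[of x] x(1) by (simp add: order_def)
    then have "x [^] q = \<one>" using H(2) by (simp add: nat_pow_consistent[symmetric])
    then have "ord x dvd q" using pow_eq_id[OF xG] by simp
    moreover have "ord x dvd p ^ k" using kill[OF xG] pow_eq_id[OF xG] by simp
    moreover have "coprime q (p ^ k)" using \<open>q \<noteq> p\<close> q(1) p by (simp add: primes_coprime)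
    ultimately have "ord x = 1" by (metis coprime_common_divisor nat_dvd_1_iff_1)
    then show False using ord_eq_1[OF xG] x(2) by simp
  qed
  then show ?thesis using m(1) by auto
qed

context padic
begin

section \<open>Presentations of cokernels\<close>

lemma coker_presentation:
  assumes M: "is_matrix p m n M"
  obtains \<kappa> where "module Z (coker p m n M)" "\<kappa> \<in> module_hom Z (V m) (coker p m n M)"
    "\<kappa> ` carrier (V m) = carrier (coker p m n M)"
    "\<And>x. x \<in> carrier (V m) \<Longrightarrow> \<kappa> x = \<zero>\<^bsub>coker p m n M\<^esub> \<longleftrightarrow> x \<in> mat_vec p m n M ` carrier (V n)"
  using quot_module[OF V_module V.submodule_image[OF V_module mat_vec_hom[OF M]]] that
  unfolding coker_def by metis

lemma iso_class_coker:
  assumes M: "is_matrix p m n M" and K: "module Z K"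
    and \<psi>: "\<psi> \<in> module_hom Z (V m) K" "\<psi> ` carrier (V m) = carrier K"
    and ker: "\<And>x. x \<in> carrier (V m) \<Longrightarrow> \<psi> x = \<zero>\<^bsub>K\<^esub> \<longleftrightarrow> x \<in> mat_vec p m n M ` carrier (V n)"
  shows "iso_class p (coker p m n M) = iso_class p K"
proof -
  obtain \<kappa> where \<kappa>: "module Z (coker p m n M)" "\<kappa> \<in> module_hom Z (V m) (coker p m n M)"
    "\<kappa> ` carrier (V m) = carrier (coker p m n M)"
    "\<And>x. x \<in> carrier (V m) \<Longrightarrow> \<kappa> x = \<zero>\<^bsub>coker p m n M\<^esub> \<longleftrightarrow> x \<in> mat_vec p m n M ` carrier (V n)"
    using coker_presentation[OF M] by metis
  obtain f where "f \<in> module_iso Z (coker p m n M) K"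
    using same_kernel_module_iso[OF V_module \<kappa>(1) K \<kappa>(2,3) \<psi>] \<kappa>(4) ker by metis
  then show ?thesis by (rule iso_class_eqI[OF \<kappa>(1) K])
qed

lemma rep_presentation:
  assumes M: "is_matrix p m n M"
  obtains \<psi> where "module Z (rep (iso_class p (coker p m n M)))"
    "\<psi> \<in> module_hom Z (V m) (rep (iso_class p (coker p m n M)))"
    "\<psi> ` carrier (V m) = carrier (rep (iso_class p (coker p m n M)))"
    "\<And>x. x \<in> carrier (V m) \<Longrightarrow>
      \<psi> x = \<zero>\<^bsub>rep (iso_class p (coker p m n M))\<^esub> \<longleftrightarrow> x \<in> mat_vec p m n M ` carrier (V n)"
proof -
  let ?K = "rep (iso_class p (coker p m n M))"
  obtain \<kappa> where \<kappa>: "module Z (coker p m n M)" "\<kappa> \<in> module_hom Z (V m) (coker p m n M)"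
    "\<kappa> ` carrier (V m) = carrier (coker p m n M)"
    "\<And>x. x \<in> carrier (V m) \<Longrightarrow> \<kappa> x = \<zero>\<^bsub>coker p m n M\<^esub> \<longleftrightarrow> x \<in> mat_vec p m n M ` carrier (V n)"
    using coker_presentation[OF M] by metis
  obtain f where f: "module Z ?K" "f \<in> module_iso Z ?K (coker p m n M)"
    using rep_iso_class[OF \<kappa>(1)] by metis
  obtain g where g: "g \<in> module_iso Z (coker p m n M) ?K"
    using module_iso_inverse[OF f(1) \<kappa>(1) f(2)] by metis
  show ?thesis
  proof (rule that[of "\<lambda>x. g (\<kappa> x)"])
    show "(\<lambda>x. g (\<kappa> x)) \<in> module_hom Z (V m) ?K"
      by (rule module_hom_comp[OF \<kappa>(2) module_isoD(1)[OF g]])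
    show "(\<lambda>x. g (\<kappa> x)) ` carrier (V m) = carrier ?K"
      using \<kappa>(3) module_isoD(2)[OF g] by (metis image_image)
    show "g (\<kappa> x) = \<zero>\<^bsub>?K\<^esub> \<longleftrightarrow> x \<in> mat_vec p m n M ` carrier (V n)" if "x \<in> carrier (V m)" for x
      using module_iso_kernel[OF \<kappa>(1) f(1) g module_homD(1)[OF \<kappa>(2) that]] \<kappa>(4)[OF that] by simp
  qed (rule f(1))
qed

lemma X0_iff:
  fixes K :: zp_module
  assumes K: "module Z K"
  shows "iso_class p K \<in> X0 p \<longleftrightarrow> finite (carrier K) \<and> (\<exists>k. card (carrier K) = p ^ k)"
proof
  assume "iso_class p K \<in> X0 p"
  then obtain G :: zp_module where G: "iso_class p K = iso_class p G" "finite (carrier G)" "\<exists>k. card (carrier G) = p ^ k"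
    by (auto simp: X0_def)
  obtain f where "f \<in> module_iso Z K G" using iso_class_eqD[OF K G(1)] by metis
  then have "bij_betw f (carrier K) (carrier G)" by (rule module_isoD)
  then show "finite (carrier K) \<and> (\<exists>k. card (carrier K) = p ^ k)"
    using G(2,3) bij_betw_finite bij_betw_same_card by metis
qed (use K in \<open>auto simp: X0_def\<close>)

lemma killed_by_order:
  assumes K: "module Z K" and card: "finite (carrier K)" "card (carrier K) = p ^ k" and x: "x \<in> carrier K"
  shows "of_N (p ^ k) \<odot>\<^bsub>K\<^esub> x = \<zero>\<^bsub>K\<^esub>"
proof -
  interpret K: Module.module Z K by fact
  have "x [^]\<^bsub>add_monoid K\<^esub> order (add_monoid K) = \<one>\<^bsub>add_monoid K\<^esub>"
    using K.M.a_group x by (intro group.pow_order_eq_1) auto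
  then have "add_pow K (p ^ k) x = \<zero>\<^bsub>K\<^esub>" using card by (simp add: order_def add_pow_def)
  then show ?thesis using add_pow_eq_smult[OF K x] by simp
qed

lemma p_power_torsion_card:
  assumes K: "module Z K" and fin: "finite (carrier K)"
    and kill: "\<And>x. x \<in> carrier K \<Longrightarrow> of_N (p ^ k) \<odot>\<^bsub>K\<^esub> x = \<zero>\<^bsub>K\<^esub>"
  shows "\<exists>l. card (carrier K) = p ^ l"
proof -
  interpret K: Module.module Z K by fact
  have "\<exists>l. order (add_monoid K) = p ^ l"
    using fin add_pow_eq_smult[OF K, of _ "p ^ k"] kill
    by (intro group.p_power_order[OF K.M.a_group _ prime]) (auto simp: add_pow_def)
  then show ?thesis by (simp add: order_def)
qed

lemma lincomb_submodule:
  assumes K: "module Z K" and N: "submodule N Z K" and x: "\<And>j. j < n \<Longrightarrow> x j \<in> N"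
    and v: "v \<in> {..<n} \<rightarrow> carrier Z"
  shows "lincomb n K x v \<in> N"
proof -
  interpret K: Module.module Z K by fact
  note NE = K.submoduleE[OF N]
  show ?thesis using x v
  proof (induction n)
    case 0 then show ?case using NE(2) by (simp add: lincomb_def) (use NE(3,5) NE(1) K.M.r_neg in \<open>metis ex_in_conv subsetD\<close>)
  next
    case (Suc n)
    have "lincomb (Suc n) K x v = lincomb n K x v \<oplus>\<^bsub>K\<^esub> v n \<odot>\<^bsub>K\<^esub> x n"
      using Suc.prems NE(1) by (intro lincomb_Suc K) auto
    moreover have "lincomb n K x v \<in> N" using Suc.prems by (intro Suc.IH) auto
    moreover have "v n \<odot>\<^bsub>K\<^esub> x n \<in> N" using Suc.prems by (intro NE(4)) auto
    ultimately show ?case using NE(5) by simp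
  qed
qed

lemma finitely_generated_iff:
  assumes K: "module Z K"
  shows "finitely_generated Z K \<longleftrightarrow> (\<exists>m \<psi>. \<psi> \<in> module_hom Z (V m) K \<and> \<psi> ` carrier (V m) = carrier K)"
proof
  interpret K: Module.module Z K by fact
  assume "finitely_generated Z K"
  then obtain S where S: "finite S" "S \<subseteq> carrier K" "span Z K S = carrier K" by (auto simp: finitely_generated_def)
  obtain x where x: "bij_betw x {0..<card S} S" using ex_bij_betw_nat_finite[OF S(1)] by blast
  let ?m = "card S" and ?\<psi> = "lincomb (card S) K x"
  have xK: "x j \<in> carrier K" if "j < ?m" for j using x S(2) that by (auto simp: bij_betw_def)
  then have \<psi>: "?\<psi> \<in> module_hom Z (V ?m) K" by (intro lincomb_hom K) auto
  have Sim: "S \<subseteq> ?\<psi> ` carrier (V ?m)"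
  proof
    fix s assume "s \<in> S"
    then have "s \<in> x ` {0..<card S}" using x by (simp add: bij_betw_def)
    then obtain j where j: "j < ?m" "s = x j" by auto
    have "?\<psi> (unit_vec ?m j) = (\<Oplus>\<^bsub>K\<^esub>i\<in>{..<?m}. if j = i then x i else \<zero>\<^bsub>K\<^esub>)"
      unfolding lincomb_def using xK
      by (intro K.M.finsum_cong') (auto simp: unit_vec_nth)
    also have "\<dots> = x j" using j xK by (intro K.M.finsum_singleton) auto
    finally show "s \<in> ?\<psi> ` carrier (V ?m)" using j(2) unit_vec_closed[of ?m j] by (metis image_eqI)
  qed
  have "carrier K \<subseteq> ?\<psi> ` carrier (V ?m)"
    using K.span_minimal[OF K.submodule_image[OF V_module \<psi>] Sim] unfolding S(3) .
  then have "?\<psi> ` carrier (V ?m) = carrier K" using module_homD(1)[OF \<psi>] by blast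
  then show "\<exists>m \<psi>. \<psi> \<in> module_hom Z (V m) K \<and> \<psi> ` carrier (V m) = carrier K" using \<psi> by blast
next
  interpret K: Module.module Z K by fact
  assume "\<exists>m \<psi>. \<psi> \<in> module_hom Z (V m) K \<and> \<psi> ` carrier (V m) = carrier K"
  then obtain m \<psi> where \<psi>: "\<psi> \<in> module_hom Z (V m) K" "\<psi> ` carrier (V m) = carrier K" by blast
  let ?S = "(\<lambda>j. \<psi> (unit_vec m j)) ` {..<m}"
  have S: "?S \<subseteq> carrier K" using module_homD(1)[OF \<psi>(1) unit_vec_closed] by blast
  have "y \<in> N" if y: "y \<in> carrier K" and N: "submodule N Z K" "?S \<subseteq> N" for y N
  proof -
    obtain v where v: "v \<in> carrier (V m)" "y = \<psi> v" using y unfolding \<psi>(2)[symmetric] by blast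
    have "lincomb m K (\<lambda>j. \<psi> (unit_vec m j)) v \<in> N"
      using N(2) V_Pi[OF v(1)] by (intro lincomb_submodule[OF K N(1)]) auto
    then show ?thesis using hom_eq_lincomb[OF \<psi>(1) K v(1)] v(2) by simp
  qed
  then have "carrier K \<subseteq> span Z K ?S" by (auto simp: span_def)
  moreover have "span Z K ?S \<subseteq> carrier K" by (rule K.span_minimal[OF K.carrier_is_submodule S])
  ultimately show "finitely_generated Z K"
    unfolding finitely_generated_def using S by (intro exI[of _ ?S]) auto
qed

section \<open>Rank one\<close>

lemma finsum_two:
  assumes K: "module Z K" and S: "finite S" "S \<subseteq> carrier K" "s \<in> S" "t \<in> S" "s \<noteq> t"
    and ab: "a \<in> carrier Z" "b \<in> carrier Z"
  shows "(\<Oplus>\<^bsub>K\<^esub>u\<in>S. (if u = s then a else if u = t then b else \<zero>\<^bsub>Z\<^esub>) \<odot>\<^bsub>K\<^esub> u)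
    = a \<odot>\<^bsub>K\<^esub> s \<oplus>\<^bsub>K\<^esub> b \<odot>\<^bsub>K\<^esub> t"
proof -
  interpret K: Module.module Z K by fact
  have st: "s \<in> carrier K" "t \<in> carrier K" using S by auto
  have "(\<Oplus>\<^bsub>K\<^esub>u\<in>S. (if u = s then a else if u = t then b else \<zero>\<^bsub>Z\<^esub>) \<odot>\<^bsub>K\<^esub> u)
    = (\<Oplus>\<^bsub>K\<^esub>u\<in>S. (if s = u then a \<odot>\<^bsub>K\<^esub> s else \<zero>\<^bsub>K\<^esub>) \<oplus>\<^bsub>K\<^esub> (if t = u then b \<odot>\<^bsub>K\<^esub> t else \<zero>\<^bsub>K\<^esub>))"
    using S st ab by (intro K.M.finsum_cong') auto
  also have "\<dots> = (\<Oplus>\<^bsub>K\<^esub>u\<in>S. if s = u then a \<odot>\<^bsub>K\<^esub> s else \<zero>\<^bsub>K\<^esub>) \<oplus>\<^bsub>K\<^esub> (\<Oplus>\<^bsub>K\<^esub>u\<in>S. if t = u then b \<odot>\<^bsub>K\<^esub> t else \<zero>\<^bsub>K\<^esub>)"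
    using st ab by (intro K.M.finsum_addf) auto
  also have "\<dots> = a \<odot>\<^bsub>K\<^esub> s \<oplus>\<^bsub>K\<^esub> b \<odot>\<^bsub>K\<^esub> t"
    using S st ab K.M.finsum_singleton[of s S "\<lambda>_. a \<odot>\<^bsub>K\<^esub> s"] K.M.finsum_singleton[of t S "\<lambda>_. b \<odot>\<^bsub>K\<^esub> t"] by simp
  finally show ?thesis .
qed

lemma lin_indep_singleton:
  assumes K: "module Z K" and h: "h \<in> carrier K"
  shows "lin_indep Z K {h} \<longleftrightarrow> (\<forall>a\<in>carrier Z. a \<odot>\<^bsub>K\<^esub> h = \<zero>\<^bsub>K\<^esub> \<longrightarrow> a = \<zero>\<^bsub>Z\<^esub>)"
proof -
  interpret K: Module.module Z K by fact
  have eq: "(\<Oplus>\<^bsub>K\<^esub>s\<in>{h}. a s \<odot>\<^bsub>K\<^esub> s) = a h \<odot>\<^bsub>K\<^esub> h" if "a h \<in> carrier Z" for a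
    using that h by simp
  show ?thesis
  proof
    assume L: "lin_indep Z K {h}"
    show "\<forall>a\<in>carrier Z. a \<odot>\<^bsub>K\<^esub> h = \<zero>\<^bsub>K\<^esub> \<longrightarrow> a = \<zero>\<^bsub>Z\<^esub>"
    proof (intro ballI impI)
      fix a assume a: "a \<in> carrier Z" "a \<odot>\<^bsub>K\<^esub> h = \<zero>\<^bsub>K\<^esub>"
      show "a = \<zero>\<^bsub>Z\<^esub>" using L a eq[of "\<lambda>_. a"] unfolding lin_indep_def by (auto dest!: bspec[of _ _ "\<lambda>_. a"])
    qed
  next
    assume "\<forall>a\<in>carrier Z. a \<odot>\<^bsub>K\<^esub> h = \<zero>\<^bsub>K\<^esub> \<longrightarrow> a = \<zero>\<^bsub>Z\<^esub>"
    then show "lin_indep Z K {h}" unfolding lin_indep_def using h eq by (auto simp: Pi_iff)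
  qed
qed

text \<open>Two elements \<open>s\<close> and \<open>t\<close> satisfy \<open>p\<^sup>k s = i a\<close> and \<open>p\<^sup>k t = i b\<close>, which gives a linear relation
  between them.\<close>

lemma rank_one_if_finite_over_Zp:
  assumes H: "module Z H" and i: "i \<in> module_hom Z (regular_module Z) H" "inj_on i (carrier Z)"
    and fin: "\<And>x. x \<in> carrier H \<Longrightarrow> of_N (p ^ k) \<odot>\<^bsub>H\<^esub> x \<in> i ` carrier Z"
  shows "has_rank Z H 1"
  unfolding has_rank_def
proof (intro conjI allI impI)
  interpret H: Module.module Z H by fact
  interpret D: domain Z by (rule Zp_domain)
  note ih = module_homD[OF i(1), simplified]
  have i0: "a = \<zero>\<^bsub>Z\<^esub>" if "a \<in> carrier Z" "i a = \<zero>\<^bsub>H\<^esub>" for a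
    using that inj_onD[OF i(2), of a "\<zero>\<^bsub>Z\<^esub>"] module_hom_zero[OF regular_module H i(1)] by simp
  have pk: "of_N (p ^ k) \<noteq> \<zero>\<^bsub>Z\<^esub>" using prime_gt_0_nat[OF prime] by (intro of_N_nonzero) simp
  have h1: "i \<one>\<^bsub>Z\<^esub> \<in> carrier H" using ih(1) by simp
  have "a = \<zero>\<^bsub>Z\<^esub>" if a: "a \<in> carrier Z" "a \<odot>\<^bsub>H\<^esub> i \<one>\<^bsub>Z\<^esub> = \<zero>\<^bsub>H\<^esub>" for a
    using i0[OF a(1)] ih(3)[OF a(1), of "\<one>\<^bsub>Z\<^esub>"] a by simp
  then have "lin_indep Z H {i \<one>\<^bsub>Z\<^esub>}" using lin_indep_singleton[OF H h1] by blast
  then show "\<exists>S. finite S \<and> lin_indep Z H S \<and> card S = 1" by (intro exI[of _ "{i \<one>\<^bsub>Z\<^esub>}"]) simp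
  fix S assume S: "finite S \<and> lin_indep Z H S"
  show "card S \<le> 1"
  proof (rule ccontr)
    assume "\<not> card S \<le> 1"
    then obtain s t where st: "s \<in> S" "t \<in> S" "s \<noteq> t"
      using S card_le_Suc0_iff_eq[of S] by auto
    have SH: "S \<subseteq> carrier H" using S by (simp add: lin_indep_def)
    then have stH: "s \<in> carrier H" "t \<in> carrier H" using st by auto
    have indep: "a = \<zero>\<^bsub>Z\<^esub> \<and> b = \<zero>\<^bsub>Z\<^esub>"
      if ab: "a \<in> carrier Z" "b \<in> carrier Z" "a \<odot>\<^bsub>H\<^esub> s \<oplus>\<^bsub>H\<^esub> b \<odot>\<^bsub>H\<^esub> t = \<zero>\<^bsub>H\<^esub>" for a b
    proof -
      let ?c = "\<lambda>u. if u = s then a else if u = t then b else \<zero>\<^bsub>Z\<^esub>"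
      have all: "\<forall>c\<in>S \<rightarrow> carrier Z. (\<Oplus>\<^bsub>H\<^esub>u\<in>S. c u \<odot>\<^bsub>H\<^esub> u) = \<zero>\<^bsub>H\<^esub> \<longrightarrow> (\<forall>u\<in>S. c u = \<zero>\<^bsub>Z\<^esub>)"
        using S unfolding lin_indep_def by blast
      have c: "?c \<in> S \<rightarrow> carrier Z" using ab by auto
      have "(\<Oplus>\<^bsub>H\<^esub>u\<in>S. ?c u \<odot>\<^bsub>H\<^esub> u) = \<zero>\<^bsub>H\<^esub> \<longrightarrow> (\<forall>u\<in>S. ?c u = \<zero>\<^bsub>Z\<^esub>)"
        by (rule bspec[OF all c])
      moreover have "(\<Oplus>\<^bsub>H\<^esub>u\<in>S. ?c u \<odot>\<^bsub>H\<^esub> u) = \<zero>\<^bsub>H\<^esub>"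
        using finsum_two[OF H _ SH st ab(1,2)] S ab(3) by simp
      ultimately have "\<forall>u\<in>S. ?c u = \<zero>\<^bsub>Z\<^esub>" by (rule mp)
      then have "?c s = \<zero>\<^bsub>Z\<^esub>" "?c t = \<zero>\<^bsub>Z\<^esub>" using st by blast+
      then show ?thesis using st(3) by auto
    qed
    obtain a b where ab: "a \<in> carrier Z" "of_N (p ^ k) \<odot>\<^bsub>H\<^esub> s = i a"
      "b \<in> carrier Z" "of_N (p ^ k) \<odot>\<^bsub>H\<^esub> t = i b" using fin stH by blast
    \<comment> \<open>The relation \<open>b (p\<^sup>k s) - a (p\<^sup>k t) = 0\<close> between multiples of \<open>i 1\<close>.\<close>
    have "(b \<otimes>\<^bsub>Z\<^esub> of_N (p ^ k)) \<odot>\<^bsub>H\<^esub> s \<oplus>\<^bsub>H\<^esub> (\<ominus>\<^bsub>Z\<^esub> a \<otimes>\<^bsub>Z\<^esub> of_N (p ^ k)) \<odot>\<^bsub>H\<^esub> t = i (b \<otimes>\<^bsub>Z\<^esub> a) \<oplus>\<^bsub>H\<^esub> i (\<ominus>\<^bsub>Z\<^esub> a \<otimes>\<^bsub>Z\<^esub> b)"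
      using ab stH ih(3)[of b a] ih(3)[of "\<ominus>\<^bsub>Z\<^esub> a" b] by (simp add: H.smult_assoc1)
    also have "\<dots> = i (b \<otimes>\<^bsub>Z\<^esub> a \<oplus>\<^bsub>Z\<^esub> \<ominus>\<^bsub>Z\<^esub> a \<otimes>\<^bsub>Z\<^esub> b)"
      using ab ih(2) by simp
    also have "b \<otimes>\<^bsub>Z\<^esub> a \<oplus>\<^bsub>Z\<^esub> \<ominus>\<^bsub>Z\<^esub> a \<otimes>\<^bsub>Z\<^esub> b = \<zero>\<^bsub>Z\<^esub>" using ab by (simp add: Z.l_minus Z.m_comm[of b a] Z.r_neg)
    also have "i \<zero>\<^bsub>Z\<^esub> = \<zero>\<^bsub>H\<^esub>" using module_hom_zero[OF regular_module H i(1)] by simp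
    finally have "b \<otimes>\<^bsub>Z\<^esub> of_N (p ^ k) = \<zero>\<^bsub>Z\<^esub> \<and> \<ominus>\<^bsub>Z\<^esub> a \<otimes>\<^bsub>Z\<^esub> of_N (p ^ k) = \<zero>\<^bsub>Z\<^esub>"
      using ab by (intro indep) auto
    then have "b = \<zero>\<^bsub>Z\<^esub>" using pk ab D.integral[of b "of_N (p ^ k)"] by auto
    then have "of_N (p ^ k) \<odot>\<^bsub>H\<^esub> t = \<zero>\<^bsub>H\<^esub>"
      using ab(4) module_hom_zero[OF regular_module H i(1)] by simp
    then have "\<zero>\<^bsub>Z\<^esub> = \<zero>\<^bsub>Z\<^esub> \<and> of_N (p ^ k) = \<zero>\<^bsub>Z\<^esub>" using stH by (intro indep) auto
    then show False using pk by simp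
  qed
qed

end

context padic
begin

lemma V_restrict [simp]: "v \<in> carrier (V n) \<Longrightarrow> restrict v {..<n} = v"
  by (simp add: V_simps)

section \<open>Extensions by the $p$-adic integers\<close>

lemma extensionD:
  assumes "(H, i, q) \<in> extensions p G"
  shows "module Z H" "i \<in> module_hom Z (regular_module Z) H" "q \<in> module_hom Z H G"
    "inj_on i (carrier Z)" "q ` carrier H = carrier G"
    "\<And>x. x \<in> carrier H \<Longrightarrow> q x = \<zero>\<^bsub>G\<^esub> \<longleftrightarrow> x \<in> i ` carrier Z"
    "\<And>a. a \<in> carrier Z \<Longrightarrow> i a \<in> carrier H" "\<And>a. a \<in> carrier Z \<Longrightarrow> q (i a) = \<zero>\<^bsub>G\<^esub>"
proof -
  have e: "module Z H \<and> i \<in> module_hom Z (regular_module Z) H \<and> q \<in> module_hom Z H G \<and>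
     inj_on i (carrier Z) \<and> q ` carrier H = carrier G \<and> i ` carrier Z = {x \<in> carrier H. q x = \<zero>\<^bsub>G\<^esub>}"
    using assms by (simp add: extensions_def)
  then show "module Z H" "i \<in> module_hom Z (regular_module Z) H" "q \<in> module_hom Z H G"
    "inj_on i (carrier Z)" "q ` carrier H = carrier G" by blast+
  have im: "i ` carrier Z = {x \<in> carrier H. q x = \<zero>\<^bsub>G\<^esub>}" using e by blast
  show "q x = \<zero>\<^bsub>G\<^esub> \<longleftrightarrow> x \<in> i ` carrier Z" if "x \<in> carrier H" for x unfolding im using that by blast
  show "i a \<in> carrier H" "q (i a) = \<zero>\<^bsub>G\<^esub>" if "a \<in> carrier Z" for a using im that by blast+
qed

text \<open>A set-theoretic section \<open>s\<close> of \<open>q\<close> identifies \<open>H\<close> with \<open>\<int>\<^sub>p \<times> G\<close> through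
  \<open>(a, y) \<mapsto> i a + s y\<close>.\<close>

lemma extension_of_exact_sequence:
  fixes H :: "(zp, 'h) module" and G :: "(zp, 'g) module"
  assumes H: "module Z H" and G: "module Z G"
    and i: "i \<in> module_hom Z (regular_module Z) H" "inj_on i (carrier Z)"
    and q: "q \<in> module_hom Z H G" "q ` carrier H = carrier G"
    and exact: "\<And>x. x \<in> carrier H \<Longrightarrow> q x = \<zero>\<^bsub>G\<^esub> \<longleftrightarrow> x \<in> i ` carrier Z"
  obtains H' i' q' b where "(H', i', q') \<in> extensions p G" "b \<in> module_iso Z H H'"
    "\<And>a. a \<in> carrier Z \<Longrightarrow> b (i a) = i' a" "\<And>x. x \<in> carrier H \<Longrightarrow> q' (b x) = q x"
proof -
  interpret H: Module.module Z H by fact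
  interpret G: Module.module Z G by fact
  have iH: "i a \<in> carrier H" if "a \<in> carrier Z" for a using module_homD(1)[OF i(1)] that by simp
  define s where "s y = inv_into (carrier H) q y" for y
  have s: "s y \<in> carrier H" "q (s y) = y" if "y \<in> carrier G" for y
    using that q(2) by (simp_all add: s_def inv_into_into f_inv_into_f)
  let ?Y = "carrier Z \<times> carrier G"
  define c where "c = (\<lambda>(a, y). i a \<oplus>\<^bsub>H\<^esub> s y)"
  have qi: "q (i a) = \<zero>\<^bsub>G\<^esub>" if "a \<in> carrier Z" for a using exact[OF iH[OF that]] that by blast
  have qc: "q (c (a, y)) = y" if "a \<in> carrier Z" "y \<in> carrier G" for a y
    using that by (simp add: c_def module_homD(2)[OF q(1)] iH s qi)
  have "bij_betw c ?Y (carrier H)"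
    unfolding bij_betw_def
  proof (intro conjI inj_onI equalityI subsetI)
    fix u v assume "u \<in> ?Y" "v \<in> ?Y" and eq: "c u = c v"
    then obtain a y a' y' where u: "u = (a, y)" "v = (a', y')" "a \<in> carrier Z" "y \<in> carrier G"
      "a' \<in> carrier Z" "y' \<in> carrier G" by blast
    have "y = y'" using qc[OF u(3,4)] qc[OF u(5,6)] eq u(1,2) by simp
    moreover then have "i a = i a'"
      using eq u iH s by (simp add: c_def)
    then have "a = a'" using i(2) u(3,5) by (auto dest: inj_onD)
    ultimately show "u = v" using u(1,2) by simp
  next
    fix x assume "x \<in> c ` ?Y" then show "x \<in> carrier H" using iH s by (auto simp: c_def)
  next
    fix x assume x: "x \<in> carrier H"
    let ?y = "q x"
    have y: "?y \<in> carrier G" using module_homD(1)[OF q(1) x] .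
    have "q (x \<ominus>\<^bsub>H\<^esub> s ?y) = \<zero>\<^bsub>G\<^esub>"
      using x y s[OF y] by (simp add: module_hom_diff[OF H G q(1)] G.diff_eq_zero_iff)
    then obtain a where a: "a \<in> carrier Z" "x \<ominus>\<^bsub>H\<^esub> s ?y = i a"
      using exact[of "x \<ominus>\<^bsub>H\<^esub> s ?y"] x s[OF y] by auto
    have "x = (x \<ominus>\<^bsub>H\<^esub> s ?y) \<oplus>\<^bsub>H\<^esub> s ?y"
      using x s[OF y] by (simp add: a_minus_def H.M.a_assoc H.M.l_neg)
    then have "x = c (a, ?y)" using a(2) by (simp add: c_def)
    then show "x \<in> c ` ?Y" using a(1) y by blast
  qed
  then have bij: "bij_betw (inv_into ?Y c) (carrier H) ?Y" by (rule bij_betw_inv_into)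
  obtain H' :: "(zp, zp \<times> 'g) module" where H': "module Z H'" "carrier H' = ?Y" "inv_into ?Y c \<in> module_iso Z H H'"
    using module_transport[OF H bij] by metis
  define b where "b = inv_into ?Y c"
  have b: "b \<in> module_iso Z H H'" using H'(3) by (simp add: b_def)
  obtain d where d: "d \<in> module_iso Z H' H" "\<And>x. x \<in> carrier H \<Longrightarrow> d (b x) = x"
    using module_iso_inverse[OF H H'(1) b] by metis
  define i' q' where "i' a = b (i a)" and "q' x = q (d x)" for a x
  have q'b: "q' (b x) = q x" if "x \<in> carrier H" for x using d(2)[OF that] by (simp add: q'_def)
  have bH: "b ` carrier H = carrier H'" by (rule module_isoD(2)[OF b])
  have "(H', i', q') \<in> extensions p G"
  proof -
    have 1: "i' \<in> module_hom Z (regular_module Z) H'"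
      using module_hom_comp[OF i(1) module_isoD(1)[OF b]] by (simp add: i'_def[abs_def])
    have 2: "q' \<in> module_hom Z H' G"
      using module_hom_comp[OF module_isoD(1)[OF d(1)] q(1)] by (simp add: q'_def[abs_def])
    have 3: "inj_on i' (carrier Z)"
    proof (rule inj_onI)
      fix x y assume xy: "x \<in> carrier Z" "y \<in> carrier Z" "i' x = i' y"
      then have "i x = i y" using inj_onD[OF module_isoD(3)[OF b]] iH by (simp add: i'_def)
      then show "x = y" using inj_onD[OF i(2)] xy by simp
    qed
    have 4: "q' ` carrier H' = carrier G"
      unfolding bH[symmetric] image_image using q'b q(2) by simp
    have 5: "i' ` carrier Z = {x \<in> carrier H'. q' x = \<zero>\<^bsub>G\<^esub>}"
    proof (intro equalityI subsetI)
      fix x assume "x \<in> i' ` carrier Z"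
      then obtain a where "a \<in> carrier Z" "x = b (i a)" by (auto simp: i'_def)
      then show "x \<in> {x \<in> carrier H'. q' x = \<zero>\<^bsub>G\<^esub>}"
        using q'b[OF iH] qi bH iH by auto
    next
      fix x assume "x \<in> {x \<in> carrier H'. q' x = \<zero>\<^bsub>G\<^esub>}"
      then obtain z where z: "z \<in> carrier H" "x = b z" "q' x = \<zero>\<^bsub>G\<^esub>" using bH by blast
      then have "z \<in> i ` carrier Z" using exact q'b by simp
      then show "x \<in> i' ` carrier Z" using z(2) by (auto simp: i'_def)
    qed
    show ?thesis unfolding extensions_def using H'(1) 1 2 3 4 5 by blast
  qed
  with b q'b that show ?thesis by (metis i'_def)
qed

end

locale finite_presentation = padic +
  fixes n :: nat and M :: "nat \<times> nat \<Rightarrow> zp" and G :: "(zp, 'g) module"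
    and \<psi> :: "(nat \<Rightarrow> zp) \<Rightarrow> 'g" and k :: nat
  assumes M: "is_matrix p n n M" and G: "module (Zp p) G"
    and \<psi>: "\<psi> \<in> module_hom (Zp p) (Zp_power p n) G" "\<psi> ` carrier (Zp_power p n) = carrier G"
    and \<psi>_kernel: "\<And>x. x \<in> carrier (Zp_power p n) \<Longrightarrow>
      \<psi> x = \<zero>\<^bsub>G\<^esub> \<longleftrightarrow> x \<in> mat_vec p n n M ` carrier (Zp_power p n)"
    and kill: "\<And>x. x \<in> carrier G \<Longrightarrow> of_N (p ^ k) \<odot>\<^bsub>G\<^esub> x = \<zero>\<^bsub>G\<^esub>"
begin

abbreviation A :: "(nat \<Rightarrow> zp) \<Rightarrow> nat \<Rightarrow> zp" where "A \<equiv> mat_vec p n n M"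

lemma A_hom: "A \<in> module_hom Z (V n) (V n)"
  by (rule mat_vec_hom[OF M])

lemma A_closed: "u \<in> carrier (V n) \<Longrightarrow> A u \<in> carrier (V n)"
  by (rule module_homD(1)[OF A_hom])

lemma \<psi>_A: "u \<in> carrier (V n) \<Longrightarrow> \<psi> (A u) = \<zero>\<^bsub>G\<^esub>"
  using \<psi>_kernel[OF A_closed] by blast

lemma quasi_inverse:
  obtains W where "W \<in> module_hom Z (V n) (V n)"
    "\<And>v. v \<in> carrier (V n) \<Longrightarrow> A (W v) = of_N (p ^ k) \<odot>\<^bsub>V n\<^esub> v"
    "\<And>v. v \<in> carrier (V n) \<Longrightarrow> W (A v) = of_N (p ^ k) \<odot>\<^bsub>V n\<^esub> v"
    "\<And>v. v \<in> carrier (V n) \<Longrightarrow> A v = \<zero>\<^bsub>V n\<^esub> \<Longrightarrow> v = \<zero>\<^bsub>V n\<^esub>"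
proof -
  have im: "of_N (p ^ k) \<odot>\<^bsub>V n\<^esub> v \<in> A ` carrier (V n)" if v: "v \<in> carrier (V n)" for v
    using \<psi>_kernel[of "of_N (p ^ k) \<odot>\<^bsub>V n\<^esub> v"] v module_homD(3)[OF \<psi>(1) of_N_closed v]
      kill[OF module_homD(1)[OF \<psi>(1) v]] by simp
  obtain W where W: "W \<in> module_hom Z (V n) (V n)"
    "\<And>v. v \<in> carrier (V n) \<Longrightarrow> A (W v) = of_N (p ^ k) \<odot>\<^bsub>V n\<^esub> v"
    "\<And>v. v \<in> carrier (V n) \<Longrightarrow> A v = \<zero>\<^bsub>V n\<^esub> \<Longrightarrow> v = \<zero>\<^bsub>V n\<^esub>"
    by (rule finite_cokernel_injective[OF A_hom im]) (assumption, rule that)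
  have "W (A v) = of_N (p ^ k) \<odot>\<^bsub>V n\<^esub> v" if v: "v \<in> carrier (V n)" for v
  proof -
    let ?x = "W (A v)" and ?y = "of_N (p ^ k) \<odot>\<^bsub>V n\<^esub> v"
    have xy: "?x \<in> carrier (V n)" "?y \<in> carrier (V n)"
      using module_homD(1)[OF W(1) A_closed[OF v]] v by auto
    have "A ?x = A ?y" using W(2)[OF A_closed[OF v]] module_homD(3)[OF A_hom of_N_closed v] by simp
    then have "A (?x \<ominus>\<^bsub>V n\<^esub> ?y) = \<zero>\<^bsub>V n\<^esub>" using module_hom_fibre[OF V_module V_module A_hom xy] by simp
    then have "?x \<ominus>\<^bsub>V n\<^esub> ?y = \<zero>\<^bsub>V n\<^esub>" using W(3) xy V.M.minus_closed by blast
    then show ?thesis using V.M.diff_eq_zero_iff[OF xy] by simp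
  qed
  with W that show ?thesis by blast
qed

text \<open>The extension arises from \<open>M\<close> by adjoining the row \<open>r\<close>: some lift \<open>g\<close> of \<open>\<psi>\<close> to the middle
  term satisfies \<open>g M = - r\<close>.\<close>

definition matches :: "'g extension \<Rightarrow> (nat \<Rightarrow> zp) \<Rightarrow> bool" where
  "matches E r \<longleftrightarrow> (case E of (H, i, q) \<Rightarrow> \<exists>g\<in>module_hom Z (V n) H.
     (\<forall>v\<in>carrier (V n). q (g v) = \<psi> v) \<and> (\<forall>u\<in>carrier (V n). g (A u) = \<ominus>\<^bsub>H\<^esub> i (dot n r u)))"

text \<open>A linear map that becomes zero in \<open>G\<close> factors through \<open>\<int>\<^sub>p\<close>, hence is given by a row.\<close>

lemma lift_of_zero:
  assumes E: "(H, i, q) \<in> extensions p G" and f: "f \<in> module_hom Z (V n) H"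
    and z: "\<And>v. v \<in> carrier (V n) \<Longrightarrow> q (f v) = \<zero>\<^bsub>G\<^esub>"
  obtains w where "w \<in> carrier (V n)" "\<And>v. v \<in> carrier (V n) \<Longrightarrow> f v = i (dot n w v)"
proof -
  note e = extensionD[OF E]
  obtain g where g: "g \<in> module_hom Z (V n) (regular_module Z)" "\<And>v. v \<in> carrier (V n) \<Longrightarrow> i (g v) = f v"
    using free_lift[OF regular_module e(1) e(2) f] e(6) z module_homD(1)[OF f]
    by (metis regular_simps(1))
  obtain w where "w \<in> carrier (V n)" "\<And>v. v \<in> carrier (V n) \<Longrightarrow> g v = dot n w v"
    using functional_eq_dot[OF g(1)] by metis
  with g(2) that show ?thesis by metis
qed

lemma matches_exists:
  assumes E: "E \<in> extensions p G"
  obtains r where "r \<in> carrier (V n)" "matches E r"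
proof -
  obtain H i q where Eq: "E = (H, i, q)" by (cases E) auto
  note E' = E[unfolded Eq]
  note e = extensionD[OF E']
  interpret H: Module.module Z H by (rule e(1))
  obtain g where g: "g \<in> module_hom Z (V n) H" "\<And>v. v \<in> carrier (V n) \<Longrightarrow> q (g v) = \<psi> v"
    using free_lift[OF e(1) G e(3) \<psi>(1)] e(5) module_homD(1)[OF \<psi>(1)] by metis
  have gA: "(\<lambda>u. g (A u)) \<in> module_hom Z (V n) H" by (rule module_hom_comp[OF A_hom g(1)])
  note f = module_hom_uminus[OF e(1) gA]
  have "q (\<ominus>\<^bsub>H\<^esub> g (A u)) = \<zero>\<^bsub>G\<^esub>" if u: "u \<in> carrier (V n)" for u
  proof -
    interpret G: Module.module Z G by (rule G)
    show ?thesis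
      using module_hom_neg[OF e(1) G e(3) module_homD(1)[OF gA u]] g(2)[OF A_closed[OF u]] \<psi>_A[OF u] by simp
  qed
  then obtain r where r: "r \<in> carrier (V n)" "\<And>u. u \<in> carrier (V n) \<Longrightarrow> \<ominus>\<^bsub>H\<^esub> g (A u) = i (dot n r u)"
    using lift_of_zero[OF E' f] by metis
  have "g (A u) = \<ominus>\<^bsub>H\<^esub> i (dot n r u)" if "u \<in> carrier (V n)" for u
    using r(2)[OF that] module_homD(1)[OF gA that] by (metis H.M.minus_minus)
  then have "matches E r" unfolding matches_def Eq using g by auto
  with r(1) that show ?thesis by blast
qed

lemma dot_closed_vec: "r \<in> carrier (V n) \<Longrightarrow> u \<in> carrier (V n) \<Longrightarrow> dot n r u \<in> carrier Z"
  using V_Pi by (intro dot_closed) auto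

text \<open>Two lifts of \<open>\<psi>\<close> differ by a map to the kernel \<open>\<int>\<^sub>p\<close>, which is a row \<open>w\<close>.\<close>

lemma matches_diff:
  assumes E: "E \<in> extensions p G" and r: "r \<in> carrier (V n)" "matches E r" "r' \<in> carrier (V n)" "matches E r'"
  obtains w where "w \<in> carrier (V n)"
    "\<And>u. u \<in> carrier (V n) \<Longrightarrow> dot n r' u = dot n r u \<oplus>\<^bsub>Z\<^esub> dot n w (A u)"
proof -
  obtain H i q where Eq: "E = (H, i, q)" by (cases E) auto
  note E' = E[unfolded Eq]
  note e = extensionD[OF E']
  interpret H: Module.module Z H by (rule e(1))
  interpret G: Module.module Z G by (rule G)
  obtain g where g: "g \<in> module_hom Z (V n) H" "\<And>v. v \<in> carrier (V n) \<Longrightarrow> q (g v) = \<psi> v"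
    "\<And>u. u \<in> carrier (V n) \<Longrightarrow> g (A u) = \<ominus>\<^bsub>H\<^esub> i (dot n r u)"
    using r(2) unfolding matches_def Eq by auto
  obtain g' where g': "g' \<in> module_hom Z (V n) H" "\<And>v. v \<in> carrier (V n) \<Longrightarrow> q (g' v) = \<psi> v"
    "\<And>u. u \<in> carrier (V n) \<Longrightarrow> g' (A u) = \<ominus>\<^bsub>H\<^esub> i (dot n r' u)"
    using r(4) unfolding matches_def Eq by auto
  have f: "(\<lambda>v. g v \<ominus>\<^bsub>H\<^esub> g' v) \<in> module_hom Z (V n) H" by (rule module_hom_minus[OF e(1) g(1) g'(1)])
  have "q (g v \<ominus>\<^bsub>H\<^esub> g' v) = \<zero>\<^bsub>G\<^esub>" if "v \<in> carrier (V n)" for v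
    using that g(2) g'(2) module_homD(1)[OF g(1)] module_homD(1)[OF g'(1)] module_homD(1)[OF \<psi>(1)]
    by (simp add: module_hom_diff[OF e(1) G e(3)] G.diff_eq_zero_iff)
  then obtain w where w: "w \<in> carrier (V n)" "\<And>v. v \<in> carrier (V n) \<Longrightarrow> g v \<ominus>\<^bsub>H\<^esub> g' v = i (dot n w v)"
    using lift_of_zero[OF E' f] by metis
  have "dot n r' u = dot n r u \<oplus>\<^bsub>Z\<^esub> dot n w (A u)" if u: "u \<in> carrier (V n)" for u
  proof (rule inj_onD[OF e(4)])
    have c: "dot n r u \<in> carrier Z" "dot n r' u \<in> carrier Z" "dot n w (A u) \<in> carrier Z"
      using dot_closed_vec r(1,3) w(1) u A_closed[OF u] by auto
    have "i (dot n w (A u)) = \<ominus>\<^bsub>H\<^esub> i (dot n r u) \<oplus>\<^bsub>H\<^esub> i (dot n r' u)"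
      using w(2)[OF A_closed[OF u]] g(3)[OF u] g'(3)[OF u] e(7)[OF c(2)] by (simp add: a_minus_def)
    then have "i (dot n r u) \<oplus>\<^bsub>H\<^esub> i (dot n w (A u)) = i (dot n r' u)"
      using e(7) c by (simp add: H.M.a_assoc[symmetric] H.M.r_neg)
    then show "i (dot n r' u) = i (dot n r u \<oplus>\<^bsub>Z\<^esub> dot n w (A u))"
      using module_homD(2)[OF e(2)] c by simp
  qed (use dot_closed_vec r w u A_closed in auto)
  with w(1) that show ?thesis by blast
qed

text \<open>Conversely, any row \<open>w\<close> can be subtracted from a lift.\<close>

lemma matches_shift:
  assumes E: "E \<in> extensions p G" and r: "r \<in> carrier (V n)" "matches E r" and w: "w \<in> carrier (V n)"
    and r': "\<And>u. u \<in> carrier (V n) \<Longrightarrow> dot n r' u = dot n r u \<oplus>\<^bsub>Z\<^esub> dot n w (A u)"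
  shows "matches E r'"
proof -
  obtain H i q where Eq: "E = (H, i, q)" by (cases E) auto
  note E' = E[unfolded Eq]
  note e = extensionD[OF E']
  interpret H: Module.module Z H by (rule e(1))
  interpret G: Module.module Z G by (rule G)
  obtain g where g: "g \<in> module_hom Z (V n) H" "\<And>v. v \<in> carrier (V n) \<Longrightarrow> q (g v) = \<psi> v"
    "\<And>u. u \<in> carrier (V n) \<Longrightarrow> g (A u) = \<ominus>\<^bsub>H\<^esub> i (dot n r u)"
    using r(2) unfolding matches_def Eq by auto
  let ?g = "\<lambda>v. g v \<ominus>\<^bsub>H\<^esub> i (dot n w v)"
  have "(\<lambda>v. i (dot n w v)) \<in> module_hom Z (V n) H"
    by (rule module_hom_comp[OF dot_hom[OF V_Pi[OF w]] e(2)])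
  then have "?g \<in> module_hom Z (V n) H" by (rule module_hom_minus[OF e(1) g(1)])
  moreover have "q (?g v) = \<psi> v" if v: "v \<in> carrier (V n)" for v
  proof -
    have "q (?g v) = q (g v) \<ominus>\<^bsub>G\<^esub> q (i (dot n w v))"
      using module_homD(1)[OF g(1) v] e(7)[OF dot_closed_vec[OF w v]] by (rule module_hom_diff[OF e(1) G e(3)])
    then show ?thesis using g(2)[OF v] e(8)[OF dot_closed_vec[OF w v]] module_homD(1)[OF \<psi>(1) v] by (simp add: a_minus_def)
  qed
  moreover have "?g (A u) = \<ominus>\<^bsub>H\<^esub> i (dot n r' u)" if u: "u \<in> carrier (V n)" for u
  proof -
    have c: "dot n r u \<in> carrier Z" "dot n w (A u) \<in> carrier Z" using dot_closed_vec r(1) w u A_closed[OF u] by auto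
    then show ?thesis
      using g(3)[OF u] r'[OF u] module_homD(2)[OF e(2)] e(7) by (simp add: a_minus_def H.M.minus_add)
  qed
  ultimately show ?thesis unfolding matches_def Eq prod.case by (intro bexI[of _ ?g]) auto
qed

text \<open>The image of the matrix that results from \<open>M\<close> by adjoining the row \<open>r\<close>.\<close>

definition bordered_image :: "(nat \<Rightarrow> zp) \<Rightarrow> (nat \<Rightarrow> zp) set" where
  "bordered_image r = (\<lambda>u. (A u)(n := dot n r u)) ` carrier (V n)"

lemma bordered_hom:
  assumes r: "r \<in> carrier (V n)"
  shows "(\<lambda>u. (A u)(n := dot n r u)) \<in> module_hom Z (V n) (V (Suc n))"
proof -
  note d = module_homD[OF dot_hom[OF V_Pi[OF r]], simplified]
  show ?thesis
  proof (rule module_homI)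
    show "(A u)(n := dot n r u) \<in> carrier (V (Suc n))" if "u \<in> carrier (V n)" for u
      using that A_closed dot_closed_vec[OF r] by simp
    show "(A (u \<oplus>\<^bsub>V n\<^esub> v))(n := dot n r (u \<oplus>\<^bsub>V n\<^esub> v))
        = (A u)(n := dot n r u) \<oplus>\<^bsub>V (Suc n)\<^esub> (A v)(n := dot n r v)"
      if "u \<in> carrier (V n)" "v \<in> carrier (V n)" for u v
    proof (rule V_eqI[of _ "Suc n"])
      show "(A (u \<oplus>\<^bsub>V n\<^esub> v))(n := dot n r (u \<oplus>\<^bsub>V n\<^esub> v)) \<in> carrier (V (Suc n))"
        using that A_closed[of "u \<oplus>\<^bsub>V n\<^esub> v"] dot_closed_vec[OF r, of "u \<oplus>\<^bsub>V n\<^esub> v"] by simp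
      show "(A u)(n := dot n r u) \<oplus>\<^bsub>V (Suc n)\<^esub> (A v)(n := dot n r v) \<in> carrier (V (Suc n))"
        using that A_closed dot_closed_vec[OF r] by simp
      show "((A (u \<oplus>\<^bsub>V n\<^esub> v))(n := dot n r (u \<oplus>\<^bsub>V n\<^esub> v))) j
        = ((A u)(n := dot n r u) \<oplus>\<^bsub>V (Suc n)\<^esub> (A v)(n := dot n r v)) j" if "j < Suc n" for j
        using that \<open>u \<in> _\<close> \<open>v \<in> _\<close> module_homD(2)[OF A_hom] d(2) by (auto simp: less_Suc_eq)
    qed
    show "(A (a \<odot>\<^bsub>V n\<^esub> u))(n := dot n r (a \<odot>\<^bsub>V n\<^esub> u)) = a \<odot>\<^bsub>V (Suc n)\<^esub> (A u)(n := dot n r u)"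
      if "a \<in> carrier Z" "u \<in> carrier (V n)" for a u
    proof (rule V_eqI[of _ "Suc n"])
      show "(A (a \<odot>\<^bsub>V n\<^esub> u))(n := dot n r (a \<odot>\<^bsub>V n\<^esub> u)) \<in> carrier (V (Suc n))"
        using that A_closed[of "a \<odot>\<^bsub>V n\<^esub> u"] dot_closed_vec[OF r, of "a \<odot>\<^bsub>V n\<^esub> u"] by simp
      show "a \<odot>\<^bsub>V (Suc n)\<^esub> (A u)(n := dot n r u) \<in> carrier (V (Suc n))"
        using that A_closed dot_closed_vec[OF r] by simp
      show "((A (a \<odot>\<^bsub>V n\<^esub> u))(n := dot n r (a \<odot>\<^bsub>V n\<^esub> u))) j = (a \<odot>\<^bsub>V (Suc n)\<^esub> (A u)(n := dot n r u)) j"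
        if "j < Suc n" for j
        using that \<open>u \<in> _\<close> \<open>a \<in> _\<close> module_homD(3)[OF A_hom] d(3) by (auto simp: less_Suc_eq)
    qed
  qed
qed

text \<open>The sign in the definition of \<open>matches\<close> is chosen such that \<open>(v, a) \<mapsto> g v + i a\<close> kills
  exactly the vectors \<open>(A u, dot r u)\<close>.\<close>

lemma matches_presentation:
  assumes E: "(H, i, q) \<in> extensions p G" and r: "r \<in> carrier (V n)" "matches (H, i, q) r"
  obtains \<Psi> where "\<Psi> \<in> module_hom Z (V (Suc n)) H" "\<Psi> ` carrier (V (Suc n)) = carrier H"
    "\<And>x. x \<in> carrier (V (Suc n)) \<Longrightarrow> \<Psi> x = \<zero>\<^bsub>H\<^esub> \<longleftrightarrow> x \<in> bordered_image r"
    "\<And>a. a \<in> carrier Z \<Longrightarrow> \<Psi> (\<zero>\<^bsub>V n\<^esub>(n := a)) = i a"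
    "\<And>x. x \<in> carrier (V (Suc n)) \<Longrightarrow> q (\<Psi> x) = \<psi> (restrict x {..<n})"
proof -
  note e = extensionD[OF E]
  interpret H: Module.module Z H by (rule e(1))
  interpret G: Module.module Z G by (rule G)
  obtain g where g: "g \<in> module_hom Z (V n) H" "\<And>v. v \<in> carrier (V n) \<Longrightarrow> q (g v) = \<psi> v"
    "\<And>u. u \<in> carrier (V n) \<Longrightarrow> g (A u) = \<ominus>\<^bsub>H\<^esub> i (dot n r u)"
    using r(2) unfolding matches_def by auto
  let ?P = "\<lambda>x. g (restrict x {..<n}) \<oplus>\<^bsub>H\<^esub> i (x n)"
  have P: "?P \<in> module_hom Z (V (Suc n)) H"
    by (rule module_hom_add[OF e(1) module_hom_comp[OF front_hom g(1)] module_hom_comp[OF last_hom e(2)]])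
  have gc: "g v \<in> carrier H" if "v \<in> carrier (V n)" for v using module_homD(1)[OF g(1) that] .
  have snoc: "?P (v(n := a)) = g v \<oplus>\<^bsub>H\<^esub> i a" if "v \<in> carrier (V n)" for v a using that by simp
  have qP: "q (?P x) = \<psi> (restrict x {..<n})" if x: "x \<in> carrier (V (Suc n))" for x
  proof -
    have f: "restrict x {..<n} \<in> carrier (V n)" "x n \<in> carrier Z" using front_closed[OF x] V_memb[OF x] by auto
    show ?thesis using module_homD(2)[OF e(3) gc[OF f(1)] e(7)[OF f(2)]] g(2)[OF f(1)] e(8)[OF f(2)]
        module_homD(1)[OF \<psi>(1) f(1)] by simp
  qed
  show ?thesis
  proof (rule that[OF P])
    show "?P ` carrier (V (Suc n)) = carrier H"
    proof (intro equalityI subsetI)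
      fix y assume "y \<in> ?P ` carrier (V (Suc n))" then show "y \<in> carrier H" using module_homD(1)[OF P] by blast
    next
      fix y assume y: "y \<in> carrier H"
      have "q y \<in> \<psi> ` carrier (V n)" using module_homD(1)[OF e(3) y] \<psi>(2) by simp
      then obtain v where v: "v \<in> carrier (V n)" "\<psi> v = q y" by force
      have "q (y \<ominus>\<^bsub>H\<^esub> g v) = \<zero>\<^bsub>G\<^esub>"
        using module_hom_diff[OF e(1) G e(3) y gc[OF v(1)]] g(2)[OF v(1)] v(2) module_homD(1)[OF e(3) y]
        by (simp add: G.diff_eq_zero_iff)
      then obtain a where a: "a \<in> carrier Z" "y \<ominus>\<^bsub>H\<^esub> g v = i a"
        using e(6)[of "y \<ominus>\<^bsub>H\<^esub> g v"] y gc[OF v(1)] by auto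
      have "y = g v \<oplus>\<^bsub>H\<^esub> (y \<ominus>\<^bsub>H\<^esub> g v)"
        using y gc[OF v(1)] by (simp add: a_minus_def H.M.a_lcomm[of "g v" y] H.M.r_neg)
      then have "y = ?P (v(n := a))" using snoc[OF v(1)] a(2) by simp
      then show "y \<in> ?P ` carrier (V (Suc n))" using snoc_closed[OF v(1) a(1)] by blast
    qed
    show "?P x = \<zero>\<^bsub>H\<^esub> \<longleftrightarrow> x \<in> bordered_image r" if x: "x \<in> carrier (V (Suc n))" for x
    proof
      assume z: "?P x = \<zero>\<^bsub>H\<^esub>"
      have f: "restrict x {..<n} \<in> carrier (V n)" "x n \<in> carrier Z" using front_closed[OF x] V_memb[OF x] by auto
      have "\<psi> (restrict x {..<n}) = \<zero>\<^bsub>G\<^esub>" using qP[OF x] z module_hom_zero[OF e(1) G e(3)] by simp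
      then obtain u where u: "u \<in> carrier (V n)" "restrict x {..<n} = A u" using \<psi>_kernel[OF f(1)] by blast
      have d: "dot n r u \<in> carrier Z" using dot_closed_vec r(1) u(1) by blast
      have "\<ominus>\<^bsub>H\<^esub> i (dot n r u) \<oplus>\<^bsub>H\<^esub> i (x n) = \<zero>\<^bsub>H\<^esub>" using z u g(3) by simp
      moreover have "i (x n) = i (dot n r u) \<oplus>\<^bsub>H\<^esub> (\<ominus>\<^bsub>H\<^esub> i (dot n r u) \<oplus>\<^bsub>H\<^esub> i (x n))"
        using e(7)[OF d] e(7)[OF f(2)] by (simp add: H.M.a_assoc[symmetric] H.M.r_neg)
      ultimately have "i (x n) = i (dot n r u)" using e(7)[OF d] by simp
      then have "x n = dot n r u" using inj_onD[OF e(4)] f(2) d by blast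
      then have "x = (A u)(n := dot n r u)" using snoc_front[OF x] u(2) by simp
      then show "x \<in> bordered_image r" using u(1) by (simp add: bordered_image_def)
    next
      assume "x \<in> bordered_image r"
      then obtain u where u: "u \<in> carrier (V n)" "x = (A u)(n := dot n r u)" by (auto simp: bordered_image_def)
      then show "?P x = \<zero>\<^bsub>H\<^esub>"
        using snoc[OF A_closed[OF u(1)]] g(3)[OF u(1)] e(7)[OF dot_closed_vec[OF r(1) u(1)]] by (simp add: H.M.l_neg)
    qed
    show "?P (\<zero>\<^bsub>V n\<^esub>(n := a)) = i a" if "a \<in> carrier Z" for a
      using snoc[of "\<zero>\<^bsub>V n\<^esub>" a] module_hom_zero[OF V_module e(1) g(1)] e(7)[OF that] by simp
  qed (rule qP)
qed

lemma matches_same: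
  assumes E: "E \<in> extensions p G" and E': "E' \<in> extensions p G" and r: "r \<in> carrier (V n)" "matches E r" "matches E' r"
  shows "(E, E') \<in> ext_rel p G"
proof -
  obtain H i q H' i' q' where Eq: "E = (H, i, q)" "E' = (H', i', q')" by (cases E, cases E') auto
  note e = extensionD[OF E[unfolded Eq]] and e' = extensionD[OF E'[unfolded Eq]]
  obtain P where P: "P \<in> module_hom Z (V (Suc n)) H" "P ` carrier (V (Suc n)) = carrier H"
    "\<And>x. x \<in> carrier (V (Suc n)) \<Longrightarrow> P x = \<zero>\<^bsub>H\<^esub> \<longleftrightarrow> x \<in> bordered_image r"
    "\<And>a. a \<in> carrier Z \<Longrightarrow> P (\<zero>\<^bsub>V n\<^esub>(n := a)) = i a"
    "\<And>x. x \<in> carrier (V (Suc n)) \<Longrightarrow> q (P x) = \<psi> (restrict x {..<n})"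
    using matches_presentation[OF E[unfolded Eq] r(1) r(2)[unfolded Eq]] by metis
  obtain P' where P': "P' \<in> module_hom Z (V (Suc n)) H'" "P' ` carrier (V (Suc n)) = carrier H'"
    "\<And>x. x \<in> carrier (V (Suc n)) \<Longrightarrow> P' x = \<zero>\<^bsub>H'\<^esub> \<longleftrightarrow> x \<in> bordered_image r"
    "\<And>a. a \<in> carrier Z \<Longrightarrow> P' (\<zero>\<^bsub>V n\<^esub>(n := a)) = i' a"
    "\<And>x. x \<in> carrier (V (Suc n)) \<Longrightarrow> q' (P' x) = \<psi> (restrict x {..<n})"
    using matches_presentation[OF E'[unfolded Eq] r(1) r(3)[unfolded Eq]] by metis
  have same: "P x = \<zero>\<^bsub>H\<^esub> \<longleftrightarrow> P' x = \<zero>\<^bsub>H'\<^esub>" if "x \<in> carrier (V (Suc n))" for x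
    using P(3)[OF that] P'(3)[OF that] by simp
  obtain f where f: "f \<in> module_iso Z H H'" "\<And>x. x \<in> carrier (V (Suc n)) \<Longrightarrow> f (P x) = P' x"
    using same_kernel_module_iso[OF V_module e(1) e'(1) P(1,2) P'(1,2) same] by blast
  have "f (i a) = i' a" if a: "a \<in> carrier Z" for a
    using P(4)[OF a] P'(4)[OF a] f(2)[OF snoc_closed[OF V.M.zero_closed a]] by simp
  moreover have "q' (f y) = q y" if "y \<in> carrier H" for y
  proof -
    have "y \<in> P ` carrier (V (Suc n))" using that P(2) by simp
    then obtain x where "x \<in> carrier (V (Suc n))" "y = P x" by blast
    then show ?thesis using P(5) P'(5) f(2) by simp
  qed
  ultimately show ?thesis using E E' f(1) unfolding ext_rel_def Eq by blast
qed

lemma matches_ext_rel: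
  assumes rel: "(E, E') \<in> ext_rel p G" and r: "matches E r" "r \<in> carrier (V n)"
  shows "matches E' r"
proof -
  obtain H i q H' i' q' f where Eq: "E = (H, i, q)" "E' = (H', i', q')" and
    E: "(H, i, q) \<in> extensions p G" and E': "(H', i', q') \<in> extensions p G" and f: "f \<in> module_iso Z H H'"
    "\<forall>x\<in>carrier Z. f (i x) = i' x" "\<forall>y\<in>carrier H. q' (f y) = q y"
    using rel by (auto simp: ext_rel_def)
  note e = extensionD[OF E] and e' = extensionD[OF E']
  obtain g where g: "g \<in> module_hom Z (V n) H" "\<And>v. v \<in> carrier (V n) \<Longrightarrow> q (g v) = \<psi> v"
    "\<And>u. u \<in> carrier (V n) \<Longrightarrow> g (A u) = \<ominus>\<^bsub>H\<^esub> i (dot n r u)"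
    using r(1) unfolding matches_def Eq by auto
  have "(\<lambda>v. f (g v)) \<in> module_hom Z (V n) H'" by (rule module_hom_comp[OF g(1) module_isoD(1)[OF f(1)]])
  moreover have "q' (f (g v)) = \<psi> v" if "v \<in> carrier (V n)" for v
    using g(2)[OF that] f(3) module_homD(1)[OF g(1) that] by simp
  moreover have "f (g (A u)) = \<ominus>\<^bsub>H'\<^esub> i' (dot n r u)" if u: "u \<in> carrier (V n)" for u
  proof -
    have d: "dot n r u \<in> carrier Z" using dot_closed_vec r(2) u by blast
    show ?thesis using module_hom_neg[OF e(1) e'(1) module_isoD(1)[OF f(1)] e(7)[OF d]] g(3)[OF u] f(2) d by simp
  qed
  ultimately show ?thesis unfolding matches_def Eq prod.case by (intro bexI[of _ "\<lambda>v. f (g v)"]) auto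
qed

text \<open>The extension is the cokernel of \<open>M\<close> with the row \<open>r\<close> adjoined.  Injectivity of
  \<open>\<int>\<^sub>p \<rightarrow> H\<close> rests on the injectivity of \<open>A\<close>.\<close>

lemma extension_exists:
  assumes r: "r \<in> carrier (V n)"
  obtains E where "E \<in> extensions p G" "matches E r"
proof -
  obtain W where W: "\<And>v. v \<in> carrier (V n) \<Longrightarrow> A v = \<zero>\<^bsub>V n\<^esub> \<Longrightarrow> v = \<zero>\<^bsub>V n\<^esub>" using quasi_inverse by metis
  have sub: "submodule (bordered_image r) Z (V (Suc n))"
    unfolding bordered_image_def by (rule V.submodule_image[OF V_module bordered_hom[OF r]])
  define H where "H = quot_module (V (Suc n)) (bordered_image r)"
  obtain \<kappa> where \<kappa>: "module Z H" "\<kappa> \<in> module_hom Z (V (Suc n)) H" "\<kappa> ` carrier (V (Suc n)) = carrier H"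
    "\<And>x. x \<in> carrier (V (Suc n)) \<Longrightarrow> \<kappa> x = \<zero>\<^bsub>H\<^esub> \<longleftrightarrow> x \<in> bordered_image r"
    using quot_module[OF V_module sub] that unfolding H_def by metis
  interpret H: Module.module Z H by (rule \<kappa>(1))
  let ?i = "\<lambda>a. \<kappa> (\<zero>\<^bsub>V n\<^esub>(n := a))"
  have i: "?i \<in> module_hom Z (regular_module Z) H" by (rule module_hom_comp[OF inj_last_hom \<kappa>(2)])
  have i_inj: "inj_on ?i (carrier Z)"
  proof -
    have z: "a = \<zero>\<^bsub>Z\<^esub>" if a: "a \<in> carrier Z" "?i a = \<zero>\<^bsub>H\<^esub>" for a
    proof -
      have "\<zero>\<^bsub>V n\<^esub>(n := a) \<in> bordered_image r" using \<kappa>(4)[of "\<zero>\<^bsub>V n\<^esub>(n := a)"] a by simp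
      then obtain u where u: "u \<in> carrier (V n)" "\<zero>\<^bsub>V n\<^esub>(n := a) = (A u)(n := dot n r u)"
        by (auto simp: bordered_image_def)
      have "\<zero>\<^bsub>V n\<^esub> = A u" using arg_cong[OF u(2), of "\<lambda>x. restrict x {..<n}"] A_closed[OF u(1)] by simp
      then have "u = \<zero>\<^bsub>V n\<^esub>" using W[OF u(1)] by simp
      moreover have "a = dot n r u" using fun_cong[OF u(2), of n] by simp
      ultimately show ?thesis
        using module_hom_zero[OF V_module regular_module dot_hom[OF V_Pi[OF r]]] by simp
    qed
    show ?thesis
    proof (rule inj_onI)
      fix a b assume ab: "a \<in> carrier Z" "b \<in> carrier Z" "?i a = ?i b"
      interpret R: Module.module Z "regular_module Z" by (rule regular_module)
      have "?i (a \<ominus>\<^bsub>regular_module Z\<^esub> b) = \<zero>\<^bsub>H\<^esub>"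
        using module_hom_fibre[OF regular_module \<kappa>(1) i, of a b] ab by simp
      then have "a \<ominus>\<^bsub>regular_module Z\<^esub> b = \<zero>\<^bsub>regular_module Z\<^esub>"
        using z[of "a \<ominus>\<^bsub>regular_module Z\<^esub> b"] R.M.minus_closed[of a b] ab by simp
      then show "a = b" using R.M.diff_eq_zero_iff[of a b] ab by simp
    qed
  qed
  obtain q where q: "q \<in> module_hom Z H G" "\<And>x. x \<in> carrier (V (Suc n)) \<Longrightarrow> q (\<kappa> x) = \<psi> (restrict x {..<n})"
  proof (rule module_hom_factor[OF V_module \<kappa>(1) G \<kappa>(2,3) module_hom_comp[OF front_hom \<psi>(1)]])
    fix x assume "x \<in> carrier (V (Suc n))" "\<kappa> x = \<zero>\<^bsub>H\<^esub>"
    then obtain u where u: "u \<in> carrier (V n)" "x = (A u)(n := dot n r u)"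
      using \<kappa>(4) by (auto simp: bordered_image_def)
    then show "\<psi> (restrict x {..<n}) = \<zero>\<^bsub>G\<^esub>" using \<psi>_A A_closed by simp
  qed (use that in blast)
  have q_surj: "q ` carrier H = carrier G"
  proof (intro equalityI subsetI)
    fix y assume "y \<in> q ` carrier H" then show "y \<in> carrier G" using module_homD(1)[OF q(1)] by blast
  next
    fix y assume "y \<in> carrier G"
    then have "y \<in> \<psi> ` carrier (V n)" using \<psi>(2) by simp
    then obtain v where v: "v \<in> carrier (V n)" "y = \<psi> v" by blast
    let ?x = "v(n := \<zero>\<^bsub>Z\<^esub>)"
    have x: "?x \<in> carrier (V (Suc n))" using v by simp
    have "q (\<kappa> ?x) = y" using q(2)[OF x] v by simp
    then show "y \<in> q ` carrier H" using module_homD(1)[OF \<kappa>(2) x] by blast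
  qed
  have exact: "q y = \<zero>\<^bsub>G\<^esub> \<longleftrightarrow> y \<in> ?i ` carrier Z" if "y \<in> carrier H" for y
  proof -
    have "y \<in> \<kappa> ` carrier (V (Suc n))" using that \<kappa>(3) by simp
    then obtain x where x: "x \<in> carrier (V (Suc n))" "y = \<kappa> x" by blast
    have f: "restrict x {..<n} \<in> carrier (V n)" "x n \<in> carrier Z" using front_closed[OF x(1)] V_memb[OF x(1)] by auto
    show ?thesis
    proof
      assume "q y = \<zero>\<^bsub>G\<^esub>"
      then have "\<psi> (restrict x {..<n}) = \<zero>\<^bsub>G\<^esub>" using q(2) x by simp
      then obtain u where u: "u \<in> carrier (V n)" "restrict x {..<n} = A u" using \<psi>_kernel[OF f(1)] by blast
      let ?b = "(A u)(n := dot n r u)" and ?a = "x n \<ominus>\<^bsub>Z\<^esub> dot n r u"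
      have d: "dot n r u \<in> carrier Z" using dot_closed_vec[OF r u(1)] .
      have a: "?a \<in> carrier Z" using f(2) d Z.minus_closed by blast
      have b: "?b \<in> carrier (V (Suc n))" using A_closed[OF u(1)] d by simp
      have l: "\<zero>\<^bsub>V n\<^esub>(n := ?a) \<in> carrier (V (Suc n))" using a by simp
      have "x = ?b \<oplus>\<^bsub>V (Suc n)\<^esub> \<zero>\<^bsub>V n\<^esub>(n := ?a)"
      proof (rule V_eqI[OF x(1) V.M.a_closed[OF b l]])
        fix j assume j: "j < Suc n"
        show "x j = (?b \<oplus>\<^bsub>V (Suc n)\<^esub> \<zero>\<^bsub>V n\<^esub>(n := ?a)) j"
        proof (cases "j = n")
          case True
          have "dot n r u \<oplus>\<^bsub>Z\<^esub> ?a = x n"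
            using f(2) d by (simp add: a_minus_def Z.a_lcomm[of "dot n r u" "x n"] Z.r_neg)
          then show ?thesis using True by simp
        next
          case False
          then have jn: "j < n" using j by simp
          have "x j = A u j" using fun_cong[OF u(2), of j] jn by simp
          then show ?thesis using jn V_memb[OF A_closed[OF u(1)] jn] by simp
        qed
      qed
      then have "\<kappa> x = \<kappa> ?b \<oplus>\<^bsub>H\<^esub> ?i ?a" using module_homD(2)[OF \<kappa>(2) b l] by simp
      also have "\<kappa> ?b = \<zero>\<^bsub>H\<^esub>" using \<kappa>(4)[OF b] u(1) by (auto simp: bordered_image_def)
      finally have "\<kappa> x = ?i ?a" unfolding H.M.l_zero[OF module_homD(1)[OF \<kappa>(2) l]] .
      then have "y = ?i ?a" unfolding x(2) .
      then show "y \<in> ?i ` carrier Z" using a by blast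
    next
      assume "y \<in> ?i ` carrier Z"
      then obtain a where a: "a \<in> carrier Z" "y = ?i a" by blast
      then show "q y = \<zero>\<^bsub>G\<^esub>"
        using q(2)[OF snoc_closed[OF V.M.zero_closed a(1)]] module_hom_zero[OF V_module G \<psi>(1)] by simp
    qed
  qed
  obtain H' i' q' b where E: "(H', i', q') \<in> extensions p G" and b: "b \<in> module_iso Z H H'"
    "\<And>a. a \<in> carrier Z \<Longrightarrow> b (?i a) = i' a" "\<And>x. x \<in> carrier H \<Longrightarrow> q' (b x) = q x"
    using extension_of_exact_sequence[OF \<kappa>(1) G i i_inj q(1) q_surj exact] by blast
  note e = extensionD[OF E]
  interpret H': Module.module Z H' by (rule e(1))
  have b\<kappa>: "(\<lambda>x. b (\<kappa> x)) \<in> module_hom Z (V (Suc n)) H'" by (rule module_hom_comp[OF \<kappa>(2) module_isoD(1)[OF b(1)]])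
  let ?g = "\<lambda>v. b (\<kappa> (v(n := \<zero>\<^bsub>Z\<^esub>)))"
  have ext0: "(\<lambda>v. v(n := \<zero>\<^bsub>Z\<^esub>)) \<in> module_hom Z (V n) (V (Suc n))"
  proof (rule module_homI)
    show "(v \<oplus>\<^bsub>V n\<^esub> w)(n := \<zero>\<^bsub>Z\<^esub>) = v(n := \<zero>\<^bsub>Z\<^esub>) \<oplus>\<^bsub>V (Suc n)\<^esub> w(n := \<zero>\<^bsub>Z\<^esub>)"
      if "v \<in> carrier (V n)" "w \<in> carrier (V n)" for v w
      using that by (intro V_eqI[of _ "Suc n"]) (auto simp: less_Suc_eq)
    show "(a \<odot>\<^bsub>V n\<^esub> v)(n := \<zero>\<^bsub>Z\<^esub>) = a \<odot>\<^bsub>V (Suc n)\<^esub> v(n := \<zero>\<^bsub>Z\<^esub>)"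
      if "a \<in> carrier Z" "v \<in> carrier (V n)" for a v
      using that by (intro V_eqI[of _ "Suc n"]) (auto simp: less_Suc_eq)
  qed simp
  have "?g \<in> module_hom Z (V n) H'" by (rule module_hom_comp[OF ext0 b\<kappa>])
  moreover have "q' (?g v) = \<psi> v" if v: "v \<in> carrier (V n)" for v
  proof -
    have x: "v(n := \<zero>\<^bsub>Z\<^esub>) \<in> carrier (V (Suc n))" using v by simp
    show ?thesis using b(3)[OF module_homD(1)[OF \<kappa>(2) x]] q(2)[OF x] v by simp
  qed
  moreover have "?g (A u) = \<ominus>\<^bsub>H'\<^esub> i' (dot n r u)" if u: "u \<in> carrier (V n)" for u
  proof -
    have d: "dot n r u \<in> carrier Z" using dot_closed_vec[OF r u] .
    let ?x = "(A u)(n := \<zero>\<^bsub>Z\<^esub>)" and ?y = "\<zero>\<^bsub>V n\<^esub>(n := dot n r u)"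
    have xy: "?x \<in> carrier (V (Suc n))" "?y \<in> carrier (V (Suc n))" using A_closed[OF u] d by auto
    have s: "?x \<oplus>\<^bsub>V (Suc n)\<^esub> ?y = (A u)(n := dot n r u)"
      using A_closed[OF u] d V_memb[OF A_closed[OF u]] by (intro V_eqI[of _ "Suc n"]) (auto simp: less_Suc_eq)
    have "\<kappa> (?x \<oplus>\<^bsub>V (Suc n)\<^esub> ?y) = \<zero>\<^bsub>H\<^esub>"
      unfolding s using \<kappa>(4)[of "(A u)(n := dot n r u)"] A_closed[OF u] d u by (auto simp: bordered_image_def)
    then have "b (\<kappa> ?x) \<oplus>\<^bsub>H'\<^esub> b (\<kappa> ?y) = \<zero>\<^bsub>H'\<^esub>"
      using module_homD(2)[OF b\<kappa> xy] module_hom_zero[OF \<kappa>(1) e(1) module_isoD(1)[OF b(1)]] by simp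
    then have "b (\<kappa> ?x) \<oplus>\<^bsub>H'\<^esub> i' (dot n r u) = \<zero>\<^bsub>H'\<^esub>" using b(2)[OF d] by simp
    then have "\<ominus>\<^bsub>H'\<^esub> i' (dot n r u) = b (\<kappa> ?x)"
      by (rule H'.M.minus_equality[OF _ e(7)[OF d] module_homD(1)[OF b\<kappa> xy(1)]])
    then show ?thesis by simp
  qed
  ultimately have "matches (H', i', q') r" unfolding matches_def prod.case by (intro bexI[of _ ?g]) auto
  with E that show ?thesis by blast
qed

definition ext_of_row :: "(nat \<Rightarrow> zp) \<Rightarrow> 'g extension set" where
  "ext_of_row r = {E \<in> extensions p G. matches E r}"

lemma ext_class_eq:
  assumes "E \<in> extensions p G" "r \<in> carrier (V n)" "matches E r"
  shows "ext_rel p G `` {E} = ext_of_row r"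
proof (intro equalityI subsetI)
  fix E' assume "E' \<in> ext_rel p G `` {E}"
  then have rel: "(E, E') \<in> ext_rel p G" by blast
  then have "E' \<in> extensions p G" by (auto simp: ext_rel_def)
  then show "E' \<in> ext_of_row r" using matches_ext_rel[OF rel assms(3,2)] by (simp add: ext_of_row_def)
next
  fix E' assume "E' \<in> ext_of_row r"
  then show "E' \<in> ext_rel p G `` {E}"
    using matches_same[OF assms(1) _ assms(2,3)] by (simp add: ext_of_row_def)
qed

text \<open>Every extension matches some row, and two extensions that match a common row are equivalent.\<close>

lemma Ext_eq: "Ext p G = ext_of_row ` carrier (V n)"
proof (intro equalityI subsetI)
  fix c assume "c \<in> Ext p G"
  then obtain E where E: "E \<in> extensions p G" "c = ext_rel p G `` {E}" by (auto simp: Ext_def quotient_def)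
  obtain r where "r \<in> carrier (V n)" "matches E r" using matches_exists[OF E(1)] by blast
  then show "c \<in> ext_of_row ` carrier (V n)" using ext_class_eq[OF E(1)] E(2) by blast
next
  fix c assume "c \<in> ext_of_row ` carrier (V n)"
  then obtain r where r: "r \<in> carrier (V n)" "c = ext_of_row r" by blast
  obtain E where "E \<in> extensions p G" "matches E r" using extension_exists[OF r(1)] by blast
  then show "c \<in> Ext p G" using ext_class_eq r unfolding Ext_def quotient_def by blast
qed

lemma ext_of_row_memb:
  assumes "E \<in> ext_of_row r" "E \<in> ext_of_row r'" "r \<in> carrier (V n)" "r' \<in> carrier (V n)"
  shows "ext_of_row r = ext_of_row r'"
  using assms ext_class_eq[of E] by (auto simp: ext_of_row_def)

lemma ext_of_row_nonempty:
  assumes "r \<in> carrier (V n)" obtains E where "E \<in> ext_of_row r"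
proof -
  obtain E where "E \<in> extensions p G" "matches E r" using extension_exists[OF assms] by blast
  then show ?thesis by (intro that[of E]) (simp add: ext_of_row_def)
qed

lemma ext_of_row_shift:
  assumes r: "r \<in> carrier (V n)" and w: "w \<in> carrier (V n)" and r': "r' \<in> carrier (V n)"
    and eq: "\<And>u. u \<in> carrier (V n) \<Longrightarrow> dot n r' u = dot n r u \<oplus>\<^bsub>Z\<^esub> dot n w (A u)"
  shows "ext_of_row r' = ext_of_row r"
proof -
  obtain E where E: "E \<in> ext_of_row r" using ext_of_row_nonempty[OF r] by blast
  then have "E \<in> ext_of_row r'" using matches_shift[OF _ r _ w eq] by (simp add: ext_of_row_def)
  then show ?thesis using ext_of_row_memb[OF _ E r' r] by blast
qed

text \<open>Whether two rows define the same class depends only on their difference.\<close>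

lemma ext_of_row_translate:
  assumes r: "r \<in> carrier (V n)" "r' \<in> carrier (V n)" and s: "s \<in> carrier (V n)"
    and eq: "ext_of_row r = ext_of_row r'"
  shows "ext_of_row (s \<oplus>\<^bsub>V n\<^esub> r) = ext_of_row (s \<oplus>\<^bsub>V n\<^esub> r')"
proof -
  obtain E where "E \<in> ext_of_row r" using ext_of_row_nonempty[OF r(1)] by blast
  then have E: "E \<in> extensions p G" "matches E r" "matches E r'" using eq by (auto simp: ext_of_row_def)
  obtain w where w: "w \<in> carrier (V n)"
    "\<And>u. u \<in> carrier (V n) \<Longrightarrow> dot n r' u = dot n r u \<oplus>\<^bsub>Z\<^esub> dot n w (A u)"
    using matches_diff[OF E(1) r(1) E(2) r(2) E(3)] by blast
  have "ext_of_row (s \<oplus>\<^bsub>V n\<^esub> r') = ext_of_row (s \<oplus>\<^bsub>V n\<^esub> r)"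
  proof (rule ext_of_row_shift[OF _ w(1)])
    fix u assume u: "u \<in> carrier (V n)"
    show "dot n (s \<oplus>\<^bsub>V n\<^esub> r') u = dot n (s \<oplus>\<^bsub>V n\<^esub> r) u \<oplus>\<^bsub>Z\<^esub> dot n w (A u)"
      using w(2)[OF u] dot_add[OF s r(1) u] dot_add[OF s r(2) u] dot_closed_vec s r(1) w(1) u A_closed[OF u]
      by (simp add: Z.a_assoc)
  qed (use r s in auto)
  then show ?thesis by simp
qed

text \<open>If \<open>r' = r + p\<^sup>k t\<close>, the functional \<open>w = t W\<close>, with \<open>W A = p\<^sup>k\<close>, satisfies \<open>w A = p\<^sup>k t\<close>;
  that is, multiples of \<open>p\<^sup>k\<close> belong to the row space.\<close>

lemma ext_of_row_locally_constant:
  assumes r: "r \<in> carrier (V n)" "r' \<in> carrier (V n)" and close: "\<And>j. j < n \<Longrightarrow> r' j k = r j k"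
  shows "ext_of_row r' = ext_of_row r"
proof -
  obtain t where t: "t \<in> carrier (V n)" "r' = r \<oplus>\<^bsub>V n\<^esub> of_N (p ^ k) \<odot>\<^bsub>V n\<^esub> t"
    using same_residue_vec[OF r(2,1) close] by blast
  obtain W where W: "W \<in> module_hom Z (V n) (V n)"
    "\<And>v. v \<in> carrier (V n) \<Longrightarrow> W (A v) = of_N (p ^ k) \<odot>\<^bsub>V n\<^esub> v" using quasi_inverse by metis
  note td = dot_hom[OF V_Pi[OF t(1)]]
  obtain w where w: "w \<in> carrier (V n)" "\<And>v. v \<in> carrier (V n) \<Longrightarrow> dot n t (W v) = dot n w v"
    using functional_eq_dot[OF module_hom_comp[OF W(1) td]] by metis
  show ?thesis
  proof (rule ext_of_row_shift[OF r(1) w(1) r(2)])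
    fix u assume u: "u \<in> carrier (V n)"
    have "dot n w (A u) = of_N (p ^ k) \<otimes>\<^bsub>Z\<^esub> dot n t u"
      using w(2)[OF A_closed[OF u]] W(2)[OF u] module_homD(3)[OF td of_N_closed u] by simp
    also have "\<dots> = dot n (of_N (p ^ k) \<odot>\<^bsub>V n\<^esub> t) u" using dot_scale[OF t(1) of_N_closed u] by simp
    finally show "dot n r' u = dot n r u \<oplus>\<^bsub>Z\<^esub> dot n w (A u)"
      unfolding t(2) using dot_add[OF r(1) _ u, of "of_N (p ^ k) \<odot>\<^bsub>V n\<^esub> t"] t(1) by simp
  qed
qed

lemma Ext_finite: "finite (Ext p G)" and Ext_nonempty: "Ext p G \<noteq> {}"
  unfolding Ext_eq using ext_of_row_locally_constant residue_finite_image[of n k ext_of_row] V.M.zero_closed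
  by (blast, metis empty_is_image empty_iff)

text \<open>Translation by \<open>- s\<close> maps the rows with the class of \<open>s\<close> onto those with the class of zero,
  so that all classes have the same probability.\<close>

lemma ext_of_row_uniform:
  shows "ext_of_row \<in> measurable (haar_family {..<n}) (uniform_count_measure (Ext p G))"
    and "distr (haar_family {..<n}) (uniform_count_measure (Ext p G)) ext_of_row = uniform_count_measure (Ext p G)"
proof -
  let ?\<nu> = "haar_family {..<n}" and ?U = "uniform_count_measure (Ext p G)"
  interpret \<nu>: prob_space ?\<nu> by (rule prob_haar_family)
  have sets: "ext_of_row -` C \<inter> space ?\<nu> \<in> sets ?\<nu>" for C
  proof (rule locally_constant_sets)
    fix r assume "r \<in> ext_of_row -` C \<inter> space ?\<nu>"
    then have r: "r \<in> carrier (V n)" "ext_of_row r \<in> C" by (auto simp: V_simps)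
    show "\<exists>k. \<forall>r'\<in>{..<n} \<rightarrow>\<^sub>E carrier Z. (\<forall>j\<in>{..<n}. r' j k = r j k) \<longrightarrow> r' \<in> ext_of_row -` C \<inter> space ?\<nu>"
      using ext_of_row_locally_constant[OF r(1)] r(2) by (intro exI[of _ k]) (auto simp: V_simps)
  qed auto
  show m: "ext_of_row \<in> measurable ?\<nu> ?U"
  proof (rule measurableI)
    show "ext_of_row r \<in> space ?U" if "r \<in> space ?\<nu>" for r
      using that Ext_eq by (simp add: space_uniform_count_measure V_simps)
  qed (rule sets)
  have em: "emeasure (distr ?\<nu> ?U ext_of_row) C = emeasure ?\<nu> (ext_of_row -` C \<inter> space ?\<nu>)" if "C \<subseteq> Ext p G" for C
    using that by (intro emeasure_distr m) (simp add: sets_uniform_count_measure)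
  have const: "emeasure (distr ?\<nu> ?U ext_of_row) {ext_of_row s} = emeasure (distr ?\<nu> ?U ext_of_row) {ext_of_row \<zero>\<^bsub>V n\<^esub>}"
    if s: "s \<in> carrier (V n)" for s
  proof -
    let ?s = "\<ominus>\<^bsub>V n\<^esub> s"
    let ?T = "\<lambda>r. \<lambda>j\<in>{..<n}. ?s j \<oplus>\<^bsub>Z\<^esub> r j"
    have sc: "?s \<in> carrier (V n)" using s by simp
    have T: "?T \<in> measurable ?\<nu> ?\<nu>" "distr ?\<nu> ?\<nu> ?T = ?\<nu>"
      using haar_family_translate[of "{..<n}" ?s] sc by (auto simp: V_simps)
    have T_add: "?T r = ?s \<oplus>\<^bsub>V n\<^esub> r" for r by (simp add: V_simps)
    have inE: "ext_of_row r \<in> Ext p G" if "r \<in> carrier (V n)" for r using that Ext_eq by blast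
    have "emeasure ?\<nu> (ext_of_row -` {ext_of_row \<zero>\<^bsub>V n\<^esub>} \<inter> space ?\<nu>)
      = emeasure (distr ?\<nu> ?\<nu> ?T) (ext_of_row -` {ext_of_row \<zero>\<^bsub>V n\<^esub>} \<inter> space ?\<nu>)" using T(2) by simp
    also have "\<dots> = emeasure ?\<nu> (?T -` (ext_of_row -` {ext_of_row \<zero>\<^bsub>V n\<^esub>} \<inter> space ?\<nu>) \<inter> space ?\<nu>)"
      by (rule emeasure_distr[OF T(1) sets])
    also have "?T -` (ext_of_row -` {ext_of_row \<zero>\<^bsub>V n\<^esub>} \<inter> space ?\<nu>) \<inter> space ?\<nu>
        = ext_of_row -` {ext_of_row s} \<inter> space ?\<nu>"
    proof -
      have iff: "ext_of_row (?s \<oplus>\<^bsub>V n\<^esub> r) = ext_of_row \<zero>\<^bsub>V n\<^esub> \<longleftrightarrow> ext_of_row r = ext_of_row s"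
        if r: "r \<in> carrier (V n)" for r
      proof
        assume "ext_of_row r = ext_of_row s"
        then show "ext_of_row (?s \<oplus>\<^bsub>V n\<^esub> r) = ext_of_row \<zero>\<^bsub>V n\<^esub>"
          using ext_of_row_translate[OF r s sc] s by (simp add: V.M.l_neg)
      next
        assume "ext_of_row (?s \<oplus>\<^bsub>V n\<^esub> r) = ext_of_row \<zero>\<^bsub>V n\<^esub>"
        then have "ext_of_row (s \<oplus>\<^bsub>V n\<^esub> (?s \<oplus>\<^bsub>V n\<^esub> r)) = ext_of_row (s \<oplus>\<^bsub>V n\<^esub> \<zero>\<^bsub>V n\<^esub>)"
          using ext_of_row_translate[OF _ _ s, of "?s \<oplus>\<^bsub>V n\<^esub> r" "\<zero>\<^bsub>V n\<^esub>"] r sc by simp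
        then show "ext_of_row r = ext_of_row s" using r s sc by (simp add: V.M.a_assoc[symmetric] V.M.r_neg)
      qed
      have cl: "?s \<oplus>\<^bsub>V n\<^esub> r \<in> carrier (V n)" if "r \<in> carrier (V n)" for r using that sc by simp
      show ?thesis
      proof (rule Set.set_eqI)
        fix r
        show "r \<in> ?T -` (ext_of_row -` {ext_of_row \<zero>\<^bsub>V n\<^esub>} \<inter> space ?\<nu>) \<inter> space ?\<nu>
          \<longleftrightarrow> r \<in> ext_of_row -` {ext_of_row s} \<inter> space ?\<nu>"
          unfolding vimage_eq Int_iff singleton_iff T_add space_haar_V using iff[of r] cl[of r] by blast
      qed
    qed
    finally show ?thesis using em[of "{ext_of_row s}"] em[of "{ext_of_row \<zero>\<^bsub>V n\<^esub>}"] inE s by simp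
  qed
  show "distr ?\<nu> ?U ext_of_row = ?U"
  proof (rule measure_eqI_finite)
    show "sets (distr ?\<nu> ?U ext_of_row) = Pow (Ext p G)" "sets ?U = Pow (Ext p G)"
      by (simp_all add: sets_uniform_count_measure)
    show "finite (Ext p G)" by (rule Ext_finite)
    interpret D: prob_space "distr ?\<nu> ?U ext_of_row" by (rule \<nu>.prob_space_distr[OF m])
    let ?c = "measure (distr ?\<nu> ?U ext_of_row) {ext_of_row \<zero>\<^bsub>V n\<^esub>}"
    have c: "measure (distr ?\<nu> ?U ext_of_row) {e} = ?c" if "e \<in> Ext p G" for e
    proof -
      obtain s where s: "s \<in> carrier (V n)" "e = ext_of_row s" using \<open>e \<in> Ext p G\<close> unfolding Ext_eq by blast
      show ?thesis unfolding measure_def s(2) const[OF s(1)] ..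
    qed
    have "1 = measure (distr ?\<nu> ?U ext_of_row) (Ext p G)"
      using D.prob_space by (simp add: space_uniform_count_measure)
    also have "\<dots> = (\<Sum>e\<in>Ext p G. measure (distr ?\<nu> ?U ext_of_row) {e})"
      using Ext_finite by (intro D.finite_measure_eq_sum_singleton) (auto simp: sets_uniform_count_measure)
    also have "\<dots> = card (Ext p G) * ?c" using c by simp
    finally have cc: "?c = 1 / card (Ext p G)"
      using Ext_finite Ext_nonempty by (simp add: field_simps)
    fix e assume e: "e \<in> Ext p G"
    show "emeasure (distr ?\<nu> ?U ext_of_row) {e} = emeasure ?U {e}"
      using e c[OF e] cc Ext_finite by (simp add: D.emeasure_eq_measure emeasure_uniform_count_measure)
  qed
qed

lemma middle_class_of_row:
  assumes r: "r \<in> carrier (V n)" and N: "is_matrix p (Suc n) n N"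
    and rows: "\<And>i j. i < n \<Longrightarrow> j < n \<Longrightarrow> N (i, j) = M (i, j)" and last: "\<And>j. j < n \<Longrightarrow> N (n, j) = r j"
  shows "middle_class p (ext_of_row r) = iso_class p (coker p (Suc n) n N)"
    and "iso_class p (coker p (Suc n) n N) \<in> X1 p"
proof -
  have im: "mat_vec p (Suc n) n N ` carrier (V n) = bordered_image r"
    unfolding bordered_image_def
  proof (rule image_cong[OF refl])
    fix u assume u: "u \<in> carrier (V n)"
    have "dot n (\<lambda>j. N (n, j)) u = dot n r u" using last V_Pi[OF r] V_Pi[OF u] by (intro dot_cong) auto
    then show "mat_vec p (Suc n) n N u = (A u)(n := dot n r u)" using mat_vec_new_row[OF N rows u] by simp
  qed
  obtain E0 where E0: "E0 \<in> ext_of_row r" using ext_of_row_nonempty[OF r] by blast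
  obtain H i q where Eq: "(SOME E. E \<in> ext_of_row r) = (H, i, q)" by (metis prod_cases3)
  then have "(H, i, q) \<in> ext_of_row r" using someI[of "\<lambda>E. E \<in> ext_of_row r", OF E0] by simp
  then have E: "(H, i, q) \<in> extensions p G" "matches (H, i, q) r" by (auto simp: ext_of_row_def)
  note e = extensionD[OF E(1)]
  obtain P where P: "P \<in> module_hom Z (V (Suc n)) H" "P ` carrier (V (Suc n)) = carrier H"
    "\<And>x. x \<in> carrier (V (Suc n)) \<Longrightarrow> P x = \<zero>\<^bsub>H\<^esub> \<longleftrightarrow> x \<in> bordered_image r"
    using matches_presentation[OF E(1) r E(2)] by metis
  show "middle_class p (ext_of_row r) = iso_class p (coker p (Suc n) n N)"
    unfolding middle_class_def Eq using iso_class_coker[OF N e(1) P(1,2)] P(3) im by simp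
  obtain \<kappa> where \<kappa>: "module Z (coker p (Suc n) n N)" "\<kappa> \<in> module_hom Z (V (Suc n)) (coker p (Suc n) n N)"
    "\<kappa> ` carrier (V (Suc n)) = carrier (coker p (Suc n) n N)"
    "\<And>x. x \<in> carrier (V (Suc n)) \<Longrightarrow> \<kappa> x = \<zero>\<^bsub>coker p (Suc n) n N\<^esub> \<longleftrightarrow> x \<in> mat_vec p (Suc n) n N ` carrier (V n)"
    using coker_presentation[OF N] by metis
  let ?C = "coker p (Suc n) n N"
  have same: "P x = \<zero>\<^bsub>H\<^esub> \<longleftrightarrow> \<kappa> x = \<zero>\<^bsub>?C\<^esub>" if "x \<in> carrier (V (Suc n))" for x
    using P(3)[OF that] \<kappa>(4)[OF that] im by simp
  obtain f where f: "f \<in> module_iso Z H ?C"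
    by (rule same_kernel_module_iso[OF V_module e(1) \<kappa>(1) P(1,2) \<kappa>(2,3) same]) (assumption, rule that)
  have "has_rank Z ?C 1"
  proof (rule rank_one_if_finite_over_Zp[OF \<kappa>(1) module_hom_comp[OF e(2) module_isoD(1)[OF f]]])
    show "inj_on (\<lambda>x. f (i x)) (carrier Z)"
    proof (rule inj_onI)
      fix a b assume ab: "a \<in> carrier Z" "b \<in> carrier Z" "f (i a) = f (i b)"
      then have "i a = i b" using inj_onD[OF module_isoD(3)[OF f]] e(7) by blast
      then show "a = b" using inj_onD[OF e(4)] ab by blast
    qed
    fix x assume "x \<in> carrier ?C"
    then have "x \<in> f ` carrier H" using module_isoD(2)[OF f] by simp
    then obtain y where y: "y \<in> carrier H" "x = f y" by blast
    interpret H: Module.module Z H by (rule e(1))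
    have "q (of_N (p ^ k) \<odot>\<^bsub>H\<^esub> y) = \<zero>\<^bsub>G\<^esub>"
      using module_homD(3)[OF e(3) of_N_closed y(1)] kill[OF module_homD(1)[OF e(3) y(1)]] by simp
    then obtain a where a: "a \<in> carrier Z" "of_N (p ^ k) \<odot>\<^bsub>H\<^esub> y = i a"
      using e(6)[of "of_N (p ^ k) \<odot>\<^bsub>H\<^esub> y"] y(1) by auto
    have "of_N (p ^ k) \<odot>\<^bsub>?C\<^esub> x = f (i a)"
      using module_homD(3)[OF module_isoD(1)[OF f] of_N_closed y(1), of "p ^ k"] y(2) a(2) by simp
    then show "of_N (p ^ k) \<odot>\<^bsub>?C\<^esub> x \<in> (\<lambda>x. f (i x)) ` carrier Z"
      using a(1) by (rule image_eqI)
  qed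
  moreover have "finitely_generated Z ?C" unfolding finitely_generated_iff[OF \<kappa>(1)] using \<kappa>(2,3) by blast
  ultimately show "iso_class p ?C \<in> X1 p" using \<kappa>(1) unfolding X1_def by blast
qed

end

section \<open>Laws and change of variables\<close>

lemma emeasure_law:
  assumes A: "A \<subseteq> S" and meas: "\<And>A. A \<subseteq> S \<Longrightarrow> g -` A \<inter> space R \<in> sets R"
  shows "emeasure (law R g S) A = emeasure R (g -` A \<inter> space R)"
proof -
  let ?O = "g -` S \<inter> space R"
  have O: "?O \<inter> space R \<in> sets R" using meas[of S] by simp
  have sp: "space (restrict_space R ?O) = ?O" by (simp add: space_restrict_space)
  have g: "g \<in> measurable (restrict_space R ?O) (count_space S)"
  proof (rule measurableI)
    show "g x \<in> space (count_space S)" if "x \<in> space (restrict_space R ?O)" for x using that sp by auto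
    show "g -` B \<inter> space (restrict_space R ?O) \<in> sets (restrict_space R ?O)" if "B \<in> sets (count_space S)" for B
    proof -
      have "g -` B \<inter> space (restrict_space R ?O) = g -` B \<inter> space R" using that sp by auto
      then show ?thesis using that meas[of B] O by (subst sets_restrict_space_iff) auto
    qed
  qed
  have "emeasure (law R g S) A = emeasure (restrict_space R ?O) (g -` A \<inter> ?O)"
    unfolding law_def using A sp by (subst emeasure_distr[OF g]) auto
  also have "g -` A \<inter> ?O = g -` A \<inter> space R" using A by auto
  also have "emeasure (restrict_space R ?O) \<dots> = emeasure R (g -` A \<inter> space R)"
    using A by (intro emeasure_restrict_space O) auto
  finally show ?thesis .
qed

lemma sets_law [simp]: "sets (law P f S) = Pow S" and space_law [simp]: "space (law P f S) = S"
  by (simp_all add: law_def)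

lemma law_surely:
  assumes f: "random_element P f S" "\<And>w. w \<in> space P \<Longrightarrow> f w \<in> S"
  shows "f \<in> measurable P (count_space S)" and "law P f S = distr P (count_space S) f"
proof -
  show m: "f \<in> measurable P (count_space S)"
    using f by (intro measurableI) (auto simp: random_element_def)
  show "law P f S = distr P (count_space S) f"
  proof (rule measure_eqI)
    fix A assume "A \<in> sets (law P f S)"
    then have A: "A \<subseteq> S" by simp
    show "emeasure (law P f S) A = emeasure (distr P (count_space S) f) A"
      using emeasure_law[OF A, of f P] emeasure_distr[OF m, of A] f(1) A by (simp add: random_element_def)
  qed simp
qed

text \<open>The mass of a law is at most that of \<open>P\<close>, also in the degenerate case in which the set function
  fails to be a measure and is replaced by the zero measure.\<close>

lemma subprob_law:
  assumes P: "prob_space P" and S: "S \<noteq> {}"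
  shows "subprob_space (law P f S)"
proof (rule subprob_spaceI)
  interpret prob_space P by fact
  let ?O = "f -` S \<inter> space P"
  have r: "emeasure (restrict_space P ?O) B \<le> 1" for B
    unfolding restrict_space_def emeasure_measure_of_conv using emeasure_le_1 by simp
  show "emeasure (law P f S) (space (law P f S)) \<le> 1"
    unfolding law_def distr_def emeasure_measure_of_conv using r by simp
qed (use S in simp)

text \<open>All three parts replace the random entries by the random object that occurs in the definition of
  the operator: a class in \<open>Ext\<close>, a Haar-random element, or a point of the product space.\<close>

lemma distributed_as_pullback:
  assumes h: "h \<in> measurable P Q" "distr P Q h = Q'" and Q': "sets Q' = sets Q"
    and F: "random_element Q' F S" and f: "\<And>w. w \<in> space P \<Longrightarrow> f w = F (h w)"
  shows "distributed_as P f S (law Q' F S)"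
proof -
  have sQ: "space Q' = space Q" using sets_eq_imp_space_eq[OF Q'] .
  have hQ': "h \<in> measurable P Q'" using h(1) measurable_cong_sets[OF refl Q'] by blast
  have d: "distr P Q' h = Q'" using h(2) distr_cong[OF refl Q', of P h h] by simp
  have pre: "f -` A \<inter> space P = h -` (F -` A \<inter> space Q') \<inter> space P" for A
    using f measurable_space[OF hQ'] by auto
  have m: "F -` A \<inter> space Q' \<in> sets Q'" if "A \<subseteq> S" for A using F that by (simp add: random_element_def)
  have mP: "f -` A \<inter> space P \<in> sets P" if "A \<subseteq> S" for A
    unfolding pre using measurable_sets[OF hQ' m[OF that]] .
  have "AE w in distr P Q' h. F w \<in> S" using F unfolding d random_element_def by simp
  then have "AE w in P. F (h w) \<in> S" by (rule AE_distrD[OF hQ'])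
  then have "AE w in P. f w \<in> S" by (rule AE_mp) (intro AE_I2, simp add: f)
  then have "random_element P f S" using mP by (simp add: random_element_def)
  moreover have "law P f S = law Q' F S"
  proof (rule measure_eqI)
    fix A assume "A \<in> sets (law P f S)"
    then have A: "A \<subseteq> S" by simp
    have "emeasure (law P f S) A = emeasure P (h -` (F -` A \<inter> space Q') \<inter> space P)"
      using emeasure_law[OF A mP] pre by simp
    also have "\<dots> = emeasure (distr P Q' h) (F -` A \<inter> space Q')"
      using emeasure_distr[OF hQ' m[OF A]] by simp
    also have "\<dots> = emeasure (law Q' F S) A" using emeasure_law[OF A m] d by simp
    finally show "emeasure (law P f S) A = emeasure (law Q' F S) A" .
  qed simp
  ultimately show ?thesis by (simp add: distributed_as_def)
qed

context padic
begin

section \<open>Adjoining a column\<close>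

text \<open>A quotient of \<open>\<int>\<^sub>p\<^sup>m\<close> that is killed by \<open>p\<^sup>k\<close> is determined by residues modulo \<open>p\<^sup>k\<close>, hence
  finite.\<close>

lemma coker_X0_iff:
  assumes N: "is_matrix p m l N"
  shows "iso_class p (coker p m l N) \<in> X0 p
    \<longleftrightarrow> (\<exists>k. \<forall>v\<in>carrier (V m). of_N (p ^ k) \<odot>\<^bsub>V m\<^esub> v \<in> mat_vec p m l N ` carrier (V l))"
proof -
  let ?C = "coker p m l N"
  obtain \<kappa> where \<kappa>: "module Z ?C" "\<kappa> \<in> module_hom Z (V m) ?C" "\<kappa> ` carrier (V m) = carrier ?C"
    "\<And>x. x \<in> carrier (V m) \<Longrightarrow> \<kappa> x = \<zero>\<^bsub>?C\<^esub> \<longleftrightarrow> x \<in> mat_vec p m l N ` carrier (V l)"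
    using coker_presentation[OF N] by metis
  interpret C: Module.module Z ?C by (rule \<kappa>(1))
  have iff: "of_N (p ^ k) \<odot>\<^bsub>?C\<^esub> \<kappa> v = \<zero>\<^bsub>?C\<^esub> \<longleftrightarrow> of_N (p ^ k) \<odot>\<^bsub>V m\<^esub> v \<in> mat_vec p m l N ` carrier (V l)"
    if v: "v \<in> carrier (V m)" for v k
    using \<kappa>(4)[OF V.smult_closed[OF of_N_closed v]] module_homD(3)[OF \<kappa>(2) of_N_closed v] by simp
  show ?thesis
  proof
    assume "iso_class p ?C \<in> X0 p"
    then obtain k where k: "finite (carrier ?C)" "card (carrier ?C) = p ^ k" using X0_iff[OF \<kappa>(1)] by blast
    have "of_N (p ^ k) \<odot>\<^bsub>V m\<^esub> v \<in> mat_vec p m l N ` carrier (V l)" if v: "v \<in> carrier (V m)" for v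
      using iff[OF v] killed_by_order[OF \<kappa>(1) k module_homD(1)[OF \<kappa>(2) v]] by blast
    then show "\<exists>k. \<forall>v\<in>carrier (V m). of_N (p ^ k) \<odot>\<^bsub>V m\<^esub> v \<in> mat_vec p m l N ` carrier (V l)" by blast
  next
    assume "\<exists>k. \<forall>v\<in>carrier (V m). of_N (p ^ k) \<odot>\<^bsub>V m\<^esub> v \<in> mat_vec p m l N ` carrier (V l)"
    then obtain k where k: "\<And>v. v \<in> carrier (V m) \<Longrightarrow> of_N (p ^ k) \<odot>\<^bsub>?C\<^esub> \<kappa> v = \<zero>\<^bsub>?C\<^esub>"
      using iff by blast
    have "finite (\<kappa> ` carrier (V m))"
    proof (rule residue_finite_image)
      fix v w assume vw: "v \<in> carrier (V m)" "w \<in> carrier (V m)" "\<And>i. i < m \<Longrightarrow> v i k = w i k"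
      obtain z where z: "z \<in> carrier (V m)" "v = w \<oplus>\<^bsub>V m\<^esub> of_N (p ^ k) \<odot>\<^bsub>V m\<^esub> z"
        using same_residue_vec[OF vw] by blast
      show "\<kappa> v = \<kappa> w"
        unfolding z(2) using vw(2) z(1) k[OF z(1)] module_homD[OF \<kappa>(2)] by simp
    qed
    then have fin: "finite (carrier ?C)" using \<kappa>(3) by simp
    have "of_N (p ^ k) \<odot>\<^bsub>?C\<^esub> x = \<zero>\<^bsub>?C\<^esub>" if "x \<in> carrier ?C" for x
    proof -
      have "x \<in> \<kappa> ` carrier (V m)" using that \<kappa>(3) by simp
      then show ?thesis using k by blast
    qed
    then show "iso_class p ?C \<in> X0 p" using X0_iff[OF \<kappa>(1)] fin p_power_torsion_card[OF \<kappa>(1) fin] by blast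
  qed
qed

lemma coker_locally_constant:
  assumes N: "is_matrix p m l N" and X0: "iso_class p (coker p m l N) \<in> X0 p"
  shows "\<exists>k. \<forall>N'. is_matrix p m l N' \<and> (\<forall>i<m. \<forall>j<l. N' (i, j) k = N (i, j) k)
    \<longrightarrow> coker p m l N' = coker p m l N"
proof -
  obtain k where k: "\<And>v. v \<in> carrier (V m) \<Longrightarrow> of_N (p ^ k) \<odot>\<^bsub>V m\<^esub> v \<in> mat_vec p m l N ` carrier (V l)"
    using X0 coker_X0_iff[OF N] by blast
  show ?thesis
  proof (intro exI[of _ "Suc k"] allI impI, elim conjE)
    fix N' assume N': "is_matrix p m l N'" "\<forall>i<m. \<forall>j<l. N' (i, j) (Suc k) = N (i, j) (Suc k)"
    show "coker p m l N' = coker p m l N"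
      unfolding coker_def using image_locally_constant[OF N N'(1) N'(2)[rule_format] k] by simp
  qed
qed

lemma coker_new_column:
  fixes K :: "(zp, 'b) module"
  assumes M: "is_matrix p m n M" and K: "module Z K"
    and \<psi>: "\<psi> \<in> module_hom Z (V m) K" "\<psi> ` carrier (V m) = carrier K"
    and ker: "\<And>x. x \<in> carrier (V m) \<Longrightarrow> \<psi> x = \<zero>\<^bsub>K\<^esub> \<longleftrightarrow> x \<in> mat_vec p m n M ` carrier (V n)"
    and c: "c \<in> carrier (V m)" and N: "is_matrix p m (Suc n) N"
    and cols: "\<And>i j. i < m \<Longrightarrow> j < n \<Longrightarrow> N (i, j) = M (i, j)" "\<And>i. i < m \<Longrightarrow> N (i, n) = c i"
  shows "iso_class p (coker p m (Suc n) N) = iso_class p (quot_module K (span Z K {\<psi> c}))"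
    and "\<And>x. x \<in> carrier (V m) \<Longrightarrow> \<psi> x \<in> span Z K {\<psi> c} \<longleftrightarrow> x \<in> mat_vec p m (Suc n) N ` carrier (V (Suc n))"
proof -
  interpret K: Module.module Z K by fact
  have h: "\<psi> c \<in> carrier K" using module_homD(1)[OF \<psi>(1) c] .
  have col: "(\<lambda>i\<in>{..<m}. N (i, n)) = c"
    using c cols(2) V_memb[OF c] by (intro V_eqI[of _ m] V_closedI) auto
  have NA: "mat_vec p m (Suc n) N x = mat_vec p m n M (restrict x {..<n}) \<oplus>\<^bsub>V m\<^esub> x n \<odot>\<^bsub>V m\<^esub> c"
    if "x \<in> carrier (V (Suc n))" for x
    using mat_vec_new_column[OF N cols(1) that] unfolding col .
  note Mh = mat_vec_hom[OF M]
  show iff: "\<psi> x \<in> span Z K {\<psi> c} \<longleftrightarrow> x \<in> mat_vec p m (Suc n) N ` carrier (V (Suc n))"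
    if x: "x \<in> carrier (V m)" for x
  proof
    assume "\<psi> x \<in> span Z K {\<psi> c}"
    then obtain t where t: "t \<in> carrier Z" "\<psi> x = t \<odot>\<^bsub>K\<^esub> \<psi> c" unfolding K.span_singleton(1)[OF h] by blast
    have tc: "t \<odot>\<^bsub>V m\<^esub> c \<in> carrier (V m)" using t c by simp
    have d: "x \<ominus>\<^bsub>V m\<^esub> t \<odot>\<^bsub>V m\<^esub> c \<in> carrier (V m)" using x tc by (rule V.M.minus_closed)
    have "\<psi> (x \<ominus>\<^bsub>V m\<^esub> t \<odot>\<^bsub>V m\<^esub> c) = \<zero>\<^bsub>K\<^esub>"
      using module_hom_fibre[OF V_module K \<psi>(1) x tc] t module_homD(3)[OF \<psi>(1) t(1) c] by simp
    then obtain u where u: "u \<in> carrier (V n)" "x \<ominus>\<^bsub>V m\<^esub> t \<odot>\<^bsub>V m\<^esub> c = mat_vec p m n M u"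
      using ker[OF d] by blast
    have "x = (x \<ominus>\<^bsub>V m\<^esub> t \<odot>\<^bsub>V m\<^esub> c) \<oplus>\<^bsub>V m\<^esub> t \<odot>\<^bsub>V m\<^esub> c"
      using x tc by (simp add: a_minus_def V.M.a_assoc V.M.l_neg)
    then have "x = mat_vec p m n M u \<oplus>\<^bsub>V m\<^esub> t \<odot>\<^bsub>V m\<^esub> c" unfolding u(2) .
    also have "\<dots> = mat_vec p m (Suc n) N (u(n := t))"
      using NA[OF snoc_closed[OF u(1) t(1)]] u(1) by simp
    finally show "x \<in> mat_vec p m (Suc n) N ` carrier (V (Suc n))" using snoc_closed[OF u(1) t(1)] by blast
  next
    assume "x \<in> mat_vec p m (Suc n) N ` carrier (V (Suc n))"
    then obtain y where y: "y \<in> carrier (V (Suc n))" "x = mat_vec p m (Suc n) N y" by blast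
    have f: "restrict y {..<n} \<in> carrier (V n)" "y n \<in> carrier Z" using front_closed[OF y(1)] V_memb[OF y(1)] by auto
    have Mf: "mat_vec p m n M (restrict y {..<n}) \<in> carrier (V m)" using module_homD(1)[OF Mh f(1)] .
    have "\<psi> x = \<psi> (mat_vec p m n M (restrict y {..<n})) \<oplus>\<^bsub>K\<^esub> y n \<odot>\<^bsub>K\<^esub> \<psi> c"
      unfolding y(2) NA[OF y(1)]
      using module_homD(2)[OF \<psi>(1) Mf V.smult_closed[OF f(2) c]] module_homD(3)[OF \<psi>(1) f(2) c] by simp
    also have "\<psi> (mat_vec p m n M (restrict y {..<n})) = \<zero>\<^bsub>K\<^esub>" using ker[OF Mf] f(1) by blast
    finally have "\<psi> x = y n \<odot>\<^bsub>K\<^esub> \<psi> c" using h f(2) by simp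
    then show "\<psi> x \<in> span Z K {\<psi> c}" unfolding K.span_singleton(1)[OF h] using f(2) by blast
  qed
  note Q = quot_module[OF K K.span_singleton(2)[OF h]]
  let ?S = "span Z K {\<psi> c}"
  show "iso_class p (coker p m (Suc n) N) = iso_class p (quot_module K ?S)"
  proof (rule iso_class_coker[OF N Q(1) module_hom_comp[OF \<psi>(1) Q(2)]])
    show "(\<lambda>x. ?S +>\<^bsub>K\<^esub> \<psi> x) ` carrier (V m) = carrier (quot_module K ?S)"
      using Q(3) \<psi>(2) by (metis image_image)
    show "?S +>\<^bsub>K\<^esub> \<psi> x = \<zero>\<^bsub>quot_module K ?S\<^esub> \<longleftrightarrow> x \<in> mat_vec p m (Suc n) N ` carrier (V (Suc n))"
      if x: "x \<in> carrier (V m)" for x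
      using Q(4)[OF module_homD(1)[OF \<psi>(1) x]] iff[OF x] by blast
  qed
qed

text \<open>Rank one enters only through these two consequences: some \<open>h\<close> is not torsion, and for any such
  \<open>h\<close> every element has a nonzero multiple in the span of \<open>h\<close>.\<close>

lemma rank_one_properties:
  assumes K: "module Z K" and H: "module Z H" and f: "f \<in> module_iso Z K H" and rank: "has_rank Z H 1"
  shows "\<exists>h\<in>carrier K. \<forall>a\<in>carrier Z. a \<odot>\<^bsub>K\<^esub> h = \<zero>\<^bsub>K\<^esub> \<longrightarrow> a = \<zero>\<^bsub>Z\<^esub>"
    and "\<lbrakk>h \<in> carrier K; \<And>a. a \<in> carrier Z \<Longrightarrow> a \<odot>\<^bsub>K\<^esub> h = \<zero>\<^bsub>K\<^esub> \<Longrightarrow> a = \<zero>\<^bsub>Z\<^esub>; x \<in> carrier K\<rbrakk>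
      \<Longrightarrow> \<exists>b\<in>carrier Z. \<exists>a\<in>carrier Z. b \<noteq> \<zero>\<^bsub>Z\<^esub> \<and> b \<odot>\<^bsub>K\<^esub> x = a \<odot>\<^bsub>K\<^esub> h"
proof -
  interpret K: Module.module Z K by fact
  interpret H: Module.module Z H by fact
  interpret D: domain Z by (rule Zp_domain)
  note fh = module_homD[OF module_isoD(1)[OF f]]
  have f0: "f x = \<zero>\<^bsub>H\<^esub> \<longleftrightarrow> x = \<zero>\<^bsub>K\<^esub>" if "x \<in> carrier K" for x using module_iso_kernel[OF K H f that] .
  obtain S where S: "finite S" "lin_indep Z H S" "card S = 1" using rank by (auto simp: has_rank_def)
  obtain s where s: "S = {s}" using card_1_singletonE[OF S(3)] by blast
  have sH: "s \<in> carrier H" using S(2) s by (simp add: lin_indep_def)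
  then have "s \<in> f ` carrier K" using module_isoD(2)[OF f] by simp
  then obtain h0 where h0: "h0 \<in> carrier K" "s = f h0" by blast
  have "a = \<zero>\<^bsub>Z\<^esub>" if a: "a \<in> carrier Z" "a \<odot>\<^bsub>K\<^esub> h0 = \<zero>\<^bsub>K\<^esub>" for a
  proof -
    have "a \<odot>\<^bsub>H\<^esub> s = \<zero>\<^bsub>H\<^esub>" using fh(3)[OF a(1) h0(1)] a(2) h0(2) f0[OF K.M.zero_closed] by simp
    then show ?thesis using S(2) s lin_indep_singleton[OF H sH] a(1) by blast
  qed
  then show "\<exists>h\<in>carrier K. \<forall>a\<in>carrier Z. a \<odot>\<^bsub>K\<^esub> h = \<zero>\<^bsub>K\<^esub> \<longrightarrow> a = \<zero>\<^bsub>Z\<^esub>" using h0(1) by blast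
  assume h: "h \<in> carrier K" and nt: "\<And>a. a \<in> carrier Z \<Longrightarrow> a \<odot>\<^bsub>K\<^esub> h = \<zero>\<^bsub>K\<^esub> \<Longrightarrow> a = \<zero>\<^bsub>Z\<^esub>"
    and x: "x \<in> carrier K"
  show "\<exists>b\<in>carrier Z. \<exists>a\<in>carrier Z. b \<noteq> \<zero>\<^bsub>Z\<^esub> \<and> b \<odot>\<^bsub>K\<^esub> x = a \<odot>\<^bsub>K\<^esub> h"
  proof (cases "x = h")
    case True
    then show ?thesis using x by (intro bexI[of _ "\<one>\<^bsub>Z\<^esub>"]) auto
  next
    case False
    then have ne: "f x \<noteq> f h" using inj_onD[OF module_isoD(3)[OF f]] x h by blast
    let ?S = "{f h, f x}"
    have SH: "?S \<subseteq> carrier H" using fh(1) x h by blast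
    have fxh: "f x \<in> carrier H" "f h \<in> carrier H" using SH by auto
    have "card ?S = 2" using ne by simp
    then have "\<not> lin_indep Z H ?S" using rank unfolding has_rank_def by (metis One_nat_def finite.emptyI finite_insert numeral_2_eq_2 not_less_eq_eq order_refl)
    then obtain c where c: "c \<in> ?S \<rightarrow> carrier Z" "(\<Oplus>\<^bsub>H\<^esub>s\<in>?S. c s \<odot>\<^bsub>H\<^esub> s) = \<zero>\<^bsub>H\<^esub>" "\<not> (\<forall>s\<in>?S. c s = \<zero>\<^bsub>Z\<^esub>)"
      unfolding lin_indep_def using SH by blast
    let ?a = "c (f h)" and ?b = "c (f x)"
    have ab: "?a \<in> carrier Z" "?b \<in> carrier Z" using c(1) by auto
    have "?a \<odot>\<^bsub>H\<^esub> f h \<oplus>\<^bsub>H\<^esub> ?b \<odot>\<^bsub>H\<^esub> f x = \<zero>\<^bsub>H\<^esub>"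
      using c(2) ne ab fxh by (simp add: Pi_iff)
    then have "f (?a \<odot>\<^bsub>K\<^esub> h \<oplus>\<^bsub>K\<^esub> ?b \<odot>\<^bsub>K\<^esub> x) = \<zero>\<^bsub>H\<^esub>" using fh x h ab by simp
    then have z: "?a \<odot>\<^bsub>K\<^esub> h \<oplus>\<^bsub>K\<^esub> ?b \<odot>\<^bsub>K\<^esub> x = \<zero>\<^bsub>K\<^esub>" using f0 x h ab by simp
    have b0: "?b \<noteq> \<zero>\<^bsub>Z\<^esub>"
    proof
      assume b: "?b = \<zero>\<^bsub>Z\<^esub>"
      then have "?a \<odot>\<^bsub>K\<^esub> h = \<zero>\<^bsub>K\<^esub>" using z x h ab by simp
      then have "?a = \<zero>\<^bsub>Z\<^esub>" using nt ab(1) by blast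
      then show False using b c(3) by blast
    qed
    have "?b \<odot>\<^bsub>K\<^esub> x \<oplus>\<^bsub>K\<^esub> ?a \<odot>\<^bsub>K\<^esub> h = \<zero>\<^bsub>K\<^esub>" using z x h ab by (simp add: K.M.a_comm)
    then have "\<ominus>\<^bsub>K\<^esub> (?a \<odot>\<^bsub>K\<^esub> h) = ?b \<odot>\<^bsub>K\<^esub> x"
      by (rule K.M.minus_equality) (use x h ab in auto)
    then have "?b \<odot>\<^bsub>K\<^esub> x = (\<ominus>\<^bsub>Z\<^esub> ?a) \<odot>\<^bsub>K\<^esub> h" using K.smult_l_minus[OF ab(1) h] by simp
    then show ?thesis using ab b0 by blast
  qed
qed

text \<open>If \<open>b + i h = b' + j h\<close> with torsion elements \<open>b\<close> and \<open>b'\<close> and \<open>i < j\<close>, then a nonzero multiple of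
  \<open>h\<close> is zero.  So the translates of \<open>B\<close> by multiples of \<open>h\<close> are disjoint, and they all have the
  same measure.\<close>

lemma torsion_null:
  assumes K: "module Z K" and \<mu>: "is_haar p K \<mu>" and B: "B \<in> sets \<mu>"
    and torsion: "\<And>x. x \<in> B \<Longrightarrow> \<exists>a\<in>carrier Z. a \<noteq> \<zero>\<^bsub>Z\<^esub> \<and> a \<odot>\<^bsub>K\<^esub> x = \<zero>\<^bsub>K\<^esub>"
    and h: "h \<in> carrier K" "\<And>a. a \<in> carrier Z \<Longrightarrow> a \<odot>\<^bsub>K\<^esub> h = \<zero>\<^bsub>K\<^esub> \<Longrightarrow> a = \<zero>\<^bsub>Z\<^esub>"
  shows "emeasure \<mu> B = 0"
proof -
  interpret K: Module.module Z K by fact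
  interpret D: domain Z by (rule Zp_domain)
  interpret prob_space \<mu> using \<mu> by (simp add: is_haar_def)
  have s: "sets \<mu> = sets (padic_borel K)" using \<mu> is_haar_iff[OF K] by blast
  have sp: "space \<mu> = carrier K" using \<mu> by (simp add: is_haar_def)
  have BK: "B \<subseteq> carrier K" using sets.sets_into_space[OF B] sp by simp
  let ?x = "\<lambda>j. of_N j \<odot>\<^bsub>K\<^esub> h"
  let ?B = "\<lambda>j. (\<lambda>x. ?x j \<oplus>\<^bsub>K\<^esub> x) ` B"
  have xj: "?x j \<in> carrier K" for j using h(1) by simp
  have meas: "?B j \<in> sets \<mu>" for j
  proof -
    have "(\<lambda>x. \<ominus>\<^bsub>K\<^esub> ?x j \<oplus>\<^bsub>K\<^esub> x) -` B \<inter> space (padic_borel K) \<in> sets (padic_borel K)"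
      using B s xj by (intro measurable_sets[OF translation_measurable[OF K]]) auto
    then show ?thesis using translate_image[OF K xj BK] s by simp
  qed
  have eqm: "measure \<mu> (?B j) = measure \<mu> B" for j
    using \<mu> B xj[of j] by (simp add: is_haar_def measure_def)
  have disj: "?B i \<inter> ?B j = {}" if "i < j" for i j
  proof (rule ccontr)
    assume "?B i \<inter> ?B j \<noteq> {}"
    then obtain b b' where b: "b \<in> B" "b' \<in> B" "?x i \<oplus>\<^bsub>K\<^esub> b = ?x j \<oplus>\<^bsub>K\<^esub> b'" by blast
    have bK: "b \<in> carrier K" "b' \<in> carrier K" using b BK by auto
    obtain a a' where a: "a \<in> carrier Z" "a \<noteq> \<zero>\<^bsub>Z\<^esub>" "a \<odot>\<^bsub>K\<^esub> b = \<zero>\<^bsub>K\<^esub>"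
      "a' \<in> carrier Z" "a' \<noteq> \<zero>\<^bsub>Z\<^esub>" "a' \<odot>\<^bsub>K\<^esub> b' = \<zero>\<^bsub>K\<^esub>" using torsion b by metis
    have "of_N j = of_N i \<oplus>\<^bsub>Z\<^esub> of_N (j - i)" using that of_N_simps(3)[of i "j - i"] by simp
    then have "?x j = ?x i \<oplus>\<^bsub>K\<^esub> ?x (j - i)" using h(1) by (simp add: K.smult_l_distr)
    then have "?x i \<oplus>\<^bsub>K\<^esub> b = ?x i \<oplus>\<^bsub>K\<^esub> (?x (j - i) \<oplus>\<^bsub>K\<^esub> b')"
      using b(3) xj bK by (simp add: K.M.a_assoc)
    moreover have "y = \<ominus>\<^bsub>K\<^esub> ?x i \<oplus>\<^bsub>K\<^esub> (?x i \<oplus>\<^bsub>K\<^esub> y)" if "y \<in> carrier K" for y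
      using that xj[of i] by (simp add: K.M.a_assoc[symmetric] K.M.l_neg)
    ultimately have "b = ?x (j - i) \<oplus>\<^bsub>K\<^esub> b'" using bK K.M.a_closed[OF xj[of "j - i"] bK(2)] by metis
    then have "(a \<otimes>\<^bsub>Z\<^esub> a') \<odot>\<^bsub>K\<^esub> b = (a \<otimes>\<^bsub>Z\<^esub> a') \<odot>\<^bsub>K\<^esub> ?x (j - i) \<oplus>\<^bsub>K\<^esub> (a \<otimes>\<^bsub>Z\<^esub> a') \<odot>\<^bsub>K\<^esub> b'"
      using a(1,4) xj[of "j - i"] bK by (metis Z.m_closed K.smult_r_distr)
    moreover have "(a \<otimes>\<^bsub>Z\<^esub> a') \<odot>\<^bsub>K\<^esub> b = \<zero>\<^bsub>K\<^esub>"
      using a bK K.smult_assoc1[of a' a b] Z.m_comm[of a a'] by simp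
    moreover have "(a \<otimes>\<^bsub>Z\<^esub> a') \<odot>\<^bsub>K\<^esub> b' = \<zero>\<^bsub>K\<^esub>" using a bK K.smult_assoc1[of a a' b'] by simp
    ultimately have "((a \<otimes>\<^bsub>Z\<^esub> a') \<otimes>\<^bsub>Z\<^esub> of_N (j - i)) \<odot>\<^bsub>K\<^esub> h = \<zero>\<^bsub>K\<^esub>"
      using a(1,4) h(1) xj[of "j - i"] by (simp add: K.smult_assoc1)
    then have "(a \<otimes>\<^bsub>Z\<^esub> a') \<otimes>\<^bsub>Z\<^esub> of_N (j - i) = \<zero>\<^bsub>Z\<^esub>" using h(2) a(1,4) by simp
    then show False
      using D.integral[of "a \<otimes>\<^bsub>Z\<^esub> a'" "of_N (j - i)"] D.integral[of a a'] a of_N_nonzero[of "j - i"] that by auto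
  qed
  have "measure \<mu> B = 0"
  proof (rule ccontr)
    assume "measure \<mu> B \<noteq> 0"
    then have pos: "measure \<mu> B > 0" by (simp add: zero_less_measure_iff)
    obtain N where N: "1 < real N * measure \<mu> B" using reals_Archimedean3[OF pos] by blast
    have "measure \<mu> (\<Union>j\<in>{..<N}. ?B j) = (\<Sum>j\<in>{..<N}. measure \<mu> (?B j))"
    proof (rule finite_measure_finite_Union)
      show "?B ` {..<N} \<subseteq> events" using meas by blast
      show "disjoint_family_on ?B {..<N}"
        unfolding disjoint_family_on_def using disj by (metis Int_commute linorder_neqE_nat)
    qed simp
    also have "\<dots> = real N * measure \<mu> B" using eqm by simp
    finally show False using N prob_le_1[of "\<Union>j\<in>{..<N}. ?B j"] by simp
  qed
  then show ?thesis by (simp add: emeasure_eq_measure)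
qed

lemma rep_X1:
  assumes "c \<in> X1 p"
  obtains H :: zp_module and f where "module Z H" "c = iso_class p H" "finitely_generated Z H" "has_rank Z H 1"
    "module Z (rep c)" "f \<in> module_iso Z (rep c) H"
proof -
  obtain H :: zp_module where H: "c = iso_class p H" "module Z H" "finitely_generated Z H" "has_rank Z H 1"
    using assms by (auto simp: X1_def)
  obtain f where "module Z (rep (iso_class p H))" "f \<in> module_iso Z (rep (iso_class p H)) H"
    using rep_iso_class[OF H(2)] by metis
  then show ?thesis using that H by blast
qed

text \<open>Where the quotient is finite its class is locally constant, so the preimages of subsets of \<open>X0 p\<close>
  are open.  The remaining elements are torsion: for a nontorsion \<open>h\<close>, a power of \<open>p\<close> maps each of
  the finitely many generators into the span of \<open>h\<close>.\<close>

lemma random_quotient_almost_surely_finite: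
  assumes M: "is_matrix p (Suc n) n M" and c: "iso_class p (coker p (Suc n) n M) \<in> X1 p"
  defines "K \<equiv> rep (iso_class p (coker p (Suc n) n M))"
  shows "random_element (haar p K) (\<lambda>h. iso_class p (quot_module K (span Z K {h}))) (X0 p)"
proof -
  let ?g = "\<lambda>h. iso_class p (quot_module K (span Z K {h}))"
  obtain \<psi> where K: "module Z K" and \<psi>: "\<psi> \<in> module_hom Z (V (Suc n)) K" "\<psi> ` carrier (V (Suc n)) = carrier K"
    "\<And>x. x \<in> carrier (V (Suc n)) \<Longrightarrow> \<psi> x = \<zero>\<^bsub>K\<^esub> \<longleftrightarrow> x \<in> mat_vec p (Suc n) n M ` carrier (V n)"
    by (rule rep_presentation[OF M, folded K_def]) (rule that)
  obtain H :: zp_module and f where H: "module Z H" "has_rank Z H 1" and f: "f \<in> module_iso Z K H"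
    by (rule rep_X1[OF c, folded K_def]) (rule that)
  note rank = rank_one_properties[OF K H(1) f H(2)]
  interpret K: Module.module Z K by (rule K)
  have haar: "is_haar p K (haar p K)" by (rule haar_quotient(1)[OF K \<psi>(1,2)])
  have sets: "sets (haar p K) = sets (padic_borel K)" using haar is_haar_iff[OF K] by blast
  have sp: "space (haar p K) = carrier K" using haar by (simp add: is_haar_def)
  \<comment> \<open>Each element of \<open>K\<close> is the image of a column \<open>v\<close>, and its quotient is the cokernel of \<open>?N v\<close>.\<close>
  let ?N = "\<lambda>v (i, j). if j = n then v i else M (i, j)"
  have N: "is_matrix p (Suc n) (Suc n) (?N v)" if "v \<in> carrier (V (Suc n))" for v
    using M V_memb[OF that] by (auto simp: is_matrix_def less_Suc_eq)
  have g: "?g (\<psi> v) = iso_class p (coker p (Suc n) (Suc n) (?N v))"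
    and span_iff: "\<And>x. x \<in> carrier (V (Suc n)) \<Longrightarrow>
      \<psi> x \<in> span Z K {\<psi> v} \<longleftrightarrow> x \<in> mat_vec p (Suc n) (Suc n) (?N v) ` carrier (V (Suc n))"
    if v: "v \<in> carrier (V (Suc n))" for v
    using coker_new_column[OF M K \<psi> v N[OF v]] by auto
  have lift: "\<exists>v\<in>carrier (V (Suc n)). x = \<psi> v" if "x \<in> carrier K" for x
  proof -
    have "x \<in> \<psi> ` carrier (V (Suc n))" using that \<psi>(2) by simp
    then show ?thesis by blast
  qed
  have meas: "?g -` A \<inter> space (haar p K) \<in> sets (haar p K)" if A: "A \<subseteq> X0 p" for A
    unfolding sets
  proof (intro open_in_padic_borel, unfold padic_open_iff_ball[OF K], intro conjI ballI)
    show "?g -` A \<inter> space (haar p K) \<subseteq> carrier K" using sp by blast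
    fix x assume x: "x \<in> ?g -` A \<inter> space (haar p K)"
    then obtain v where v: "v \<in> carrier (V (Suc n))" "x = \<psi> v" using lift sp by blast
    have X0v: "iso_class p (coker p (Suc n) (Suc n) (?N v)) \<in> X0 p" using x v g[OF v(1)] A by auto
    obtain k where k: "\<forall>N'. is_matrix p (Suc n) (Suc n) N' \<and>
      (\<forall>i<Suc n. \<forall>j<Suc n. N' (i, j) k = ?N v (i, j) k) \<longrightarrow> coker p (Suc n) (Suc n) N' = coker p (Suc n) (Suc n) (?N v)"
      using coker_locally_constant[OF N[OF v(1)] X0v] by (rule exE)
    have "y \<in> ?g -` A \<inter> space (haar p K)" if y: "y \<in> padic_ball K k x" for y
    proof -
      obtain z where z: "z \<in> carrier K" "y = x \<oplus>\<^bsub>K\<^esub> of_N (p ^ k) \<odot>\<^bsub>K\<^esub> z" using y unfolding padic_ball_def by blast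
      obtain u where u: "u \<in> carrier (V (Suc n))" "z = \<psi> u" using lift[OF z(1)] by blast
      let ?v = "v \<oplus>\<^bsub>V (Suc n)\<^esub> of_N (p ^ k) \<odot>\<^bsub>V (Suc n)\<^esub> u"
      have v': "?v \<in> carrier (V (Suc n))" using v(1) u(1) by simp
      have "y = \<psi> ?v" using z(2) v u module_homD[OF \<psi>(1)] by simp
      moreover have "?v i k = v i k" if "i < Suc n" for i
      proof -
        have "?v i k = (v i k + 0) mod int p ^ k"
          using that p_power_residue_zero[of k k] by (simp add: Zp_simps(3))
        then show ?thesis using Zp_mod_self[OF V_memb[OF v(1) that]] by simp
      qed
      then have "coker p (Suc n) (Suc n) (?N ?v) = coker p (Suc n) (Suc n) (?N v)"
        by (intro k[rule_format] conjI N[OF v']) simp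
      ultimately have "?g y = ?g x" using g[OF v'] g[OF v(1)] v(2) by simp
      moreover have "y \<in> carrier K" using y ball_props(1)[OF K] x sp by blast
      ultimately show ?thesis using x sp by simp
    qed
    then show "\<exists>k. padic_ball K k x \<subseteq> ?g -` A \<inter> space (haar p K)" by blast
  qed
  have good: "?g h \<in> X0 p" if h: "h \<in> carrier K" and nt: "\<And>a. a \<in> carrier Z \<Longrightarrow> a \<odot>\<^bsub>K\<^esub> h = \<zero>\<^bsub>K\<^esub> \<Longrightarrow> a = \<zero>\<^bsub>Z\<^esub>" for h
  proof -
    obtain v where v: "v \<in> carrier (V (Suc n))" "h = \<psi> v" using lift[OF h] by blast
    let ?S = "span Z K {h}"
    note S = K.submoduleE[OF K.span_singleton(2)[OF h]]
    have "\<exists>l. of_N (p ^ l) \<odot>\<^bsub>K\<^esub> x \<in> ?S" if x: "x \<in> carrier K" for x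
    proof -
      obtain b a where ba: "b \<in> carrier Z" "a \<in> carrier Z" "b \<noteq> \<zero>\<^bsub>Z\<^esub>" "b \<odot>\<^bsub>K\<^esub> x = a \<odot>\<^bsub>K\<^esub> h"
        using rank(2)[OF h nt x] by blast
      obtain l t where t: "t \<in> carrier Z" "t \<otimes>\<^bsub>Z\<^esub> b = of_N (p ^ l)" using p_power_in_ideal[OF ba(1,3)] by blast
      have "of_N (p ^ l) \<odot>\<^bsub>K\<^esub> x = t \<odot>\<^bsub>K\<^esub> (b \<odot>\<^bsub>K\<^esub> x)" using t ba x by (simp flip: t(2) add: K.smult_assoc1)
      also have "\<dots> = (t \<otimes>\<^bsub>Z\<^esub> a) \<odot>\<^bsub>K\<^esub> h" using ba t h by (simp add: K.smult_assoc1)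
      finally show ?thesis unfolding K.span_singleton(1)[OF h] using t(1) ba(2) by blast
    qed
    then have "\<forall>j. \<exists>l. of_N (p ^ l) \<odot>\<^bsub>K\<^esub> \<psi> (unit_vec (Suc n) j) \<in> ?S"
      using module_homD(1)[OF \<psi>(1) unit_vec_closed] by blast
    then obtain l where l: "\<And>j. of_N (p ^ l j) \<odot>\<^bsub>K\<^esub> \<psi> (unit_vec (Suc n) j) \<in> ?S" by metis
      \<comment> \<open>Any common upper bound of the exponents \<open>l j\<close> will do.\<close>
  define k where "k = (\<Sum>j<Suc n. l j)"
    have pk: "of_N (p ^ k) \<odot>\<^bsub>K\<^esub> \<psi> (unit_vec (Suc n) j) \<in> ?S" if "j < Suc n" for j
    proof -
      have "l j \<le> k" unfolding k_def using that by (intro member_le_sum) auto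
      then have "of_N (p ^ k) = of_N (p ^ (k - l j)) \<otimes>\<^bsub>Z\<^esub> of_N (p ^ l j)"
        using of_N_simps(4)[of "p ^ (k - l j)" "p ^ l j"] by (simp flip: power_add)
      then have "of_N (p ^ k) \<odot>\<^bsub>K\<^esub> \<psi> (unit_vec (Suc n) j) = of_N (p ^ (k - l j)) \<odot>\<^bsub>K\<^esub> (of_N (p ^ l j) \<odot>\<^bsub>K\<^esub> \<psi> (unit_vec (Suc n) j))"
        using module_homD(1)[OF \<psi>(1) unit_vec_closed] by (simp add: K.smult_assoc1)
      then show ?thesis using S(4)[OF of_N_closed l] by simp
    qed
    have "of_N (p ^ k) \<odot>\<^bsub>V (Suc n)\<^esub> u \<in> mat_vec p (Suc n) (Suc n) (?N v) ` carrier (V (Suc n))"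
      if u: "u \<in> carrier (V (Suc n))" for u
    proof -
      have "of_N (p ^ k) \<odot>\<^bsub>K\<^esub> \<psi> u = lincomb (Suc n) K (\<lambda>j. of_N (p ^ k) \<odot>\<^bsub>K\<^esub> \<psi> (unit_vec (Suc n) j)) u"
        by (rule hom_eq_lincomb[OF module_hom_comp[OF \<psi>(1) module_hom_smult[OF K of_N_closed]] K u])
      also have "\<dots> \<in> ?S" by (rule lincomb_submodule[OF K K.span_singleton(2)[OF h] pk V_Pi[OF u]])
      finally have "\<psi> (of_N (p ^ k) \<odot>\<^bsub>V (Suc n)\<^esub> u) \<in> span Z K {\<psi> v}"
        using module_homD(3)[OF \<psi>(1) of_N_closed u] v(2) by simp
      then show ?thesis using span_iff[OF v(1), of "of_N (p ^ k) \<odot>\<^bsub>V (Suc n)\<^esub> u"] u by simp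
    qed
    then have "iso_class p (coker p (Suc n) (Suc n) (?N v)) \<in> X0 p" using coker_X0_iff[OF N[OF v(1)]] by blast
    then show ?thesis using g[OF v(1)] v(2) by simp
  qed
  let ?B = "space (haar p K) - (?g -` X0 p \<inter> space (haar p K))"
  have Bm: "?B \<in> sets (haar p K)" using meas[of "X0 p"] by (intro sets.compl_sets) simp
  obtain h0 where h0: "h0 \<in> carrier K" "\<And>a. a \<in> carrier Z \<Longrightarrow> a \<odot>\<^bsub>K\<^esub> h0 = \<zero>\<^bsub>K\<^esub> \<Longrightarrow> a = \<zero>\<^bsub>Z\<^esub>" using rank(1) by blast
  have "emeasure (haar p K) ?B = 0"
  proof (rule torsion_null[OF K haar Bm _ h0])
    fix x assume "x \<in> ?B"
    then have "x \<in> carrier K" "?g x \<notin> X0 p" using sp by auto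
    then show "\<exists>a\<in>carrier Z. a \<noteq> \<zero>\<^bsub>Z\<^esub> \<and> a \<odot>\<^bsub>K\<^esub> x = \<zero>\<^bsub>K\<^esub>" using good[of x] by blast
  qed
  then have "AE h in haar p K. ?g h \<in> X0 p"
    using Bm by (intro AE_I[of _ _ ?B]) auto
  then show ?thesis using meas unfolding random_element_def by blast
qed

section \<open>Random rows and random columns\<close>

lemma adjoin_column:
  assumes P: "prob_space P" and M: "is_matrix p (Suc n) n M"
    and H: "iso_class p (coker p (Suc n) n M) \<in> X1 p" and X: "indep_haar p P X ({..n} \<times> {n})"
  shows "distributed_as P (\<lambda>w. iso_class p (coker p (Suc n) (Suc n) (override_on M (\<lambda>ij. X ij w) ({..n} \<times> {n}))))
    (X0 p) (op_d p (iso_class p (coker p (Suc n) n M)))"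
proof -
  define K where "K = rep (iso_class p (coker p (Suc n) n M))"
  obtain \<psi> where K: "module Z K" and \<psi>: "\<psi> \<in> module_hom Z (V (Suc n)) K" "\<psi> ` carrier (V (Suc n)) = carrier K"
    "\<And>x. x \<in> carrier (V (Suc n)) \<Longrightarrow> \<psi> x = \<zero>\<^bsub>K\<^esub> \<longleftrightarrow> x \<in> mat_vec p (Suc n) n M ` carrier (V n)"
    by (rule rep_presentation[OF M, folded K_def]) (rule that)
  let ?\<nu> = "haar_family {..<Suc n}" and ?C = "\<lambda>w. \<lambda>i\<in>{..<Suc n}. X (i, n) w"
  have im: "(\<lambda>i. (i, n)) ` {..<Suc n} = {..n} \<times> {n}" by auto
  have C: "?C \<in> measurable P ?\<nu>" "distr P ?\<nu> ?C = ?\<nu>"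
    using indep_haar_distr[OF P, of X "\<lambda>i. (i, n)" "{..<Suc n}"] X unfolding im by (auto simp: inj_on_def)
  note hq = haar_quotient[OF K \<psi>(1,2)]
  have m: "(\<lambda>w. \<psi> (?C w)) \<in> measurable P (haar p K)" by (rule measurable_compose[OF C(1) hq(2)])
  have d: "distr P (haar p K) (\<lambda>w. \<psi> (?C w)) = haar p K"
    using distr_distr[OF hq(2) C(1)] C(2) hq(3) by (simp add: comp_def)
  have "distributed_as P (\<lambda>w. iso_class p (coker p (Suc n) (Suc n) (override_on M (\<lambda>ij. X ij w) ({..n} \<times> {n}))))
    (X0 p) (law (haar p K) (\<lambda>h. iso_class p (quot_module K (span Z K {h}))) (X0 p))"
  proof (rule distributed_as_pullback[OF m d refl])
    show "random_element (haar p K) (\<lambda>h. iso_class p (quot_module K (span Z K {h}))) (X0 p)"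
      unfolding K_def by (rule random_quotient_almost_surely_finite[OF M H])
    fix w assume "w \<in> space P"
    then have c: "?C w \<in> carrier (V (Suc n))" using measurable_space[OF C(1)] by (simp add: space_haar_V[symmetric] del: space_haar_family)
    let ?N = "override_on M (\<lambda>ij. X ij w) ({..n} \<times> {n})"
    have col: "?N (i, n) = ?C w i" if "i < Suc n" for i using that by (simp add: override_on_def)
    have old: "?N (i, j) = M (i, j)" if "j < n" for i j using that by (simp add: override_on_def)
    have Nm: "is_matrix p (Suc n) (Suc n) ?N"
      unfolding is_matrix_def
    proof (intro allI impI)
      fix i j assume ij: "i < Suc n" "j < Suc n"
      show "?N (i, j) \<in> carrier Z"
      proof (cases "j = n")
        case True then show ?thesis using col[OF ij(1)] V_memb[OF c ij(1)] by simp
      next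
        case False then show ?thesis using old[of j i] ij M by (simp add: is_matrix_def)
      qed
    qed
    show "iso_class p (coker p (Suc n) (Suc n) ?N) = iso_class p (quot_module K (span Z K {\<psi> (?C w)}))"
      by (rule coker_new_column(1)[OF M K \<psi> c Nm old col])
  qed
  then show ?thesis unfolding op_d_def K_def .
qed

lemma adjoin_row:
  assumes P: "prob_space P" and M: "is_matrix p n n M"
    and G: "iso_class p (coker p n n M) \<in> X0 p" and X: "indep_haar p P X ({n} \<times> {..<n})"
  shows "distributed_as P (\<lambda>w. iso_class p (coker p (Suc n) n (override_on M (\<lambda>ij. X ij w) ({n} \<times> {..<n}))))
    (X1 p) (op_dstar p (iso_class p (coker p n n M)))"
    and "\<And>w. w \<in> space P \<Longrightarrow> is_matrix p (Suc n) n (override_on M (\<lambda>ij. X ij w) ({n} \<times> {..<n}))"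
    and "\<And>w. w \<in> space P \<Longrightarrow>
      iso_class p (coker p (Suc n) n (override_on M (\<lambda>ij. X ij w) ({n} \<times> {..<n}))) \<in> X1 p"
proof -
  define K where "K = rep (iso_class p (coker p n n M))"
  obtain \<psi> where K: "module Z K" and \<psi>: "\<psi> \<in> module_hom Z (V n) K" "\<psi> ` carrier (V n) = carrier K"
    "\<And>x. x \<in> carrier (V n) \<Longrightarrow> \<psi> x = \<zero>\<^bsub>K\<^esub> \<longleftrightarrow> x \<in> mat_vec p n n M ` carrier (V n)"
    by (rule rep_presentation[OF M, folded K_def]) (rule that)
  obtain k where k: "\<And>v. v \<in> carrier (V n) \<Longrightarrow> of_N (p ^ k) \<odot>\<^bsub>V n\<^esub> v \<in> mat_vec p n n M ` carrier (V n)"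
    using G coker_X0_iff[OF M] by blast
  interpret F: finite_presentation p n M K \<psi> k
  proof (intro finite_presentation.intro finite_presentation_axioms.intro padic_axioms M K \<psi>)
    fix x assume "x \<in> carrier K"
    then have "x \<in> \<psi> ` carrier (V n)" using \<psi>(2) by simp
    then obtain v where v: "v \<in> carrier (V n)" "x = \<psi> v" by blast
    have "\<psi> (of_N (p ^ k) \<odot>\<^bsub>V n\<^esub> v) = \<zero>\<^bsub>K\<^esub>" using \<psi>(3)[of "of_N (p ^ k) \<odot>\<^bsub>V n\<^esub> v"] k[OF v(1)] v(1) by simp
    then show "of_N (p ^ k) \<odot>\<^bsub>K\<^esub> x = \<zero>\<^bsub>K\<^esub>" using module_homD(3)[OF \<psi>(1) of_N_closed v(1)] v(2) by simp
  qed
  let ?\<nu> = "haar_family {..<n}" and ?R = "\<lambda>w. \<lambda>j\<in>{..<n}. X (n, j) w" and ?U = "uniform_count_measure (Ext p K)"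
  have im: "(\<lambda>j. (n, j)) ` {..<n} = {n} \<times> {..<n}" by auto
  have R: "?R \<in> measurable P ?\<nu>" "distr P ?\<nu> ?R = ?\<nu>"
    using indep_haar_distr[OF P, of X "\<lambda>j. (n, j)" "{..<n}"] X unfolding im by (auto simp: inj_on_def)
  have m: "(\<lambda>w. F.ext_of_row (?R w)) \<in> measurable P ?U" by (rule measurable_compose[OF R(1) F.ext_of_row_uniform(1)])
  have d: "distr P ?U (\<lambda>w. F.ext_of_row (?R w)) = ?U"
    using distr_distr[OF F.ext_of_row_uniform(1) R(1)] R(2) F.ext_of_row_uniform(2) by (simp add: comp_def)
  have row: "?R w \<in> carrier (V n)" if "w \<in> space P" for w
    using that measurable_space[OF R(1)] by (simp add: space_haar_V[symmetric] del: space_haar_family)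
  have old: "override_on M f ({n} \<times> {..<n}) (i, j) = M (i, j)" if "i < n" for f i j
    using that by (simp add: override_on_def)
  have new: "override_on M (\<lambda>ij. X ij w) ({n} \<times> {..<n}) (n, j) = ?R w j" if "j < n" for w j
    using that by (simp add: override_on_def)
  show N: "is_matrix p (Suc n) n (override_on M (\<lambda>ij. X ij w) ({n} \<times> {..<n}))" if w: "w \<in> space P" for w
    unfolding is_matrix_def
  proof (intro allI impI)
    fix i j assume ij: "i < Suc n" "j < n"
    show "override_on M (\<lambda>ij. X ij w) ({n} \<times> {..<n}) (i, j) \<in> carrier Z"
    proof (cases "i = n")
      case True then show ?thesis using new[OF ij(2), of w] V_memb[OF row[OF w] ij(2)] by simp
    next
      case False then show ?thesis using old[of i _ j] ij M by (simp add: is_matrix_def)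
    qed
  qed
  note mc = F.middle_class_of_row[OF row N old new]
  show X1: "iso_class p (coker p (Suc n) n (override_on M (\<lambda>ij. X ij w) ({n} \<times> {..<n}))) \<in> X1 p"
    if "w \<in> space P" for w using mc(2)[OF that that] .
  have "distributed_as P (\<lambda>w. iso_class p (coker p (Suc n) n (override_on M (\<lambda>ij. X ij w) ({n} \<times> {..<n}))))
    (X1 p) (law ?U (middle_class p) (X1 p))"
  proof (rule distributed_as_pullback[OF m d refl])
    have "middle_class p e \<in> X1 p" if "e \<in> Ext p K" for e
    proof -
      obtain r where r: "r \<in> carrier (V n)" "e = F.ext_of_row r" using \<open>e \<in> Ext p K\<close> F.Ext_eq by blast
      let ?N = "\<lambda>(i, j). if i = n then r j else M (i, j)"
      have "is_matrix p (Suc n) n ?N" using M V_memb[OF r(1)] by (auto simp: is_matrix_def less_Suc_eq)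
      then have "middle_class p (F.ext_of_row r) = iso_class p (coker p (Suc n) n ?N)"
        "iso_class p (coker p (Suc n) n ?N) \<in> X1 p"
        using F.middle_class_of_row[OF r(1), of ?N] by auto
      then show ?thesis using r(2) by simp
    qed
    then show "random_element ?U (middle_class p) (X1 p)"
      unfolding random_element_def
      by (intro conjI allI impI AE_I2) (auto simp: sets_uniform_count_measure space_uniform_count_measure)
    fix w assume w: "w \<in> space P"
    show "iso_class p (coker p (Suc n) n (override_on M (\<lambda>ij. X ij w) ({n} \<times> {..<n})))
      = middle_class p (F.ext_of_row (?R w))" by (rule mc(1)[OF w w, symmetric])
  qed
  then show "distributed_as P (\<lambda>w. iso_class p (coker p (Suc n) n (override_on M (\<lambda>ij. X ij w) ({n} \<times> {..<n}))))
    (X1 p) (op_dstar p (iso_class p (coker p n n M)))" unfolding op_dstar_def K_def .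
qed

text \<open>The monadic composition requires \<open>op_d p c\<close> to be a subprobability measure for every \<open>c\<close> in
  \<open>X1 p\<close>, also for those that do not come from a matrix under consideration.\<close>

lemma op_d_subprob:
  assumes c: "c \<in> X1 p" and X0: "X0 p \<noteq> {}"
  shows "op_d p c \<in> space (subprob_algebra (count_space (X0 p)))"
proof -
  obtain H :: zp_module and f where H: "module Z H" "finitely_generated Z H" and K: "module Z (rep c)"
    and f: "f \<in> module_iso Z (rep c) H" by (rule rep_X1[OF c]) (rule that)
  obtain m \<psi> where \<psi>: "\<psi> \<in> module_hom Z (V m) H" "\<psi> ` carrier (V m) = carrier H"
    using H(2) finitely_generated_iff[OF H(1)] by blast
  obtain g where g: "g \<in> module_iso Z H (rep c)" using module_iso_inverse[OF K H(1) f] by metis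
  have "is_haar p (rep c) (haar p (rep c))"
  proof (rule haar_quotient(1)[OF K module_hom_comp[OF \<psi>(1) module_isoD(1)[OF g]]])
    show "(\<lambda>x. g (\<psi> x)) ` carrier (V m) = carrier (rep c)"
      using \<psi>(2) module_isoD(2)[OF g] by (metis image_image)
  qed
  then have "prob_space (haar p (rep c))" by (simp add: is_haar_def)
  then show ?thesis unfolding op_d_def space_subprob_algebra using subprob_law[OF _ X0] by simp
qed

lemma adjoin_row_and_column:
  assumes P: "prob_space P" and M: "is_matrix p n n M"
    and G: "iso_class p (coker p n n M) \<in> X0 p" and X: "indep_haar p P X ({n} \<times> {..n} \<union> {..n} \<times> {n})"
  shows "distributed_as P (\<lambda>w. iso_class p (coker p (Suc n) (Suc n)
      (override_on M (\<lambda>ij. X ij w) ({n} \<times> {..n} \<union> {..n} \<times> {n}))))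
    (X0 p) (op_Delta0 p (iso_class p (coker p n n M)))"
proof -
  define I J where "I = {n} \<times> {..<n}" and "J = {..n} \<times> {n}"
  have IJ: "{n} \<times> {..n} \<union> {..n} \<times> {n} = I \<union> J" "I \<inter> J = {}" "finite I" "finite J"
    by (auto simp: I_def J_def less_le)
  let ?c = "iso_class p (coker p n n M)"
  let ?Q = "haar_family (I \<union> J)" and ?QI = "haar_family I" and ?QJ = "haar_family J"
  interpret ps: product_prob_space "\<lambda>_. \<mu>Z" "I \<union> J" by (intro product_prob_spaceI prob_\<mu>Z)
  have pQI: "prob_space ?QI" and pQJ: "prob_space ?QJ" and pQ: "prob_space ?Q" by (rule prob_haar_family)+
  define N where "N \<omega> = override_on M \<omega> (I \<union> J)" for \<omega> :: "nat \<times> nat \<Rightarrow> zp"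
  define F where "F \<omega> = iso_class p (coker p (Suc n) (Suc n) (N \<omega>))" for \<omega>
  define h where "h r = iso_class p (coker p (Suc n) n (override_on M r I))" for r
  have N: "is_matrix p (Suc n) (Suc n) (N \<omega>)" if "\<omega> \<in> I \<union> J \<rightarrow>\<^sub>E carrier Z" for \<omega>
    unfolding is_matrix_def N_def
  proof (intro allI impI)
    fix i j assume ij: "i < Suc n" "j < Suc n"
    show "override_on M \<omega> (I \<union> J) (i, j) \<in> carrier Z"
    proof (cases "(i, j) \<in> I \<union> J")
      case True then show ?thesis using PiE_mem[OF that True] by simp
    next
      case False
      then have "i < n" "j < n" using ij by (auto simp: I_def J_def)
      then show ?thesis using False M by (simp add: is_matrix_def)
    qed
  qed
  have meas: "F -` A \<inter> space ?Q \<in> sets ?Q" if A: "A \<subseteq> X0 p" for A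
  proof (rule locally_constant_sets)
    fix \<omega> assume "\<omega> \<in> F -` A \<inter> space ?Q"
    then have \<omega>: "\<omega> \<in> I \<union> J \<rightarrow>\<^sub>E carrier Z" "F \<omega> \<in> A" by auto
    then have X0\<omega>: "iso_class p (coker p (Suc n) (Suc n) (N \<omega>)) \<in> X0 p" using A by (auto simp: F_def)
    obtain k where k: "\<forall>N'. is_matrix p (Suc n) (Suc n) N' \<and>
      (\<forall>i<Suc n. \<forall>j<Suc n. N' (i, j) k = N \<omega> (i, j) k) \<longrightarrow> coker p (Suc n) (Suc n) N' = coker p (Suc n) (Suc n) (N \<omega>)"
      using coker_locally_constant[OF N[OF \<omega>(1)] X0\<omega>] by (rule exE)
    have "F \<omega>' = F \<omega>" if \<omega>': "\<omega>' \<in> I \<union> J \<rightarrow>\<^sub>E carrier Z" "\<forall>ij\<in>I \<union> J. \<omega>' ij k = \<omega> ij k" for \<omega>'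
    proof -
      have "N \<omega>' (i, j) k = N \<omega> (i, j) k" for i j using \<omega>'(2) by (simp add: N_def override_on_def)
      then show ?thesis unfolding F_def using k N[OF \<omega>'(1)] by simp
    qed
    then show "\<exists>k. \<forall>\<omega>'\<in>I \<union> J \<rightarrow>\<^sub>E carrier Z. (\<forall>ij\<in>I \<union> J. \<omega>' ij k = \<omega> ij k) \<longrightarrow> \<omega>' \<in> F -` A \<inter> space ?Q"
      using \<omega>(2) by (intro exI[of _ k]) simp
  qed (use IJ in auto)
  have XI: "indep_haar p ?QI (\<lambda>ij r. r ij) ({n} \<times> {..<n})" and XJ: "indep_haar p ?QJ (\<lambda>ij y. y ij) ({..n} \<times> {n})"
    using indep_haar_coordinates[OF IJ(3)] indep_haar_coordinates[OF IJ(4)] unfolding I_def J_def by auto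
  note row = adjoin_row[OF pQI M G XI, folded I_def]
  have h_X1: "h r \<in> X1 p" if "r \<in> space ?QI" for r using row(3)[OF that] by (simp add: h_def)
  have slice: "random_element ?QJ (\<lambda>y. F (merge I J (r, y))) (X0 p) \<and> law ?QJ (\<lambda>y. F (merge I J (r, y))) (X0 p) = op_d p (h r)"
    if r: "r \<in> space ?QI" for r
  proof -
    have "override_on (override_on M r I) y J = N (merge I J (r, y))" for y
      using IJ(2) by (auto simp: fun_eq_iff N_def override_on_def merge_def)
    then show ?thesis
      using adjoin_column[OF pQJ row(2)[OF r] row(3)[OF r] XJ, folded J_def]
      by (simp add: F_def h_def distributed_as_def)
  qed
  have em: "emeasure ?Q (F -` A \<inter> space ?Q) = (\<integral>\<^sup>+r. emeasure (op_d p (h r)) A \<partial>?QI)" if A: "A \<subseteq> X0 p" for A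
  proof -
    have "emeasure ?Q (F -` A \<inter> space ?Q)
      = (\<integral>\<^sup>+r. emeasure ?QJ ((\<lambda>y. merge I J (r, y)) -` (F -` A \<inter> space ?Q) \<inter> space ?QJ) \<partial>?QI)"
      by (rule ps.emeasure_fold_integral[OF IJ(2-4) meas[OF A]])
    also have "\<dots> = (\<integral>\<^sup>+r. emeasure (op_d p (h r)) A \<partial>?QI)"
    proof (rule nn_integral_cong)
      fix r assume r: "r \<in> space ?QI"
      have "(\<lambda>y. merge I J (r, y)) -` (F -` A \<inter> space ?Q) \<inter> space ?QJ
        = (\<lambda>y. F (merge I J (r, y))) -` A \<inter> space ?QJ"
      proof -
        have "merge I J (r, y) \<in> space ?Q" if "y \<in> space ?QJ" for y
          using r that IJ(2) by (auto simp: PiE_iff merge_def extensional_def)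
        then show ?thesis by blast
      qed
      then show "emeasure ?QJ ((\<lambda>y. merge I J (r, y)) -` (F -` A \<inter> space ?Q) \<inter> space ?QJ) = emeasure (op_d p (h r)) A"
        using slice[OF r] emeasure_law[OF A, of "\<lambda>y. F (merge I J (r, y))" ?QJ] by (simp add: random_element_def)
    qed
    finally show ?thesis .
  qed
  have one: "emeasure (op_d p (h r)) (X0 p) = 1" if r: "r \<in> space ?QI" for r
  proof -
    let ?f = "\<lambda>y. F (merge I J (r, y))"
    have re: "random_element ?QJ ?f (X0 p)" and l: "law ?QJ ?f (X0 p) = op_d p (h r)" using slice[OF r] by auto
    have "emeasure (op_d p (h r)) (X0 p) = emeasure ?QJ (?f -` X0 p \<inter> space ?QJ)"
      using emeasure_law[of "X0 p" "X0 p" ?f ?QJ] re l by (simp add: random_element_def)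
    also have "\<dots> = 1"
    proof (rule prob_space.emeasure_eq_1_AE[OF pQJ])
      show "?f -` X0 p \<inter> space ?QJ \<in> sets ?QJ" using re unfolding random_element_def by blast
      have "AE y in ?QJ. ?f y \<in> X0 p" using re unfolding random_element_def by blast
      then show "AE y in ?QJ. y \<in> ?f -` X0 p \<inter> space ?QJ" by (rule AE_mp) (intro AE_I2 impI, simp)
    qed
    finally show ?thesis .
  qed
  have reF: "random_element ?Q F (X0 p)"
  proof -
    have "emeasure ?Q (F -` X0 p \<inter> space ?Q) = (\<integral>\<^sup>+r. 1 \<partial>?QI)"
      unfolding em[OF order_refl] using one by (intro nn_integral_cong) simp
    then have "emeasure ?Q (F -` X0 p \<inter> space ?Q) = 1" using prob_space.emeasure_space_1[OF pQI] by simp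
    then have "measure ?Q (F -` X0 p \<inter> space ?Q) = 1" by (simp add: measure_def)
    then have "AE \<omega> in ?Q. \<omega> \<in> F -` X0 p \<inter> space ?Q" by (rule prob_space.AE_prob_1[OF pQ])
    then have "AE \<omega> in ?Q. F \<omega> \<in> X0 p" by (rule AE_mp) (intro AE_I2, simp)
    then show ?thesis using meas by (simp add: random_element_def)
  qed
  have law_F: "law ?Q F (X0 p) = op_Delta0 p ?c"
  proof -
    have dst: "random_element ?QI h (X1 p)" "law ?QI h (X1 p) = op_dstar p ?c"
      using row(1) by (auto simp: distributed_as_def h_def[abs_def])
    have X0: "X0 p \<noteq> {}" using G by blast
    obtain r0 where "r0 \<in> space ?QI" using prob_space.not_empty[OF pQI] by blast
    then have X1: "X1 p \<noteq> {}" using h_X1 by blast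
    have sp: "space (op_dstar p ?c) = X1 p" "sets (op_dstar p ?c) = Pow (X1 p)"
      unfolding dst(2)[symmetric] by simp_all
    have md: "op_d p \<in> measurable (op_dstar p ?c) (subprob_algebra (count_space (X0 p)))"
      using op_d_subprob[OF _ X0] sp by (intro measurableI) auto
    show ?thesis
    proof (rule measure_eqI)
      have "sets (op_dstar p ?c \<bind> op_d p) = sets (count_space (X0 p))"
      proof (rule sets_bind)
        show "sets (op_d p x) = sets (count_space (X0 p))" for x by (simp add: op_d_def)
      qed (use sp X1 in simp)
      then show "sets (law ?Q F (X0 p)) = sets (op_Delta0 p ?c)" by (simp add: op_Delta0_def)
      fix A assume "A \<in> sets (law ?Q F (X0 p))"
      then have A: "A \<subseteq> X0 p" by simp
      have "emeasure (op_Delta0 p ?c) A = (\<integral>\<^sup>+x. emeasure (op_d p x) A \<partial>op_dstar p ?c)"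
        unfolding op_Delta0_def using sp X1 A by (intro emeasure_bind[OF _ md]) auto
      also have "\<dots> = (\<integral>\<^sup>+x. emeasure (op_d p x) A \<partial>distr ?QI (count_space (X1 p)) h)"
        using law_surely(2)[OF dst(1) h_X1] dst(2) by simp
      also have "\<dots> = (\<integral>\<^sup>+r. emeasure (op_d p (h r)) A \<partial>?QI)"
        using law_surely(1)[OF dst(1) h_X1] by (subst nn_integral_distr) auto
      also have "\<dots> = emeasure (law ?Q F (X0 p)) A"
        using em[OF A] emeasure_law[OF A meas] by simp
      finally show "emeasure (law ?Q F (X0 p)) A = emeasure (op_Delta0 p ?c) A" by simp
    qed
  qed
  let ?h = "\<lambda>w. \<lambda>ij\<in>I \<union> J. X ij w"
  have hm: "?h \<in> measurable P ?Q" "distr P ?Q ?h = ?Q"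
    using indep_haar_distr[OF P, of X "\<lambda>ij. ij" "I \<union> J"] X IJ by (auto simp: inj_on_def)
  have "distributed_as P (\<lambda>w. iso_class p (coker p (Suc n) (Suc n) (override_on M (\<lambda>ij. X ij w) (I \<union> J))))
    (X0 p) (law ?Q F (X0 p))"
  proof (rule distributed_as_pullback[OF hm refl reF])
    fix w
    have "override_on M (\<lambda>ij. X ij w) (I \<union> J) = N (?h w)"
      by (auto simp: fun_eq_iff N_def override_on_def)
    then show "iso_class p (coker p (Suc n) (Suc n) (override_on M (\<lambda>ij. X ij w) (I \<union> J))) = F (?h w)"
      by (simp add: F_def)
  qed
  then show ?thesis unfolding law_F IJ(1) .
qed

end

theorem theorem1p1:
  fixes p :: nat and P :: "'w measure"
  assumes "prime p" and "prob_space P"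
  shows
    "(\<forall>n M G X.
        is_matrix p n n M \<and> G \<in> X0 p \<and> iso_class p (coker p n n M) = G \<and>
        indep_haar p P X ({n} \<times> {..<n}) \<longrightarrow>
        distributed_as P
          (\<lambda>w. iso_class p (coker p (n + 1) n
             (override_on M (\<lambda>ij. X ij w) ({n} \<times> {..<n}))))
          (X1 p) (op_dstar p G))
     \<and>
     (\<forall>n M H X.
        is_matrix p (n + 1) n M \<and> H \<in> X1 p \<and> iso_class p (coker p (n + 1) n M) = H \<and>
        indep_haar p P X ({..n} \<times> {n}) \<longrightarrow>
        distributed_as P
          (\<lambda>w. iso_class p (coker p (n + 1) (n + 1)
             (override_on M (\<lambda>ij. X ij w) ({..n} \<times> {n}))))
          (X0 p) (op_d p H))
     \<and>
     (\<forall>n M G X.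
        is_matrix p n n M \<and> G \<in> X0 p \<and> iso_class p (coker p n n M) = G \<and>
        indep_haar p P X ({n} \<times> {..n} \<union> {..n} \<times> {n}) \<longrightarrow>
        distributed_as P
          (\<lambda>w. iso_class p (coker p (n + 1) (n + 1)
             (override_on M (\<lambda>ij. X ij w) ({n} \<times> {..n} \<union> {..n} \<times> {n}))))
          (X0 p) (op_Delta0 p G))"
proof -
  interpret padic p by unfold_locales (rule assms(1))
  show ?thesis
    unfolding Suc_eq_plus1[symmetric]
    using adjoin_row(1)[OF assms(2)] adjoin_column[OF assms(2)] adjoin_row_and_column[OF assms(2)] by blast
qed

end
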